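(* Let $\alpha\in\mathbb{R}$, $\theta\in(0,1)$, and let $(X_t)_{t\in\mathbb{N}}$ be given by $X_0=0$ and $X_t=\alpha+\theta X_{t-1}+\xi_t$ for $t\ge 1$, where $\xi=(\xi_t)_{t\in\mathbb{Z}}$ is a zero-mean stationary Gaussian sequence whose covariance function $R_\xi(k)=E(\xi_0\xi_k)$ satisfies $R_\xi(k)\sim C|k|^{2H-2}$ as $k\to\infty$ for some constant $C>0$, and suppose $H\in(\frac12,\frac34)$. With $f$, $Y_t$, $\hat\theta_n$, $\hat\alpha_n$ as defined in the context, set $$\sigma_H^2=2\sum_{k\in\mathbb{Z}}R_Y^2(k),\quad R_Y(k)=E(Y_tY_{t+k}),\qquad \sigma_1^2=[H(2H-1)]^{-1}\pi^{-1}B(2H-1,2-2H)\sin(2\pi H-\pi),$$ where $B$ is the Beta function. Then, as $n\to\infty$: (1) $\sqrt n(\hat\theta_n-\theta)\xrightarrow{law}\mathcal N\Big(0,\dfrac{\sigma_H^2}{[f'(\theta)]^2}\Big)$, where $f'(\theta)$ is the derivative of $f(\theta)$; (2) $n^{1-H}(\hat\alpha_n-\alpha)\xrightarrow{law}\mathcal N(0,\sigma_1^2)$; (3) with $G_{n,1}:=\sqrt n(\hat\theta_n-\theta)$ and $G_{n,2}:=n^{1-H}(\hat\alpha_n-\alpha)$, $$(G_{n,1},G_{n,2})\xrightarrow{law}\mathcal N_2(0,\Sigma),\qquad \Sigma=\begin{pmatrix}\frac{\sigma_H^2}{[f'(\theta)]^2}&0\\0&\sigma_1^2\end{pmatrix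}.$$
   Context: Notation: $a_k\sim b_k$ means $a_k/b_k\to1$; $\mathcal N_2(0,\Sigma)$ is the law of a centered Gaussian vector in $\mathbb{R}^2$ with covariance matrix $\Sigma$. Put $Y_t:=\sum_{j=0}^\infty\theta^j\xi_{t-j}$, a stationary zero-mean Gaussian process. Its second moment, as a function of $\theta\in(0,1)$, is $$f(\theta):=E(Y_t^2)=\sum_{i,j=0}^\infty\theta^{i+j}R_\xi(i-j).$$ For $0<\theta<1$ the function $f$ is taken to be positive and strictly increasing, and $f^{-1}$ denotes its inverse function. Let $\bar X:=\frac1n\sum_{t=1}^nX_t$. The estimators are $$\hat\theta_n:=f^{-1}\Big(\frac1n\sum_{t=1}^n(X_t-\bar X)^2\Big),\qquad \hat\alpha_n:=(1-\hat\theta_n)\bar X.$$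
   Formalization: In (2) and (3) the limit variance is Cσ_1² instead of σ_1²: as printed the claim fails unless C=1 (e.g. fractional Gaussian noise, C=H(2H-1), where the true limit variance is 1). Also f'(θ)≠0 is assumed explicitly, as needed to divide by [f'(θ)]². *)

theory Defs
  imports "HOL-Probability.Probability" "HOL-Library.Landau_Symbols"
begin

section \<open>Gaussian laws and convergence in law\<close>

text \<open>The second argument is the variance, not the standard deviation; variance 0 gives a point
  mass, so that degenerate linear combinations of a Gaussian sequence are covered.\<close>

definition normal_law :: "real \<Rightarrow> real \<Rightarrow> real measure" where
  "normal_law m v =
     (if v = 0 then return borel m else density lborel (\<lambda>x. ennreal (normal_density m (sqrt v) x)))"

text \<open>The centered Gaussian law with covariance matrix \<open>S\<close>, given by its Lebesgue density; meaningful
  only for (symmetric) positive definite \<open>S\<close>.\<close>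

definition mv_normal_law :: "real^'n^'n \<Rightarrow> (real^'n) measure" where
  "mv_normal_law S =
     density lborel (\<lambda>x. ennreal
       (exp (- (x \<bullet> (matrix_inv S *v x)) / 2) / sqrt ((2 * pi) ^ CARD('n) * det S)))"

text \<open>The library's \<^const>\<open>weak_conv_m\<close> is for laws on the real line only; this is the
  bounded-continuous-function form of convergence in law for vectors.\<close>

definition converges_in_law ::
    "'a measure \<Rightarrow> (nat \<Rightarrow> 'a \<Rightarrow> 'b::topological_space) \<Rightarrow> 'b measure \<Rightarrow> bool" where
  "converges_in_law M G L \<longleftrightarrow>
     (\<forall>n. G n \<in> borel_measurable M) \<and>
     (\<forall>g :: 'b \<Rightarrow> real. continuous_on UNIV g \<longrightarrow> bounded (range g) \<longrightarrow>
        (\<lambda>n. \<integral>\<omega>. g (G n \<omega>) \<partial>M) \<longlonglongrightarrow> (\<integral>x. g x \<partial>L))"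

section \<open>Stationary Gaussian sequences\<close>

definition gaussian_rv :: "'a measure \<Rightarrow> ('a \<Rightarrow> real) \<Rightarrow> bool" where
  "gaussian_rv M Z \<longleftrightarrow>
     Z \<in> borel_measurable M \<and> (\<exists>m v. 0 \<le> v \<and> distr M borel Z = normal_law m v)"

definition gaussian_seq :: "'a measure \<Rightarrow> (int \<Rightarrow> 'a \<Rightarrow> real) \<Rightarrow> bool" where
  "gaussian_seq M \<xi> \<longleftrightarrow>
     (\<forall>J c. finite J \<longrightarrow> gaussian_rv M (\<lambda>\<omega>. \<Sum>t\<in>J. c t * \<xi> t \<omega>))"

definition stationary_seq :: "'a measure \<Rightarrow> (int \<Rightarrow> 'a \<Rightarrow> real) \<Rightarrow> bool" where
  "stationary_seq M \<xi> \<longleftrightarrow>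
     (\<forall>h. distr M (\<Pi>\<^sub>M t\<in>UNIV. borel) (\<lambda>\<omega> t. \<xi> (t + h) \<omega>) =
          distr M (\<Pi>\<^sub>M t\<in>UNIV. borel) (\<lambda>\<omega> t. \<xi> t \<omega>))"

text \<open>For a zero-mean stationary sequence \<open>E(Z\<^sub>t Z\<^bsub>t+k\<^esub>)\<close> does not depend on \<open>t\<close>; take \<open>t = 0\<close>.\<close>

definition autocov :: "'a measure \<Rightarrow> (int \<Rightarrow> 'a \<Rightarrow> real) \<Rightarrow> int \<Rightarrow> real" where
  "autocov M Z k = (\<integral>\<omega>. Z 0 \<omega> * Z k \<omega> \<partial>M)"

section \<open>The autoregressive model and its estimators\<close>

text \<open>The stationary solution; the series converges almost surely.\<close>

definition ar_stat :: "(int \<Rightarrow> 'a \<Rightarrow> real) \<Rightarrow> real \<Rightarrow> int \<Rightarrow> 'a \<Rightarrow> real" where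
  "ar_stat \<xi> \<theta> t \<omega> = (\<Sum>j. \<theta> ^ j * \<xi> (t - int j) \<omega>)"

text \<open>The function \<open>f(\<theta>) = E(Y\<^sub>t\<^sup>2)\<close>; by stationarity of \<open>Y\<close>, \<open>t = 0\<close> suffices.\<close>

definition second_moment :: "'a measure \<Rightarrow> (int \<Rightarrow> 'a \<Rightarrow> real) \<Rightarrow> real \<Rightarrow> real" where
  "second_moment M \<xi> \<theta> = (\<integral>\<omega>. (ar_stat \<xi> \<theta> 0 \<omega>)\<^sup>2 \<partial>M)"

definition sample_mean :: "(nat \<Rightarrow> 'a \<Rightarrow> real) \<Rightarrow> nat \<Rightarrow> 'a \<Rightarrow> real" where
  "sample_mean X n \<omega> = (1 / real n) * (\<Sum>t=1..n. X t \<omega>)"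

text \<open>The inverse of \<open>f\<close> is taken on the parameter range \<open>(0,1)\<close>. Where the sample variance is
  not in \<open>f((0,1))\<close>, \<^const>\<open>inv_into\<close> returns one fixed but unspecified real number.\<close>

definition theta_hat ::
    "'a measure \<Rightarrow> (int \<Rightarrow> 'a \<Rightarrow> real) \<Rightarrow> (nat \<Rightarrow> 'a \<Rightarrow> real) \<Rightarrow> nat \<Rightarrow> 'a \<Rightarrow> real" where
  "theta_hat M \<xi> X n \<omega> =
     inv_into {0<..<1} (second_moment M \<xi>)
       ((1 / real n) * (\<Sum>t=1..n. (X t \<omega> - sample_mean X n \<omega>)\<^sup>2))"

definition alpha_hat ::
    "'a measure \<Rightarrow> (int \<Rightarrow> 'a \<Rightarrow> real) \<Rightarrow> (nat \<Rightarrow> 'a \<Rightarrow> real) \<Rightarrow> nat \<Rightarrow> 'a \<Rightarrow> real" where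
  "alpha_hat M \<xi> X n \<omega> = (1 - theta_hat M \<xi> X n \<omega>) * sample_mean X n \<omega>"

definition sigma_H_sq :: "'a measure \<Rightarrow> (int \<Rightarrow> 'a \<Rightarrow> real) \<Rightarrow> real \<Rightarrow> real" where
  "sigma_H_sq M \<xi> \<theta> = 2 * (\<Sum>\<^sub>\<infinity>k\<in>UNIV. (autocov M (ar_stat \<xi> \<theta>) k)\<^sup>2)"

text \<open>By Euler's reflection formula this equals \<open>1 / (H (2 H - 1))\<close>. It is the asymptotic variance of
  \<open>n\<^bsup>1-H\<^esup>\<close> times the noise mean when \<open>C = 1\<close> in \<open>R(k) \<sim> C \<bar>k\<bar>\<^bsup>2H-2\<^esup>\<close>; for general \<open>C\<close> that variance
  is \<open>C\<close> times this value.\<close>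

definition sigma_1_sq :: "real \<Rightarrow> real" where
  "sigma_1_sq H =
     inverse (H * (2 * H - 1)) * inverse pi * Beta (2 * H - 1) (2 - 2 * H) * sin (2 * pi * H - pi)"

end

theory Submission
  imports Defs "HOL-Real_Asymp.Real_Asymp"
begin

text \<open>Up to a geometrically decaying shift, \<open>X\<close> is the autoregression \<open>W\<close> started at \<open>0\<close>, whose finite
  stretches are centered Gaussian with covariance \<open>G\<close> satisfying \<open>\<bar>G a b\<bar> \<le> K (1 + \<bar>a - b\<bar>) powr (2 * H - 2)\<close>.
  The sample variance is governed by the quadratic form \<open>Q = n powr (-1/2) * (\<Sum>a. W\<^sub>a\<^sup>2 - G a a)\<close> and the
  sample mean by the linear form \<open>L = (1 - \<theta>) * n powr (-H) * (\<Sum>a. W\<^sub>a)\<close>. Two Gaussian integrations by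
  parts turn the derivative in \<open>s\<close> of the joint characteristic function \<open>E (exp (i s Q + i t L))\<close> into
  \<open>-2 s T\<close> times the function itself, \<open>T = (\<Sum>a b. (G a b)\<^sup>2) / n\<close>, up to an error of order \<open>n powr (2 * H - 3/2)\<close>,
  which vanishes exactly because \<open>H < 3/4\<close>. Integrating this differential equation gives the Gaussian limit
  with independent coordinates. The delta method for the inverse of the second moment transfers it to the
  estimator of \<open>\<theta>\<close>, and the error of the estimator of \<open>\<alpha>\<close> is \<open>L\<close> up to a term vanishing in probability.\<close>

section \<open>Laws determined by characteristic functions\<close>

text \<open>The exponents come from one bound: absolute row sums of \<open>G\<close> are of order
  \<open>n powr (2 * H - 1)\<close>, and with the scaling \<open>n powr (-1/2)\<close> every error
  term carries the factor \<open>n powr (2 * H - 3/2)\<close>. The squared sample mean enters the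
  sample variance at this same order, so H < 3/4 controls both errors. The condition H > 1/2 makes
  the error of the \<theta>-estimator negligible on the slower scale \<open>n powr (1 - H)\<close>.
  \<open>Q\<close> and \<open>L\<close> are in general dependent for finite n. The limit factorizes
  because the differential equation in s starts, at s = 0, from the exact Gaussian characteristic
  function of \<open>L\<close>, and its main coefficient does not involve t. \<open>W\<close>
  replaces the stationary solution because it is a finite combination of noise variables, so that
  its Gaussianity is immediate from the hypothesis; the stationary solution enters only through
  limits of covariances. Levy's theorems concern laws on the line. Multivariate statements are
  reduced to them by reweighting the probability measure with a bounded function of the other
  coordinates.\<close>

lemma (in prob_space) integrable_bounded:
  fixes f :: "'a \<Rightarrow> 'b::{banach, second_countable_topology}"
  assumes [measurable]: "f \<in> borel_measurable M" and "\<And>x. x \<in> space M \<Longrightarrow> norm (f x) \<le> B"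
  shows "integrable M f"
  by (rule integrable_const_bound[where B = B]) (use assms in auto)

text \<open>Reweighting by the normalized density \<open>W\<close> turns a mixed expectation of
  \<open>W\<close> and \<open>h Z\<close> into an integral against a single law on the line, where
  Levy's theorems apply. It serves both the uniqueness and the continuity argument.\<close>

lemma (in prob_space)
  fixes W Z :: "'a \<Rightarrow> real"
  assumes W [measurable]: "W \<in> borel_measurable M" and Z [measurable]: "Z \<in> borel_measurable M"
    and W0: "\<And>\<omega>. \<omega> \<in> space M \<Longrightarrow> 0 \<le> W \<omega>" and iW: "integrable M W" and m: "0 < (\<integral>\<omega>. W \<omega> \<partial>M)"
  defines "\<mu> \<equiv> distr (density M (\<lambda>\<omega>. ennreal (W \<omega> / (\<integral>\<omega>. W \<omega> \<partial>M)))) borel Z"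
  shows real_distribution_tilted: "real_distribution \<mu>"
    and integral_tilted: "\<And>h :: real \<Rightarrow> 'b::{banach, second_countable_topology}. h \<in> borel_measurable borel \<Longrightarrow>
      (\<integral>x. h x \<partial>\<mu>) = (\<integral>\<omega>. W \<omega> *\<^sub>R h (Z \<omega>) \<partial>M) /\<^sub>R (\<integral>\<omega>. W \<omega> \<partial>M)"
proof -
  let ?m = "\<integral>\<omega>. W \<omega> \<partial>M"
  have nn: "AE \<omega> in M. 0 \<le> W \<omega> / ?m" using W0 m by auto
  have "(\<integral>\<omega>. W \<omega> / ?m \<partial>M) = 1" using m by simp
  then have "emeasure (density M (\<lambda>\<omega>. ennreal (W \<omega> / ?m))) (space M) = 1"
    using nn_integral_eq_integral[OF _ nn] iW by (simp add: emeasure_density cong: nn_integral_cong)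
  then have "prob_space (density M (\<lambda>\<omega>. ennreal (W \<omega> / ?m)))" by (intro prob_spaceI) simp
  then show "real_distribution \<mu>" unfolding \<mu>_def
    by (intro prob_space.real_distribution_distr) auto
  fix h :: "real \<Rightarrow> 'b" assume [measurable]: "h \<in> borel_measurable borel"
  have "(\<integral>x. h x \<partial>\<mu>) = (\<integral>\<omega>. (W \<omega> / ?m) *\<^sub>R h (Z \<omega>) \<partial>M)"
    unfolding \<mu>_def by (subst integral_distr) (auto intro!: integral_density nn)
  also have "\<dots> = (\<integral>\<omega>. (W \<omega> *\<^sub>R h (Z \<omega>)) /\<^sub>R ?m \<partial>M)"
    by (simp add: divide_inverse mult.commute)
  finally show "(\<integral>x. h x \<partial>\<mu>) = (\<integral>\<omega>. W \<omega> *\<^sub>R h (Z \<omega>) \<partial>M) /\<^sub>R ?m" by (simp only: integral_scaleR_right)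
qed

text \<open>Shifting \<open>U\<close> and \<open>V\<close> by \<open>2\<close> makes them densities, so that Levy's uniqueness theorem applies to the
  tilted laws.\<close>

lemma tilted_char_unique_real:
  fixes U :: "'a \<Rightarrow> real" and V :: "'b \<Rightarrow> real"
  assumes M: "prob_space M" and N: "prob_space N"
    and Z [measurable]: "Z \<in> borel_measurable M" and W [measurable]: "W \<in> borel_measurable N"
    and U [measurable]: "U \<in> borel_measurable M" and V [measurable]: "V \<in> borel_measurable N"
    and U_bd: "\<And>x. x \<in> space M \<Longrightarrow> \<bar>U x\<bar> \<le> 1" and V_bd: "\<And>x. x \<in> space N \<Longrightarrow> \<bar>V x\<bar> \<le> 1"
    and eq1: "\<And>c. (\<integral>x. iexp (c * Z x) \<partial>M) = (\<integral>x. iexp (c * W x) \<partial>N)"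
    and eq2: "\<And>c. (\<integral>x. U x * iexp (c * Z x) \<partial>M) = (\<integral>x. V x * iexp (c * W x) \<partial>N)"
    and A [measurable]: "A \<in> sets borel"
  shows "(\<integral>x. U x * indicator A (Z x) \<partial>M) = (\<integral>x. V x * indicator A (W x) \<partial>N)"
proof -
  interpret M: prob_space M by fact
  interpret N: prob_space N by fact
  have intM: "integrable M U" "integrable M (\<lambda>x. U x * iexp (c * Z x))" "integrable M (\<lambda>x. iexp (c * Z x))"
     "integrable M (\<lambda>x. U x * indicator A (Z x))" "integrable M (\<lambda>x. indicator A (Z x) :: real)" for c
    using U_bd by (auto intro!: M.integrable_bounded[where B=1] simp: norm_mult indicator_def)
  have intN: "integrable N V" "integrable N (\<lambda>x. V x * iexp (c * W x))" "integrable N (\<lambda>x. iexp (c * W x))"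
     "integrable N (\<lambda>x. V x * indicator A (W x))" "integrable N (\<lambda>x. indicator A (W x) :: real)" for c
    using V_bd by (auto intro!: N.integrable_bounded[where B=1] simp: norm_mult indicator_def)
  define u where "u x = 2 + U x" for x
  define v where "v x = 2 + V x" for x
  have [measurable]: "u \<in> borel_measurable M" "v \<in> borel_measurable N" unfolding u_def v_def by auto
  have u0: "0 \<le> u x" if "x \<in> space M" for x using U_bd[OF that] by (simp add: u_def abs_le_iff)
  have v0: "0 \<le> v x" if "x \<in> space N" for x using V_bd[OF that] by (simp add: v_def abs_le_iff)
  have iu: "integrable M u" and iv: "integrable N v" unfolding u_def v_def using intM intN by auto
  define m where "m = (\<integral>x. u x \<partial>M)"
  have m: "m = 2 + (\<integral>x. U x \<partial>M)" unfolding m_def u_def using intM by (simp add: M.prob_space)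
  \<comment> \<open>At frequency 0 the hypothesis \<open>eq2\<close> compares the total masses, so
    one normalizing constant \<open>m\<close> serves both tilted laws.\<close>
  have "complex_of_real (\<integral>x. U x \<partial>M) = complex_of_real (\<integral>x. V x \<partial>N)"
    using eq2[of 0] by simp
  then have mN: "(\<integral>x. v x \<partial>N) = m" unfolding m v_def using intN by (simp add: N.prob_space)
  have "\<bar>\<integral>x. U x \<partial>M\<bar> \<le> 1"
    using U_bd by (intro order_trans[OF integral_abs_bound] M.integral_le_const integrable_abs intM) auto
  then have m0: "0 < m" unfolding m by simp
  define M' where "M' = distr (density M (\<lambda>x. ennreal (u x / m))) borel Z"
  define N' where "N' = distr (density N (\<lambda>x. ennreal (v x / m))) borel W"
  have pM: "real_distribution M'"
    unfolding M'_def m_def by (rule M.real_distribution_tilted[OF _ Z u0 iu m0[unfolded m_def]]) auto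
  have pN: "real_distribution N'"
    unfolding N'_def mN[symmetric] by (rule N.real_distribution_tilted[OF _ W v0 iv m0[folded mN]]) auto
  have iM: "(\<integral>x. h x \<partial>M') = (\<integral>x. u x *\<^sub>R h (Z x) \<partial>M) /\<^sub>R m" if "h \<in> borel_measurable borel"
    for h :: "real \<Rightarrow> 'c::{banach, second_countable_topology}"
    unfolding M'_def m_def by (rule M.integral_tilted[OF _ Z u0 iu m0[unfolded m_def] that]) auto
  have iN: "(\<integral>x. h x \<partial>N') = (\<integral>x. v x *\<^sub>R h (W x) \<partial>N) /\<^sub>R m" if "h \<in> borel_measurable borel"
    for h :: "real \<Rightarrow> 'c::{banach, second_countable_topology}"
    unfolding N'_def mN[symmetric] by (rule N.integral_tilted[OF _ W v0 iv m0[folded mN] that]) auto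
  have "char M' c = char N' c" for c
    unfolding char_def using eq1[of c] eq2[of c] intM intN
    by (simp add: iM iN u_def v_def scaleR_conv_of_real distrib_right)
  then have eq: "M' = N'" by (intro Levy_uniqueness pM pN ext)
  \<comment> \<open>The untilted laws agree as well, by \<open>eq1\<close>; this removes the
    contribution of the shift by 2 from the tilted identity.\<close>
  have ind: "(\<integral>x. indicator A (Z x) \<partial>M) = (\<integral>x. indicator A (W x) \<partial>N :: real)"
  proof -
    have "distr M borel Z = distr N borel W"
      using eq1 by (intro Levy_uniqueness M.real_distribution_distr N.real_distribution_distr ext)
        (auto simp: char_def integral_distr)
    then have "(\<integral>x. indicator A x \<partial>distr M borel Z) = (\<integral>x. indicator A x \<partial>distr N borel W :: real)" by simp
    then show ?thesis by (subst (asm) (1 2) integral_distr) auto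
  qed
  have "(\<integral>x. u x * indicator A (Z x) \<partial>M) = (\<integral>x. v x * indicator A (W x) \<partial>N)"
    using iM[of "indicator A :: real \<Rightarrow> real"] iN[of "indicator A :: real \<Rightarrow> real"] m0 by (simp add: eq)
  then show ?thesis using intM(4,5) intN(4,5) ind by (simp add: u_def v_def distrib_right)
qed

text \<open>Conjugating \<open>eq2\<close> at frequency -c gives the same identity for the conjugate
  weights. Real and imaginary parts are combinations of a weight and its conjugate, so both inherit
  \<open>eq2\<close> and the real case applies to each.\<close>

lemma tilted_char_unique:
  fixes U :: "'a \<Rightarrow> complex" and V :: "'b \<Rightarrow> complex"
  assumes M: "prob_space M" and N: "prob_space N"
    and Z [measurable]: "Z \<in> borel_measurable M" and W [measurable]: "W \<in> borel_measurable N"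
    and U [measurable]: "U \<in> borel_measurable M" and V [measurable]: "V \<in> borel_measurable N"
    and U_bd: "\<And>x. x \<in> space M \<Longrightarrow> cmod (U x) \<le> 1" and V_bd: "\<And>x. x \<in> space N \<Longrightarrow> cmod (V x) \<le> 1"
    and eq1: "\<And>c. (\<integral>x. iexp (c * Z x) \<partial>M) = (\<integral>x. iexp (c * W x) \<partial>N)"
    and eq2: "\<And>c. (\<integral>x. U x * iexp (c * Z x) \<partial>M) = (\<integral>x. V x * iexp (c * W x) \<partial>N)"
    and A [measurable]: "A \<in> sets borel"
  shows "(\<integral>x. U x * indicator A (Z x) \<partial>M) = (\<integral>x. V x * indicator A (W x) \<partial>N)"
proof -
  interpret M: prob_space M by fact
  interpret N: prob_space N by fact
  have cnj_meas [measurable]: "cnj \<in> borel_measurable borel"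
    by (intro borel_measurable_continuous_onI continuous_intros)
  have iM: "integrable M (\<lambda>x. U x * iexp (c * Z x))" "integrable M (\<lambda>x. cnj (U x) * iexp (c * Z x))"
    "integrable M (\<lambda>x. U x * indicator A (Z x))" for c
    using U_bd by (auto intro!: M.integrable_bounded[where B=1] simp: norm_mult indicator_def)
  have iN: "integrable N (\<lambda>x. V x * iexp (c * W x))" "integrable N (\<lambda>x. cnj (V x) * iexp (c * W x))"
    "integrable N (\<lambda>x. V x * indicator A (W x))" for c
    using V_bd by (auto intro!: N.integrable_bounded[where B=1] simp: norm_mult indicator_def)
  have eq3: "(\<integral>x. cnj (U x) * iexp (c * Z x) \<partial>M) = (\<integral>x. cnj (V x) * iexp (c * W x) \<partial>N)" for c
  proof -
    have e: "cnj u * iexp (c * z) = cnj (u * iexp (-c * z))" for u z by (simp add: exp_cnj)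
    show ?thesis unfolding e Bochner_Integration.integral_cnj using eq2[of "- c"] by presburger
  qed
  have re: "complex_of_real (Re z) = (z + cnj z) / 2" for z by (simp add: complex_eq_iff)
  have im: "complex_of_real (Im z) = (z - cnj z) / (2 * \<i>)" for z by (simp add: complex_eq_iff)
  have r: "(\<integral>x. Re (U x) * indicator A (Z x) \<partial>M) = (\<integral>x. Re (V x) * indicator A (W x) \<partial>N)"
  proof (rule tilted_char_unique_real[OF M N Z W])
    show "(\<integral>x. complex_of_real (Re (U x)) * iexp (c * Z x) \<partial>M) = (\<integral>x. complex_of_real (Re (V x)) * iexp (c * W x) \<partial>N)" for c
      unfolding re times_divide_eq_left integral_divide_zero distrib_right Bochner_Integration.integral_add[OF iM(1,2)]
        Bochner_Integration.integral_add[OF iN(1,2)] eq2 eq3 ..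
    show "\<bar>Re (U x)\<bar> \<le> 1" if "x \<in> space M" for x using order_trans[OF abs_Re_le_cmod U_bd[OF that]] .
    show "\<bar>Re (V x)\<bar> \<le> 1" if "x \<in> space N" for x using order_trans[OF abs_Re_le_cmod V_bd[OF that]] .
  qed (use eq1 A in auto)
  have i: "(\<integral>x. Im (U x) * indicator A (Z x) \<partial>M) = (\<integral>x. Im (V x) * indicator A (W x) \<partial>N)"
  proof (rule tilted_char_unique_real[OF M N Z W])
    show "(\<integral>x. complex_of_real (Im (U x)) * iexp (c * Z x) \<partial>M) = (\<integral>x. complex_of_real (Im (V x)) * iexp (c * W x) \<partial>N)" for c
      unfolding im times_divide_eq_left integral_divide_zero left_diff_distrib Bochner_Integration.integral_diff[OF iM(1,2)]
        Bochner_Integration.integral_diff[OF iN(1,2)] eq2 eq3 ..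
    show "\<bar>Im (U x)\<bar> \<le> 1" if "x \<in> space M" for x using order_trans[OF abs_Im_le_cmod U_bd[OF that]] .
    show "\<bar>Im (V x)\<bar> \<le> 1" if "x \<in> space N" for x using order_trans[OF abs_Im_le_cmod V_bd[OF that]] .
  qed (use eq1 A in auto)
  have reI: "Re (u * indicator A z) = Re u * indicator A z" and imI: "Im (u * indicator A z) = Im u * indicator A z" for u z
    by (auto simp: indicator_def)
  show ?thesis
    using r i by (auto simp: complex_eq_iff integral_Re[symmetric] integral_Im[symmetric] reI imI iM iN simp del: integral_Re integral_Im times_complex.sel)
qed

text \<open>Uniqueness for finite-dimensional laws, obtained from dimension one: coordinates are
  converted one at a time from exponentials into indicators. The indicators already obtained, times
  the exponentials still present, form the complex weight of \<open>tilted_char_unique\<close>. Once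
  all are converted, the laws agree on boxes, which generate the product sigma-algebra.\<close>

lemma char_eq_imp_distr_PiM_eq:
  fixes Y :: "'i \<Rightarrow> 'a \<Rightarrow> real" and Y' :: "'i \<Rightarrow> 'b \<Rightarrow> real"
  assumes M: "prob_space M" and N: "prob_space N" and fin: "finite I"
    and Y [measurable]: "\<And>i. i \<in> I \<Longrightarrow> Y i \<in> borel_measurable M"
    and Y' [measurable]: "\<And>i. i \<in> I \<Longrightarrow> Y' i \<in> borel_measurable N"
    and char: "\<And>c. (\<integral>x. iexp (\<Sum>i\<in>I. c i * Y i x) \<partial>M) = (\<integral>x. iexp (\<Sum>i\<in>I. c i * Y' i x) \<partial>N)"
  shows "distr M (PiM I (\<lambda>_. borel)) (\<lambda>x. \<lambda>i\<in>I. Y i x) = distr N (PiM I (\<lambda>_. borel)) (\<lambda>x. \<lambda>i\<in>I. Y' i x)"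
    (is "?P = ?Q")
proof -
  interpret M: prob_space M by fact
  interpret N: prob_space N by fact
  have *: "(\<integral>x. (\<Prod>i\<in>J. indicator (A i) (Y i x)) * iexp (\<Sum>i\<in>I-J. c i * Y i x) \<partial>M) =
           (\<integral>x. (\<Prod>i\<in>J. indicator (A i) (Y' i x)) * iexp (\<Sum>i\<in>I-J. c i * Y' i x) \<partial>N)"
    if "finite J" "J \<subseteq> I" "\<And>i. i \<in> J \<Longrightarrow> A i \<in> sets borel" for J c A
    using that
  proof (induction J arbitrary: c rule: finite_induct)
    case empty
    then show ?case using char by simp
  next
    case (insert k J)
    note [measurable] = insert.prems(2)
    have k: "k \<in> I" "k \<notin> J" "k \<in> I - J" using insert by auto
    have J: "i \<in> I" if "i \<in> J" for i using that insert by auto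
    note [measurable] = Y[OF k(1)] Y'[OF k(1)] Y[OF J] Y'[OF J]
    have A: "A i \<in> sets borel" if "i \<in> J" for i using that insert by auto
    have split: "(\<Sum>i\<in>I-J. (c(k := b)) i * f i) = (\<Sum>i\<in>I-insert k J. c i * f i) + b * f k" for b and f :: "_ \<Rightarrow> real"
    proof -
      have "(\<Sum>i\<in>I-J. (c(k := b)) i * f i) = b * f k + (\<Sum>i\<in>I-J-{k}. (c(k := b)) i * f i)"
        using fin k by (subst sum.remove[of _ k]) auto
      also have "(\<Sum>i\<in>I-J-{k}. (c(k := b)) i * f i) = (\<Sum>i\<in>I-insert k J. c i * f i)"
        by (intro sum.cong) auto
      finally show ?thesis by simp
    qed
    have single: "(\<Sum>i\<in>I. (if i = k then b else 0) * f i) = b * f k" for b and f :: "_ \<Rightarrow> real"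
      using fin k by (simp add: if_distrib[of "\<lambda>x. x * _"] cong: if_cong)
    have [measurable]: "(\<lambda>x. \<Prod>i\<in>J. indicator (A i) (Y i x) :: complex) \<in> borel_measurable M"
      "(\<lambda>x. \<Prod>i\<in>J. indicator (A i) (Y' i x) :: complex) \<in> borel_measurable N"
      using A J by (auto intro!: borel_measurable_prod borel_measurable_indicator')
    let ?U = "\<lambda>x. (\<Prod>i\<in>J. indicator (A i) (Y i x)) * iexp (\<Sum>i\<in>I-insert k J. c i * Y i x)"
    let ?V = "\<lambda>x. (\<Prod>i\<in>J. indicator (A i) (Y' i x)) * iexp (\<Sum>i\<in>I-insert k J. c i * Y' i x)"
    have bd: "cmod (\<Prod>i\<in>J. indicator (A i) (f i)) \<le> 1" for f
      by (subst prod_norm[symmetric]) (auto intro!: prod_le_1 simp: indicator_def)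
    \<comment> \<open>The induction hypothesis with coefficient b at the new index k, for every b,
      is precisely the tilted characteristic function of coordinate k.\<close>
    have "(\<integral>x. ?U x * indicator (A k) (Y k x) \<partial>M) = (\<integral>x. ?V x * indicator (A k) (Y' k x) \<partial>N)"
    proof (rule tilted_char_unique[OF M N])
      show "(\<integral>x. iexp (b * Y k x) \<partial>M) = (\<integral>x. iexp (b * Y' k x) \<partial>N)" for b
        using char[of "\<lambda>i. if i = k then b else 0"] unfolding single .
      show "(\<integral>x. ?U x * iexp (b * Y k x) \<partial>M) = (\<integral>x. ?V x * iexp (b * Y' k x) \<partial>N)" for b
        using insert.IH[of "c(k := b)"] insert.prems unfolding split by (simp add: exp_add ring_distribs mult.assoc)
      show "A k \<in> sets borel" using insert.prems by auto
    qed (use bd in \<open>auto simp: norm_mult\<close>)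
    then show ?case using insert.hyps by (simp add: mult_ac)
  qed
  have box: "emeasure (distr P (PiM I (\<lambda>_. borel)) (\<lambda>x. \<lambda>i\<in>I. X i x)) (Pi\<^sub>E I A)
      = ennreal (\<integral>x. (\<Prod>i\<in>I. indicator (A i) (X i x)) \<partial>P)"
    if P: "prob_space P" and [measurable]: "\<And>i. i \<in> I \<Longrightarrow> A i \<in> sets borel" "\<And>i. i \<in> I \<Longrightarrow> X i \<in> borel_measurable P"
    for P :: "'z measure" and X and A
  proof -
    interpret P: prob_space P by fact
    have [measurable]: "Pi\<^sub>E I A \<in> sets (PiM I (\<lambda>_. borel))" using fin by (intro sets_PiM_I_finite) auto
    have R [measurable]: "(\<lambda>x. \<lambda>i\<in>I. X i x) \<in> measurable P (PiM I (\<lambda>_. borel))"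
      by (intro measurable_restrict) simp
    have S: "(\<lambda>x. \<lambda>i\<in>I. X i x) -` Pi\<^sub>E I A \<inter> space P \<in> sets P"
      by (intro measurable_sets[OF R]) simp
    have "emeasure (distr P (PiM I (\<lambda>_. borel)) (\<lambda>x. \<lambda>i\<in>I. X i x)) (Pi\<^sub>E I A) = 
       emeasure P ((\<lambda>x. \<lambda>i\<in>I. X i x) -` Pi\<^sub>E I A \<inter> space P)"
      by (rule emeasure_distr) measurable
    also have "\<dots> = ennreal (\<integral>x. indicator ((\<lambda>x. \<lambda>i\<in>I. X i x) -` Pi\<^sub>E I A \<inter> space P) x \<partial>P)"
      using S by (simp add: P.emeasure_eq_measure)
    also have "(\<integral>x. indicator ((\<lambda>x. \<lambda>i\<in>I. X i x) -` Pi\<^sub>E I A \<inter> space P) x \<partial>P) = (\<integral>x. (\<Prod>i\<in>I. indicator (A i) (X i x)) \<partial>P :: real)"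
      by (intro Bochner_Integration.integral_cong) 
        (auto simp: fin indicator_def PiE_iff intro!: prod.neutral)
    finally show ?thesis .
  qed
  show ?thesis
  proof (rule measure_eqI_PiM_finite[where A = "\<lambda>_. Pi\<^sub>E I (\<lambda>_. UNIV)"])
    show "?P (Pi\<^sub>E I A) = ?Q (Pi\<^sub>E I A)" if A: "\<And>i. i \<in> I \<Longrightarrow> A i \<in> sets borel" for A
    proof -
      have of: "complex_of_real (\<integral>x. (\<Prod>i\<in>I. indicator (A i) (X i x)) \<partial>P) = (\<integral>x. (\<Prod>i\<in>I. indicator (A i) (X i x)) \<partial>P)" 
        for P :: "'z measure" and X
        by (subst integral_complex_of_real[symmetric]) (auto intro!: Bochner_Integration.integral_cong prod.cong simp: indicator_def)
      have "complex_of_real (\<integral>x. (\<Prod>i\<in>I. indicator (A i) (Y i x)) \<partial>M) = complex_of_real (\<integral>x. (\<Prod>i\<in>I. indicator (A i) (Y' i x)) \<partial>N)"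
        unfolding of using *[OF fin order_refl A] by simp
      then show ?thesis using box[OF M A Y] box[OF N A Y'] by simp
    qed
    show "range (\<lambda>_::nat. Pi\<^sub>E I (\<lambda>_. UNIV)) \<subseteq> prod_algebra I (\<lambda>_. borel)"
      using fin by (auto intro!: prod_algebraI_finite)
    have "emeasure ?P (space ?P) = 1" by (intro prob_space.emeasure_space_1 M.prob_space_distr measurable_restrict) auto
    then show "emeasure ?P (Pi\<^sub>E I (\<lambda>_. UNIV)) \<noteq> \<infinity>" by (simp add: space_PiM)
  qed (use fin in \<open>auto simp: space_PiM\<close>)
qed

section \<open>Gaussian integration by parts\<close>

text \<open>Stein's identity. The standard normal density p satisfies p' = -x p, so the difference
  of the two integrands is the derivative of p h, which vanishes at both ends. The growth bounds are
  those of a linear factor times an oscillating exponential of a quadratic, the only functions it is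
  applied to.\<close>

lemma integral_std_normal_by_parts:
  fixes h h' :: "real \<Rightarrow> complex"
  assumes deriv: "\<And>x. (h has_vector_derivative h' x) (at x)"
    and cont: "\<And>x. isCont h' x"
    and bd: "\<And>x. cmod (h x) \<le> A * (1 + \<bar>x\<bar>)" and bd': "\<And>x. cmod (h' x) \<le> A * (1 + \<bar>x\<bar>)\<^sup>2"
  shows "(\<integral>x. x * h x \<partial>std_normal_distribution) = (\<integral>x. h' x \<partial>std_normal_distribution)"
proof -
  let ?p = "std_normal_density"
  have ch: "isCont h x" for x using deriv by (rule has_vector_derivative_continuous)
  have [measurable]: "h \<in> borel_measurable borel" "h' \<in> borel_measurable borel"
    using ch cont by (auto intro!: borel_measurable_continuous_onI simp: continuous_on_eq_continuous_at)
  have dp: "(?p has_real_derivative (- x * ?p x)) (at x)" for x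
    unfolding std_normal_density_def
    by (auto intro!: derivative_eq_intros simp: field_simps power2_eq_square)
  have A0: "A \<ge> 0" using order_trans[OF norm_ge_zero bd[of 0]] by simp
  have int: "integrable lborel (\<lambda>x. A * (1 + \<bar>x\<bar>)\<^sup>2 * ?p x)"
  proof -
    have "(\<lambda>x. A * (1 + \<bar>x\<bar>)\<^sup>2 * ?p x) = (\<lambda>x. A * (?p x + 2 * (?p x * \<bar>x\<bar> ^ 1) + ?p x * \<bar>x\<bar> ^ 2))"
      by (auto simp: fun_eq_iff power2_eq_square algebra_simps)
    then show ?thesis
      using integrable_std_normal_moment_abs[of 1] integrable_std_normal_moment_abs[of 2] by auto
  qed
  have le: "cmod (x * h x) \<le> A * (1 + \<bar>x\<bar>)\<^sup>2" for x
  proof -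
    have "cmod (x * h x) \<le> \<bar>x\<bar> * (A * (1 + \<bar>x\<bar>))"
      using bd[of x] by (simp add: norm_mult mult_left_mono)
    also have "\<dots> \<le> (1 + \<bar>x\<bar>) * (A * (1 + \<bar>x\<bar>))" using A0 by (intro mult_right_mono) auto
    finally show ?thesis by (simp add: power2_eq_square ac_simps)
  qed
  have i1: "integrable lborel (\<lambda>x. ?p x *\<^sub>R h' x)"
  proof (rule Bochner_Integration.integrable_bound[OF int])
    show "AE x in lborel. norm (?p x *\<^sub>R h' x) \<le> norm (A * (1 + \<bar>x\<bar>)\<^sup>2 * ?p x)"
    proof (rule AE_I2)
      fix x show "norm (?p x *\<^sub>R h' x) \<le> norm (A * (1 + \<bar>x\<bar>)\<^sup>2 * ?p x)"
        using mult_right_mono[OF bd'[of x], of "?p x"] A0 by (simp add: abs_mult mult.commute)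
    qed
  qed simp
  have i2: "integrable lborel (\<lambda>x. ?p x *\<^sub>R (x * h x))"
  proof (rule Bochner_Integration.integrable_bound[OF int])
    show "AE x in lborel. norm (?p x *\<^sub>R (x * h x)) \<le> norm (A * (1 + \<bar>x\<bar>)\<^sup>2 * ?p x)"
    proof (rule AE_I2)
      fix x show "norm (?p x *\<^sub>R (x * h x)) \<le> norm (A * (1 + \<bar>x\<bar>)\<^sup>2 * ?p x)"
        using mult_right_mono[OF le[of x], of "?p x"] A0 by (simp add: abs_mult mult.commute norm_mult)
    qed
  qed simp
  let ?F = "\<lambda>x. ?p x *\<^sub>R h x" and ?f = "\<lambda>x. ?p x *\<^sub>R h' x - ?p x *\<^sub>R (x * h x)"
  have lim: "((\<lambda>x. A * (1 + \<bar>x\<bar>) * ?p x) \<longlongrightarrow> 0) F" if "F = at_top \<or> F = at_bot" for F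
    using that unfolding std_normal_density_def by (elim disjE; simp; real_asymp)
  have "norm (?F x) \<le> A * (1 + \<bar>x\<bar>) * ?p x" for x
    using mult_right_mono[OF bd[of x], of "?p x"] by (simp add: mult.commute)
  then have lim': "(?F \<longlongrightarrow> 0) F" if "F = at_top \<or> F = at_bot" for F
    by (intro Lim_null_comparison[OF _ lim[OF that]] always_eventually allI)
  have "(LBINT x=-\<infinity>..\<infinity>. ?f x) = 0 - 0"
  proof (rule interval_integral_FTC_integrable)
    show "(?F has_vector_derivative ?f x) (at x)" for x
      by (rule has_vector_derivative_eq_rhs, rule has_vector_derivative_scaleR[OF dp deriv])
         (simp add: scaleR_conv_of_real algebra_simps)
    show "isCont ?f x" for x
      using ch cont by (auto intro!: continuous_intros simp: normal_density_def)
    show "set_integrable lborel (einterval (-\<infinity>) \<infinity>) ?f"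
      unfolding set_integrable_def using i1 i2 by simp
    show "((?F \<circ> real_of_ereal) \<longlongrightarrow> 0) (at_right (-\<infinity>))" "((?F \<circ> real_of_ereal) \<longlongrightarrow> 0) (at_left \<infinity>)"
      using lim' by (simp_all add: ereal_tendsto_simps1)
  qed simp
  then have "(\<integral>x. ?p x *\<^sub>R h' x \<partial>lborel) - (\<integral>x. ?p x *\<^sub>R (x * h x) \<partial>lborel) = 0"
    using i1 i2 by (simp add: interval_lebesgue_integral_def set_lebesgue_integral_def)
  then show ?thesis
    by (simp add: integral_density)
qed

section \<open>Centered normal laws and finite Gaussian families\<close>

lemma abs_mult_le_squares: "\<bar>a * b\<bar> \<le> (a\<^sup>2 + b\<^sup>2) / 2" for a b :: real
  using sum_squares_bound[of "\<bar>a\<bar>" "\<bar>b\<bar>"] by (simp add: abs_mult)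

text \<open>The scaled standard normal also represents the point mass at v = 0, so moments and
  characteristic functions can be computed without treating the degenerate case apart.\<close>

lemma normal_law_eq_distr:
  assumes "0 \<le> v"
  shows "normal_law 0 v = distr std_normal_distribution borel (\<lambda>x. sqrt v * x)"
proof (cases "v = 0")
  case True
  interpret real_distribution std_normal_distribution by (rule real_dist_normal_dist)
  have "distr std_normal_distribution borel (\<lambda>x. sqrt v * x) = return borel 0"
    using True by (simp add: distr_const)
  with True show ?thesis by (simp add: normal_law_def)
next
  case False
  interpret real_distribution std_normal_distribution by (rule real_dist_normal_dist)
  have "distributed std_normal_distribution lborel (\<lambda>x. x) (\<lambda>x. ennreal (std_normal_density x))"
    by (auto simp: distributed_def distr_id2)
  from normal_density_affine[OF this, of "sqrt v" 0] False assms
  have "distributed std_normal_distribution lborel (\<lambda>x. sqrt v * x) (\<lambda>x. ennreal (normal_density 0 (sqrt v) x))"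
    by simp
  then have "distr std_normal_distribution lborel (\<lambda>x. sqrt v * x) = density lborel (\<lambda>x. ennreal (normal_density 0 (sqrt v) x))"
    by (rule distributed_distr_eq_density)
  moreover have "distr std_normal_distribution lborel (\<lambda>x. sqrt v * x) = distr std_normal_distribution borel (\<lambda>x. sqrt v * x)"
    by (rule distr_cong) auto
  ultimately show ?thesis using False by (simp add: normal_law_def)
qed

lemma real_distribution_normal_law: "0 \<le> v \<Longrightarrow> real_distribution (normal_law 0 v)"
proof -
  interpret real_distribution std_normal_distribution by (rule real_dist_normal_dist)
  show "0 \<le> v \<Longrightarrow> real_distribution (normal_law 0 v)"
    unfolding normal_law_eq_distr by (intro real_distribution_distr) simp
qed

lemma char_normal_law: 
  assumes "0 \<le> v" shows "char (normal_law 0 v) t = exp (- (v * t\<^sup>2) / 2)"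
proof -
  have "char (normal_law 0 v) t = char std_normal_distribution (t * sqrt v)"
    unfolding normal_law_eq_distr[OF assms] char_def by (subst integral_distr) (auto simp: mult.assoc)
  then show ?thesis using assms by (simp add: char_std_normal_distribution power_mult_distrib mult.commute exp_of_real)
qed

lemma integrable_normal_law_power: "0 \<le> v \<Longrightarrow> integrable (normal_law 0 v) (\<lambda>x. x ^ k)"
  unfolding normal_law_eq_distr
  by (subst integrable_distr_eq) (simp_all add: power_mult_distrib integrable_std_normal_distribution_moment)

lemma integral_normal_law_square: "0 \<le> v \<Longrightarrow> (\<integral>x. x\<^sup>2 \<partial>normal_law 0 v) = v"
  unfolding normal_law_eq_distr using std_normal_distribution_even_moments[of 1]
  by (subst integral_distr) (simp_all add: power_mult_distrib)

text \<open>Joint normality is encoded through the laws of all linear combinations, which admits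
  singular covariance matrices. Nonnegativity of the quadratic form accompanies each law because
  \<open>normal_law\<close> is meaningful only for nonnegative variances.\<close>

definition centered_gaussian_family ::
  "'a measure \<Rightarrow> 'i set \<Rightarrow> ('i \<Rightarrow> 'a \<Rightarrow> real) \<Rightarrow> ('i \<Rightarrow> 'i \<Rightarrow> real) \<Rightarrow> bool" where
  "centered_gaussian_family M I Y G \<longleftrightarrow> prob_space M \<and> finite I \<and> (\<forall>i\<in>I. Y i \<in> borel_measurable M) \<and>
     (\<forall>i j. G i j = G j i) \<and>
     (\<forall>c. 0 \<le> (\<Sum>i\<in>I. \<Sum>j\<in>I. c i * c j * G i j) \<and>
       distr M borel (\<lambda>\<omega>. \<Sum>i\<in>I. c i * Y i \<omega>) = normal_law 0 (\<Sum>i\<in>I. \<Sum>j\<in>I. c i * c j * G i j))"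

locale gaussian_family =
  fixes M :: "'a measure" and I :: "'i set" and Y :: "'i \<Rightarrow> 'a \<Rightarrow> real" and G :: "'i \<Rightarrow> 'i \<Rightarrow> real"
  assumes gaussian_family: "centered_gaussian_family M I Y G"
begin

sublocale prob_space M using gaussian_family by (simp add: centered_gaussian_family_def)

lemma finite_I [simp]: "finite I" using gaussian_family by (simp add: centered_gaussian_family_def)
lemma Y_measurable [measurable]: "i \<in> I \<Longrightarrow> Y i \<in> borel_measurable M" 
  using gaussian_family by (simp add: centered_gaussian_family_def)
lemma G_sym: "G i j = G j i" 
  using gaussian_family unfolding centered_gaussian_family_def by blast

lemma G_psd: "0 \<le> (\<Sum>i\<in>I. \<Sum>j\<in>I. c i * c j * G i j)"
  using gaussian_family unfolding centered_gaussian_family_def by blast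

lemma distr_combination: "distr M borel (\<lambda>\<omega>. \<Sum>i\<in>I. c i * Y i \<omega>) = normal_law 0 (\<Sum>i\<in>I. \<Sum>j\<in>I. c i * c j * G i j)"
  using gaussian_family unfolding centered_gaussian_family_def by blast

lemma combination_measurable [measurable]: "(\<lambda>\<omega>. \<Sum>i\<in>I. c i * Y i \<omega>) \<in> borel_measurable M" by simp

lemma char_combination:
  "(\<integral>\<omega>. iexp (\<Sum>i\<in>I. c i * Y i \<omega>) \<partial>M) = exp (- (\<Sum>i\<in>I. \<Sum>j\<in>I. c i * c j * G i j) / 2)"
proof -
  have "(\<integral>\<omega>. iexp (\<Sum>i\<in>I. c i * Y i \<omega>) \<partial>M) = char (distr M borel (\<lambda>\<omega>. \<Sum>i\<in>I. c i * Y i \<omega>)) 1"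
    unfolding char_def by (subst integral_distr) auto
  then show ?thesis unfolding distr_combination by (simp add: char_normal_law G_psd exp_of_real)
qed

lemma combination_power_integrable: "integrable M (\<lambda>\<omega>. (\<Sum>i\<in>I. c i * Y i \<omega>) ^ k)"
  using integrable_normal_law_power[OF G_psd, of c k] unfolding distr_combination[symmetric]
  by (subst (asm) integrable_distr_eq) auto

lemma combination_square: "(\<integral>\<omega>. (\<Sum>i\<in>I. c i * Y i \<omega>)\<^sup>2 \<partial>M) = (\<Sum>i\<in>I. \<Sum>j\<in>I. c i * c j * G i j)"
  using integral_normal_law_square[OF G_psd, of c] unfolding distr_combination[symmetric]
  by (subst (asm) integral_distr) auto

lemma single: "i \<in> I \<Longrightarrow> (\<Sum>k\<in>I. (if k = i then b else 0) * f k) = b * (f i :: real)"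
  by (simp add: if_distrib[of "\<lambda>x. x * _"] cong: if_cong)

lemma Y_power_integrable: "i \<in> I \<Longrightarrow> integrable M (\<lambda>\<omega>. Y i \<omega> ^ k)"
  using combination_power_integrable[of "\<lambda>k. if k = i then 1 else 0" k] by (simp add: single)

lemma Y_mult_integrable [simp]: 
  assumes "i \<in> I" "j \<in> I" shows "integrable M (\<lambda>\<omega>. Y i \<omega> * Y j \<omega>)"
proof (rule Bochner_Integration.integrable_bound)
  show "integrable M (\<lambda>\<omega>. Y i \<omega> ^ 2 + Y j \<omega> ^ 2)" using assms Y_power_integrable by auto
  show "AE \<omega> in M. norm (Y i \<omega> * Y j \<omega>) \<le> norm ((Y i \<omega>)\<^sup>2 + (Y j \<omega>)\<^sup>2)"
  proof (rule AE_I2)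
    fix \<omega> show "norm (Y i \<omega> * Y j \<omega>) \<le> norm ((Y i \<omega>)\<^sup>2 + (Y j \<omega>)\<^sup>2)"
      using abs_mult_le_squares[of "Y i \<omega>" "Y j \<omega>"] zero_le_power2[of "Y i \<omega>"] zero_le_power2[of "Y j \<omega>"] by simp
  qed
qed (use assms in auto)

lemma Y_integrable [simp]: "i \<in> I \<Longrightarrow> integrable M (Y i)"
  using Y_power_integrable[of i 1] by simp

text \<open>Polarization: the variances of \<open>Y i\<close>, \<open>Y j\<close> and of their sum
  are read off from the quadratic form, and the mixed term is what remains.\<close>

lemma Y_covariance: 
  assumes "i \<in> I" "j \<in> I" shows "(\<integral>\<omega>. Y i \<omega> * Y j \<omega> \<partial>M) = G i j"
proof -
  have q: "(\<integral>\<omega>. (\<Sum>k\<in>I. c k * Y k \<omega>) * (\<Sum>k\<in>I. c k * Y k \<omega>) \<partial>M) = (\<Sum>k\<in>I. c k * (\<Sum>l\<in>I. c l * G k l))" for c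
    using combination_square[of c] by (simp add: power2_eq_square sum_distrib_left mult.assoc)
  have sq: "(\<integral>\<omega>. Y i \<omega> * Y i \<omega> \<partial>M) = G i i" if "i \<in> I" for i
    using q[of "\<lambda>k. if k = i then 1 else 0"] that unfolding single[OF that] by simp
  have sum: "(\<Sum>k\<in>I. ((if k = i then 1 else 0) + (if k = j then 1 else 0)) * f k) = f i + f j" for f :: "'i \<Rightarrow> real"
    using single[OF assms(1), of 1 f] single[OF assms(2), of 1 f] by (simp add: distrib_right sum.distrib)
  have "(\<integral>\<omega>. (Y i \<omega> + Y j \<omega>) * (Y i \<omega> + Y j \<omega>) \<partial>M) = G i i + G i j + (G j i + G j j)"
    using q[of "\<lambda>k. (if k = i then 1 else 0) + (if k = j then 1 else 0)"] unfolding sum .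
  also have "(\<integral>\<omega>. (Y i \<omega> + Y j \<omega>) * (Y i \<omega> + Y j \<omega>) \<partial>M) = 
     (\<integral>\<omega>. Y i \<omega> * Y i \<omega> \<partial>M) + 2 * (\<integral>\<omega>. Y i \<omega> * Y j \<omega> \<partial>M) + (\<integral>\<omega>. Y j \<omega> * Y j \<omega> \<partial>M)"
    using assms by (simp add: algebra_simps)
  finally show ?thesis using sq assms G_sym[of j i] by simp
qed

end

section \<open>Integration by parts for exponentials of quadratic forms\<close>

context gaussian_family begin

text \<open>The integrand of the joint characteristic function before centering the squares; the
  frequencies are already absorbed into \<open>q\<close> and \<open>r\<close>. Having modulus one,
  it preserves integrability of whatever it multiplies.\<close>

definition quad_exp :: "real \<Rightarrow> real \<Rightarrow> ('i \<Rightarrow> real) \<Rightarrow> complex" where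
  "quad_exp q r y = iexp (q * (\<Sum>i\<in>I. (y i)\<^sup>2) + r * (\<Sum>i\<in>I. y i))"

lemma norm_quad_exp [simp]: "cmod (quad_exp q r y) = 1" by (simp add: quad_exp_def)

lemma quad_exp_cong: "(\<And>i. i \<in> I \<Longrightarrow> y i = z i) \<Longrightarrow> quad_exp q r y = quad_exp q r z"
  by (simp add: quad_exp_def cong: sum.cong)

lemma quad_exp_measurable [measurable]: "quad_exp q r \<in> borel_measurable (PiM I (\<lambda>_. borel))"
  unfolding quad_exp_def by measurable

lemma quad_exp_Y_measurable [measurable]: "(\<lambda>\<omega>. quad_exp q r (\<lambda>i. Y i \<omega>)) \<in> borel_measurable M"
  unfolding quad_exp_def by measurable

lemma integrable_mult_quad_exp:
  fixes f :: "'a \<Rightarrow> complex"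
  assumes "integrable M f" shows "integrable M (\<lambda>\<omega>. f \<omega> * quad_exp q r (\<lambda>i. Y i \<omega>))"
  by (rule Bochner_Integration.integrable_bound[OF assms]) (use assms in \<open>auto simp: norm_mult\<close>)

text \<open>The family is replaced by \<open>\<kappa>\<^sub>k x + Z\<^sub>k\<close> with \<open>x\<close> standard normal and independent of \<open>Z\<close>,
  where \<open>Z\<^sub>k\<close> is the residual of \<open>Y\<^sub>k\<close> after regression on \<open>Y\<^sub>a\<close>; then integrate by parts in \<open>x\<close>.\<close>

lemma quad_exp_by_parts:
  assumes a: "a \<in> I" and b: "b \<in> I"
  shows "(\<integral>\<omega>. of_real (Y a \<omega> * Y b \<omega>) * quad_exp q r (\<lambda>i. Y i \<omega>) \<partial>M) =
    of_real (G a b) * (\<integral>\<omega>. quad_exp q r (\<lambda>i. Y i \<omega>) \<partial>M) +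
    (\<Sum>c\<in>I. of_real (G a c) * (2 * \<i> * q * (\<integral>\<omega>. of_real (Y b \<omega> * Y c \<omega>) * quad_exp q r (\<lambda>i. Y i \<omega>) \<partial>M)
      + \<i> * r * (\<integral>\<omega>. of_real (Y b \<omega>) * quad_exp q r (\<lambda>i. Y i \<omega>) \<partial>M)))" (is "?L = ?R")
proof -
  let ?e = "\<lambda>\<omega>. quad_exp q r (\<lambda>i. Y i \<omega>)"
  \<comment> \<open>Both sides of the claim are written as expectations of functionals of the
    configuration \<open>y\<close>, so that each can be moved to a different probability space
    carrying the same joint law.\<close>
  define FL where "FL y = of_real (y a * y b) * quad_exp q r y" for y
  define FR where "FR y = of_real (G a b) * quad_exp q r y +
    (\<Sum>c\<in>I. of_real (G a c) * (2 * \<i> * q * (of_real (y b * y c) * quad_exp q r y)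
      + \<i> * r * (of_real (y b) * quad_exp q r y)))" for y
  have i0: "integrable M ?e" by (rule integrable_bounded[where B=1]) auto
  have i1: "integrable M (\<lambda>\<omega>. of_real (Y i \<omega>) * ?e \<omega>)" if "i \<in> I" for i
    using that by (intro integrable_mult_quad_exp) simp
  have i2: "integrable M (\<lambda>\<omega>. of_real (Y i \<omega> * Y j \<omega>) * ?e \<omega>)" if "i \<in> I" "j \<in> I" for i j
    using that by (intro integrable_mult_quad_exp integrable_of_real) simp
  have iL: "integrable M (\<lambda>\<omega>. FL (\<lambda>i. Y i \<omega>))" unfolding FL_def using a b by (rule i2)
  have iR: "integrable M (\<lambda>\<omega>. FR (\<lambda>i. Y i \<omega>))" unfolding FR_def
    using b by (intro Bochner_Integration.integrable_add integrable_mult_right Bochner_Integration.integrable_sum i0 i1 i2)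
  have R: "?R = (\<integral>\<omega>. FR (\<lambda>i. Y i \<omega>) \<partial>M)" 
  proof -
    have "(\<integral>\<omega>. FR (\<lambda>i. Y i \<omega>) \<partial>M) = (\<integral>\<omega>. of_real (G a b) * ?e \<omega> \<partial>M) + 
      (\<Sum>c\<in>I. (\<integral>\<omega>. of_real (G a c) * (2 * \<i> * q * (of_real (Y b \<omega> * Y c \<omega>) * ?e \<omega>)
      + \<i> * r * (of_real (Y b \<omega>) * ?e \<omega>)) \<partial>M))"
      unfolding FR_def
    proof (subst Bochner_Integration.integral_add)
      show "integrable M (\<lambda>\<omega>. of_real (G a b) * ?e \<omega>)" by (intro integrable_mult_right i0)
      have i: "integrable M (\<lambda>\<omega>. of_real (G a c) * (2 * \<i> * q * (of_real (Y b \<omega> * Y c \<omega>) * ?e \<omega>)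
        + \<i> * r * (of_real (Y b \<omega>) * ?e \<omega>)))" if "c \<in> I" for c
        using b that by (intro Bochner_Integration.integrable_add integrable_mult_right i1 i2)
      then show "integrable M (\<lambda>\<omega>. \<Sum>c\<in>I. of_real (G a c) * (2 * \<i> * q * (of_real (Y b \<omega> * Y c \<omega>) * ?e \<omega>)
        + \<i> * r * (of_real (Y b \<omega>) * ?e \<omega>)))" by (rule Bochner_Integration.integrable_sum)
      show "(\<integral>\<omega>. of_real (G a b) * ?e \<omega> \<partial>M) + (\<integral>\<omega>. (\<Sum>c\<in>I. of_real (G a c) * (2 * \<i> * q * (of_real (Y b \<omega> * Y c \<omega>) * ?e \<omega>)
        + \<i> * r * (of_real (Y b \<omega>) * ?e \<omega>))) \<partial>M) = (\<integral>\<omega>. of_real (G a b) * ?e \<omega> \<partial>M) + 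
      (\<Sum>c\<in>I. (\<integral>\<omega>. of_real (G a c) * (2 * \<i> * q * (of_real (Y b \<omega> * Y c \<omega>) * ?e \<omega>)
      + \<i> * r * (of_real (Y b \<omega>) * ?e \<omega>)) \<partial>M))"
        using Bochner_Integration.integral_sum[OF i, of I "\<lambda>c. c"] by simp
    qed
    also have "\<dots> = ?R"
    proof (intro arg_cong2[where f="(+)"] sum.cong refl)
      fix c assume c: "c \<in> I"
      show "(\<integral>\<omega>. of_real (G a c) * (2 * \<i> * q * (of_real (Y b \<omega> * Y c \<omega>) * ?e \<omega>) + \<i> * r * (of_real (Y b \<omega>) * ?e \<omega>)) \<partial>M) =
        of_real (G a c) * (2 * \<i> * q * (\<integral>\<omega>. of_real (Y b \<omega> * Y c \<omega>) * ?e \<omega> \<partial>M) + \<i> * r * (\<integral>\<omega>. of_real (Y b \<omega>) * ?e \<omega> \<partial>M))"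
        using Bochner_Integration.integral_add[OF integrable_mult_right[OF i2[OF b c], of "2 * \<i> * q"] integrable_mult_right[OF i1[OF b], of "\<i> * r"]]
        by (simp only: integral_mult_right_zero)
    qed (rule integral_mult_right_zero)
    finally show ?thesis ..
  qed
  have cov: "(\<integral>\<omega>. Y i \<omega> * Y j \<omega> \<partial>M) = G i j" if "i \<in> I" "j \<in> I" for i j using Y_covariance that .
  show ?thesis
  proof (cases "G a a = 0")
    case True
    \<comment> \<open>No regression on \<open>Y a\<close> is possible here. The variable vanishes
      almost everywhere, hence so do its covariances, and both sides are 0.\<close>
    have "AE \<omega> in M. Y a \<omega> * Y a \<omega> = 0"
      using integral_nonneg_eq_0_iff_AE[of M "\<lambda>\<omega>. Y a \<omega> * Y a \<omega>"] a cov[OF a a] True by simp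
    then have Y0: "AE \<omega> in M. Y a \<omega> = 0" by simp
    have G0: "G a c = 0" if "c \<in> I" for c
    proof -
      have "(\<integral>\<omega>. Y a \<omega> * Y c \<omega> \<partial>M) = (\<integral>\<omega>. 0 \<partial>M)"
        using Y0 a that by (intro integral_cong_AE) auto
      then show ?thesis using cov[OF a that] by simp
    qed
    have "?L = (\<integral>\<omega>. 0 \<partial>M)" using Y0 a b by (intro integral_cong_AE) auto
    then show ?thesis using G0 b by simp
  next
    case False
    have "0 \<le> G a a" using cov[OF a a] by (metis Bochner_Integration.integral_nonneg zero_le_square)
    with False have Ga: "G a a > 0" by simp
    define s where "s = sqrt (G a a)"
    have s: "s > 0" "s * s = G a a" using Ga by (auto simp: s_def)
    \<comment> \<open>The coefficient of \<open>Y k\<close> on the standardized variable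
      \<open>Y a / s\<close>. For k = a the coefficient is \<open>s\<close> and the residual is 0,
      so that the factor \<open>Y a\<close> turns into \<open>s * x\<close>.\<close>
    define \<kappa> where "\<kappa> k = G a k / s" for k
    define Z where "Z k \<omega> = Y k \<omega> - G a k / G a a * Y a \<omega>" for k \<omega>
    have [measurable]: "k \<in> I \<Longrightarrow> Z k \<in> borel_measurable M" for k unfolding Z_def using a by measurable
    interpret N: real_distribution std_normal_distribution by (rule real_dist_normal_dist)
    interpret P: pair_prob_space std_normal_distribution M ..
    let ?P = "std_normal_distribution \<Otimes>\<^sub>M M"
    define W where "W k = (\<lambda>(x, \<omega>). \<kappa> k * x + Z k \<omega>)" for k
    have W_meas [measurable]: "W k \<in> borel_measurable ?P" if "k \<in> I" for k using that unfolding W_def by measurable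
    \<comment> \<open>A comparison of characteristic functions takes the place of an independence
      proof for \<open>Y a\<close> and the residuals: the quadratic form of the combination splits
      into u squared, carried by x, and the quadratic form of the residual coefficients c'.\<close>
    have charW: "(\<integral>p. iexp (\<Sum>k\<in>I. c k * W k p) \<partial>?P) = (\<integral>\<omega>. iexp (\<Sum>k\<in>I. c k * Y k \<omega>) \<partial>M)" for c
    proof -
      define u where "u = (\<Sum>k\<in>I. c k * \<kappa> k)"
      define t where "t = (\<Sum>k\<in>I. c k * G a k) / G a a"
      define c' where "c' k = c k - (if k = a then t else 0)" for k
      have Zc: "(\<Sum>k\<in>I. c k * Z k \<omega>) = (\<Sum>k\<in>I. c' k * Y k \<omega>)" for \<omega>
        using single[OF a, of t "\<lambda>k. Y k \<omega>"]
        by (simp add: Z_def c'_def t_def algebra_simps sum_subtractf sum_distrib_left sum_distrib_right sum_divide_distrib)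
      have tG: "(\<Sum>k\<in>I. c k * G a k) = t * G a a" using Ga by (simp add: t_def)
      have ut: "u = t * s" 
      proof -
        have "u * s = t * s * s" unfolding mult.assoc s tG[symmetric] u_def \<kappa>_def sum_distrib_right using s by simp
        then show ?thesis using s by simp
      qed
      have quad: "(\<Sum>i\<in>I. \<Sum>j\<in>I. c' i * c' j * G i j) = (\<Sum>i\<in>I. \<Sum>j\<in>I. c i * c j * G i j) - u\<^sup>2"
      proof -
        have inner: "(\<Sum>j\<in>I. c' j * G i j) = (\<Sum>j\<in>I. c j * G i j) - t * G i a" for i
          using single[OF a, of t "G i"] by (simp add: c'_def left_diff_distrib sum_subtractf)
        have "(\<Sum>i\<in>I. \<Sum>j\<in>I. c' i * c' j * G i j) = (\<Sum>i\<in>I. c' i * ((\<Sum>j\<in>I. c j * G i j) - t * G i a))"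
          unfolding inner[symmetric] by (simp add: sum_distrib_left mult.assoc)
        also have "\<dots> = (\<Sum>i\<in>I. c i * ((\<Sum>j\<in>I. c j * G i j) - t * G i a)) - t * ((\<Sum>j\<in>I. c j * G a j) - t * G a a)"
          using single[OF a, of t "\<lambda>i. (\<Sum>j\<in>I. c j * G i j) - t * G i a"] by (simp add: c'_def left_diff_distrib sum_subtractf)
        also have "(\<Sum>i\<in>I. c i * ((\<Sum>j\<in>I. c j * G i j) - t * G i a)) = (\<Sum>i\<in>I. \<Sum>j\<in>I. c i * c j * G i j) - t * (\<Sum>i\<in>I. c i * G a i)"
          by (simp add: right_diff_distrib sum_subtractf sum_distrib_left mult_ac G_sym[of _ a])
        finally show ?thesis unfolding tG ut using s by (simp add: power2_eq_square mult_ac)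
      qed
      have "(\<integral>p. iexp (\<Sum>k\<in>I. c k * W k p) \<partial>?P) = (\<integral>x. \<integral>\<omega>. iexp (\<Sum>k\<in>I. c k * W k (x, \<omega>)) \<partial>M \<partial>std_normal_distribution)"
        by (rule P.integral_fst'[symmetric]) (auto intro!: P.integrable_bounded[where B=1])
      also have "\<dots> = (\<integral>x. \<integral>\<omega>. iexp (u * x) * iexp (\<Sum>k\<in>I. c' k * Y k \<omega>) \<partial>M \<partial>std_normal_distribution)"
        unfolding Zc[symmetric] exp_add[symmetric] distrib_left[symmetric] of_real_add[symmetric] u_def W_def
        by (simp add: algebra_simps sum.distrib sum_distrib_left)
      also have "\<dots> = char std_normal_distribution u * exp (- ((\<Sum>i\<in>I. \<Sum>j\<in>I. c i * c j * G i j) - u\<^sup>2) / 2)"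
        by (simp only: char_combination char_def quad integral_mult_right_zero integral_mult_left_zero)
      also have "\<dots> = exp (- (\<Sum>i\<in>I. \<Sum>j\<in>I. c i * c j * G i j) / 2)"
        unfolding char_std_normal_distribution by (simp flip: exp_add exp_of_real of_real_mult) (simp add: field_simps)
      finally show ?thesis by (simp only: char_combination)
    qed
    \<comment> \<open>Equal characteristic functions give equal joint laws, so the claim may be
      checked on the product space, where Fubini isolates the variable x.\<close>
    have law: "distr M (PiM I (\<lambda>_. borel)) (\<lambda>\<omega>. \<lambda>i\<in>I. Y i \<omega>) = distr ?P (PiM I (\<lambda>_. borel)) (\<lambda>p. \<lambda>i\<in>I. W i p)"
      by (rule char_eq_imp_distr_PiM_eq[OF prob_space_axioms P.prob_space_axioms finite_I Y_measurable W_meas charW[symmetric]])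
    have [measurable]: "FL \<in> borel_measurable (PiM I (\<lambda>_. borel))" "FR \<in> borel_measurable (PiM I (\<lambda>_. borel))"
      unfolding FL_def FR_def using a b by measurable
    have FL_cong: "FL (\<lambda>i\<in>I. y i) = FL y" and FR_cong: "FR (\<lambda>i\<in>I. y i) = FR y" for y
      using a b quad_exp_cong[of "\<lambda>i\<in>I. y i" y] by (simp_all add: FL_def FR_def cong: sum.cong)
    have transfer: "(\<integral>\<omega>. F (\<lambda>i. Y i \<omega>) \<partial>M) = (\<integral>p. F (\<lambda>i. W i p) \<partial>?P)" "integrable ?P (\<lambda>p. F (\<lambda>i. W i p))"
      if F [measurable]: "F \<in> borel_measurable (PiM I (\<lambda>_. borel))" and c: "\<And>y. F (\<lambda>i\<in>I. y i) = F y" and i: "integrable M (\<lambda>\<omega>. F (\<lambda>i. Y i \<omega>))"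
      for F :: "('i \<Rightarrow> real) \<Rightarrow> complex"
    proof -
      have mY: "(\<lambda>\<omega>. \<lambda>i\<in>I. Y i \<omega>) \<in> measurable M (PiM I (\<lambda>_. borel))" by measurable
      have mW: "(\<lambda>\<omega>. \<lambda>i\<in>I. W i \<omega>) \<in> measurable ?P (PiM I (\<lambda>_. borel))" by measurable
      show "(\<integral>\<omega>. F (\<lambda>i. Y i \<omega>) \<partial>M) = (\<integral>p. F (\<lambda>i. W i p) \<partial>?P)"
        using integral_distr[OF mY F] integral_distr[OF mW F] unfolding law c by simp
      show "integrable ?P (\<lambda>p. F (\<lambda>i. W i p))"
        using integrable_distr_eq[OF mY F] integrable_distr_eq[OF mW F] i unfolding law c by simp
    qed
    note tL = transfer[OF _ FL_cong iL, simplified] and tR = transfer[OF _ FR_cong iR, simplified]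
    have Za: "Z a \<omega> = 0" for \<omega> using Ga by (simp add: Z_def)
    have \<kappa>a: "\<kappa> a = s" using s by (simp add: \<kappa>_def field_simps)
    have inner: "(\<integral>x. FL (\<lambda>i. W i (x, \<omega>)) \<partial>std_normal_distribution) = (\<integral>x. FR (\<lambda>i. W i (x, \<omega>)) \<partial>std_normal_distribution)" for \<omega>
    proof -
      \<comment> \<open>With this choice \<open>x * h x\<close> is the integrand of the left side
        and \<open>h'\<close> that of the right side, for each fixed value of the residuals.\<close>
      define h where "h x = of_real (s * (\<kappa> b * x + Z b \<omega>)) * quad_exp q r (\<lambda>i. \<kappa> i * x + Z i \<omega>)" for x
      define D where "D x = (\<Sum>k\<in>I. \<kappa> k * (2 * q * (\<kappa> k * x + Z k \<omega>) + r))" for x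
      define h' where "h' x = of_real (s * \<kappa> b) * quad_exp q r (\<lambda>i. \<kappa> i * x + Z i \<omega>) + 
        of_real (s * (\<kappa> b * x + Z b \<omega>) * D x) * \<i> * quad_exp q r (\<lambda>i. \<kappa> i * x + Z i \<omega>)" for x
      have dq: "((\<lambda>x. q * (\<Sum>i\<in>I. (\<kappa> i * x + Z i \<omega>)\<^sup>2) + r * (\<Sum>i\<in>I. \<kappa> i * x + Z i \<omega>)) has_real_derivative D x) (at x)" for x
        by (auto intro!: derivative_eq_intros simp: D_def sum_distrib_left sum.distrib algebra_simps)
      have de: "((\<lambda>x. quad_exp q r (\<lambda>i. \<kappa> i * x + Z i \<omega>)) has_vector_derivative D x *\<^sub>R (\<i> * quad_exp q r (\<lambda>i. \<kappa> i * x + Z i \<omega>))) (at x)" for x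
        unfolding quad_exp_def
        using vector_diff_chain_at[OF dq[THEN has_real_derivative_iff_has_vector_derivative[THEN iffD1]] has_vector_derivative_iexp]
        by (simp add: o_def)
      have "(h has_vector_derivative h' x) (at x)" for x
        unfolding h_def h'_def
        by (rule has_vector_derivative_eq_rhs, rule has_vector_derivative_mult[OF has_vector_derivative_of_real de])
           (auto intro!: derivative_eq_intros simp: scaleR_conv_of_real algebra_simps)
      moreover have "isCont h' x" for x unfolding h'_def quad_exp_def D_def by (intro continuous_intros)
      moreover define A where "A = s * (\<bar>\<kappa> b\<bar> + \<bar>Z b \<omega>\<bar>)"
      moreover define B where "B = (\<Sum>k\<in>I. \<bar>\<kappa> k\<bar> * (2 * \<bar>q\<bar> * (\<bar>\<kappa> k\<bar> + \<bar>Z k \<omega>\<bar>) + \<bar>r\<bar>))"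
      moreover have lin: "\<bar>u * x + v\<bar> \<le> (\<bar>u\<bar> + \<bar>v\<bar>) * (1 + \<bar>x\<bar>)" for u v x :: real
      proof -
        have "\<bar>u * x + v\<bar> \<le> \<bar>u\<bar> * \<bar>x\<bar> + \<bar>v\<bar>" using abs_triangle_ineq[of "u*x" v] by (simp add: abs_mult)
        then show ?thesis by (simp add: algebra_simps) (smt (verit) mult_nonneg_nonneg abs_ge_zero)
      qed
      moreover have B0: "B \<ge> 0" unfolding B_def by (intro sum_nonneg) auto
      moreover have A0: "A \<ge> 0" unfolding A_def using s by simp
      moreover have bA: "\<bar>s * (\<kappa> b * x + Z b \<omega>)\<bar> \<le> A * (1 + \<bar>x\<bar>)" for x
        unfolding A_def using lin[of "\<kappa> b" x "Z b \<omega>"] s by (simp add: abs_mult mult.assoc)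
      moreover have bD: "\<bar>D x\<bar> \<le> B * (1 + \<bar>x\<bar>)" for x
        unfolding D_def B_def sum_distrib_right
      proof (rule order_trans[OF sum_abs sum_mono])
        fix k
        have "\<bar>2 * q * (\<kappa> k * x + Z k \<omega>) + r\<bar> \<le> 2 * \<bar>q\<bar> * ((\<bar>\<kappa> k\<bar> + \<bar>Z k \<omega>\<bar>) * (1 + \<bar>x\<bar>)) + \<bar>r\<bar> * 1"
          by (rule order_trans[OF abs_triangle_ineq]) (auto simp: abs_mult intro!: add_mono mult_left_mono lin)
        also have "\<dots> \<le> 2 * \<bar>q\<bar> * ((\<bar>\<kappa> k\<bar> + \<bar>Z k \<omega>\<bar>) * (1 + \<bar>x\<bar>)) + \<bar>r\<bar> * (1 + \<bar>x\<bar>)"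
          by (intro add_mono mult_left_mono) auto
        also have "\<dots> = (2 * \<bar>q\<bar> * (\<bar>\<kappa> k\<bar> + \<bar>Z k \<omega>\<bar>) + \<bar>r\<bar>) * (1 + \<bar>x\<bar>)"
          by (simp add: algebra_simps)
        finally show "\<bar>\<kappa> k * (2 * q * (\<kappa> k * x + Z k \<omega>) + r)\<bar> \<le> \<bar>\<kappa> k\<bar> * (2 * \<bar>q\<bar> * (\<bar>\<kappa> k\<bar> + \<bar>Z k \<omega>\<bar>) + \<bar>r\<bar>) * (1 + \<bar>x\<bar>)"
          unfolding abs_mult[of "\<kappa> k"] mult.assoc[of "\<bar>\<kappa> k\<bar>"] by (rule mult_left_mono) simp
      qed
      moreover have "cmod (h x) \<le> (A + A * B) * (1 + \<bar>x\<bar>)" for x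
      proof -
        have "cmod (h x) = \<bar>s * (\<kappa> b * x + Z b \<omega>)\<bar>" unfolding h_def norm_mult norm_quad_exp norm_of_real by simp
        also have "\<dots> \<le> A * (1 + \<bar>x\<bar>)" by (rule bA)
        also have "\<dots> \<le> (A + A * B) * (1 + \<bar>x\<bar>)" using A0 B0 by (intro mult_right_mono) auto
        finally show ?thesis .
      qed
      moreover have "cmod (h' x) \<le> (A + A * B) * (1 + \<bar>x\<bar>)\<^sup>2" for x
      proof -
        have "cmod (h' x) \<le> \<bar>s * \<kappa> b\<bar> + \<bar>s * (\<kappa> b * x + Z b \<omega>)\<bar> * \<bar>D x\<bar>"
          unfolding h'_def by (rule order_trans[OF norm_triangle_ineq]) (simp only: norm_mult norm_of_real norm_quad_exp abs_mult norm_ii mult_1_right order_refl)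
        also have "\<dots> \<le> A + (A * (1 + \<bar>x\<bar>)) * (B * (1 + \<bar>x\<bar>))"
          using A0 s by (intro add_mono mult_mono bA bD) (auto simp: A_def abs_mult algebra_simps)
        also have "\<dots> \<le> A * (1 + \<bar>x\<bar>)\<^sup>2 + (A * (1 + \<bar>x\<bar>)) * (B * (1 + \<bar>x\<bar>))"
          using mult_left_mono[OF one_le_power[of "1 + \<bar>x\<bar>" 2] A0] by simp
        finally show ?thesis by (simp add: algebra_simps power2_eq_square)
      qed
      ultimately have "(\<integral>x. x * h x \<partial>std_normal_distribution) = (\<integral>x. h' x \<partial>std_normal_distribution)"
        by (intro integral_std_normal_by_parts[where A = "A + A * B"])
      moreover have "x * h x = FL (\<lambda>i. W i (x, \<omega>))" for x
        unfolding h_def FL_def W_def by (simp add: Za \<kappa>a)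
      moreover have "h' x = FR (\<lambda>i. W i (x, \<omega>))" for x
      proof -
        have sk: "G a c = s * \<kappa> c" for c using s by (simp add: \<kappa>_def)
        have "s * (\<kappa> b * x + Z b \<omega>) * D x = (\<Sum>c\<in>I. G a c * (2 * q * ((\<kappa> b * x + Z b \<omega>) * (\<kappa> c * x + Z c \<omega>)) + r * (\<kappa> b * x + Z b \<omega>)))"
          unfolding D_def sum_distrib_left
          by (intro sum.cong refl) (simp add: sk algebra_simps)
        then show ?thesis using s
          by (simp add: h'_def FR_def W_def \<kappa>_def[of b] sum_distrib_right sum_distrib_left)
             (simp add: \<kappa>_def algebra_simps)
      qed
      ultimately show ?thesis by simp
    qed
    have "?L = (\<integral>\<omega>. FL (\<lambda>i. Y i \<omega>) \<partial>M)" by (simp add: FL_def)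
    also have "\<dots> = (\<integral>\<omega>. \<integral>x. FL (\<lambda>i. W i (x, \<omega>)) \<partial>std_normal_distribution \<partial>M)"
      using P.integral_snd[of "\<lambda>x \<omega>. FL (\<lambda>i. W i (x, \<omega>))"] tL by (simp add: case_prod_beta')
    also have "\<dots> = (\<integral>\<omega>. FR (\<lambda>i. Y i \<omega>) \<partial>M)"
      using P.integral_snd[of "\<lambda>x \<omega>. FR (\<lambda>i. W i (x, \<omega>))"] tR by (simp add: case_prod_beta' inner)
    finally show ?thesis unfolding R .
  qed
qed

end

section \<open>Quadratic and linear forms of a Gaussian family\<close>

text \<open>A global quadratic remainder bound is the form in which a Taylor estimate survives
  integration; it replaces an interchange of derivative and integral.\<close>

lemma has_vector_derivative_quadratic_bound:
  fixes f :: "real \<Rightarrow> 'b::real_normed_vector"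
  assumes "\<And>y. norm (f y - f x - (y - x) *\<^sub>R v) \<le> K * (y - x)\<^sup>2"
  shows "(f has_vector_derivative v) (at x)"
  unfolding has_vector_derivative_def has_derivative_iff_norm
proof (rule conjI[OF bounded_linear_scaleR_left], rule Lim_null_comparison)
  have "norm (norm (f y - f x - (y - x) *\<^sub>R v) / norm (y - x)) \<le> K * \<bar>y - x\<bar>" for y
  proof (cases "y = x")
    case False
    have "norm (f y - f x - (y - x) *\<^sub>R v) \<le> K * \<bar>y - x\<bar> * \<bar>y - x\<bar>"
      using assms[of y] by (simp add: power2_eq_square abs_mult[symmetric] mult.assoc)
    then show ?thesis using False by (simp add: divide_simps)
  qed simp
  then show "\<forall>\<^sub>F y in at x. norm (norm (f y - f x - (y - x) *\<^sub>R v) / norm (y - x)) \<le> K * \<bar>y - x\<bar>"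
    by (intro always_eventually allI)
  have "((\<lambda>y. K * \<bar>y - x\<bar>) \<longlongrightarrow> K * \<bar>x - x\<bar>) (at x)" by (intro tendsto_intros)
  then show "((\<lambda>y. K * \<bar>y - x\<bar>) \<longlongrightarrow> 0) (at x)" by simp
qed

text \<open>The remainder of the first-order expansion of exp (i x) is at most half of x squared.
  Taken at \<open>(y - s) * Q\<close> and integrated, it is \<open>(y - s)\<close> squared times
  half the second moment of \<open>Q\<close>, so two moments suffice.\<close>

lemma (in prob_space) has_vector_derivative_char:
  assumes [measurable]: "Q \<in> borel_measurable M" "L \<in> borel_measurable M"
    and Q2: "integrable M (\<lambda>\<omega>. (Q \<omega>)\<^sup>2)" and Q1: "integrable M Q"
  shows "((\<lambda>s. \<integral>\<omega>. iexp (s * Q \<omega> + L \<omega>) \<partial>M) has_vector_derivative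
     (\<integral>\<omega>. \<i> * Q \<omega> * iexp (s * Q \<omega> + L \<omega>) \<partial>M)) (at s)"
proof (rule has_vector_derivative_quadratic_bound)
  fix y
  have i0: "integrable M (\<lambda>\<omega>. iexp (s * Q \<omega> + L \<omega>))" for s
    by (rule integrable_bounded[where B=1]) auto
  have i1: "integrable M (\<lambda>\<omega>. \<i> * Q \<omega> * iexp (s * Q \<omega> + L \<omega>))"
    by (rule Bochner_Integration.integrable_bound[OF Q1]) (auto simp: norm_mult)
  have pt: "cmod (iexp (y * Q \<omega> + L \<omega>) - iexp (s * Q \<omega> + L \<omega>) - (y - s) *\<^sub>R (\<i> * Q \<omega> * iexp (s * Q \<omega> + L \<omega>))) \<le> (y - s)\<^sup>2 / 2 * (Q \<omega>)\<^sup>2" for \<omega>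
  proof -
    let ?x = "(y - s) * Q \<omega>"
    have e: "y * Q \<omega> + L \<omega> = ?x + (s * Q \<omega> + L \<omega>)" by (simp add: algebra_simps)
    have "iexp (y * Q \<omega> + L \<omega>) - iexp (s * Q \<omega> + L \<omega>) - (y - s) *\<^sub>R (\<i> * Q \<omega> * iexp (s * Q \<omega> + L \<omega>))
      = (iexp ?x - (\<Sum>k\<le>1. (\<i> * ?x)^k / fact k)) * iexp (s * Q \<omega> + L \<omega>)"
      unfolding e of_real_add distrib_left exp_add
      by (simp add: scaleR_conv_of_real algebra_simps)
    also have "cmod \<dots> \<le> \<bar>?x\<bar>^2 / 2"
      using iexp_approx1[of ?x 1] by (simp add: norm_mult numeral_2_eq_2)
    finally show ?thesis by (simp add: power_mult_distrib)
  qed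
  have eq: "(\<integral>\<omega>. iexp (y * Q \<omega> + L \<omega>) \<partial>M) - (\<integral>\<omega>. iexp (s * Q \<omega> + L \<omega>) \<partial>M) - (y - s) *\<^sub>R (\<integral>\<omega>. \<i> * Q \<omega> * iexp (s * Q \<omega> + L \<omega>) \<partial>M)
    = (\<integral>\<omega>. iexp (y * Q \<omega> + L \<omega>) - iexp (s * Q \<omega> + L \<omega>) - (y - s) *\<^sub>R (\<i> * Q \<omega> * iexp (s * Q \<omega> + L \<omega>)) \<partial>M)"
    using Bochner_Integration.integral_diff[OF Bochner_Integration.integrable_diff[OF i0 i0] integrable_scaleR_right[OF i1, of "y - s"], of y s]
      Bochner_Integration.integral_diff[OF i0 i0, of y s] by (simp only: integral_scaleR_right)
  have "norm (\<integral>\<omega>. iexp (y * Q \<omega> + L \<omega>) - iexp (s * Q \<omega> + L \<omega>) - (y - s) *\<^sub>R (\<i> * Q \<omega> * iexp (s * Q \<omega> + L \<omega>)) \<partial>M) \<le> (\<integral>\<omega>. (y - s)\<^sup>2 / 2 * (Q \<omega>)\<^sup>2 \<partial>M)"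
  proof (rule order_trans[OF integral_norm_bound integral_mono])
    show "integrable M (\<lambda>\<omega>. cmod (iexp (y * Q \<omega> + L \<omega>) - iexp (s * Q \<omega> + L \<omega>) - (y - s) *\<^sub>R (\<i> * Q \<omega> * iexp (s * Q \<omega> + L \<omega>))))"
      by (intro integrable_norm Bochner_Integration.integrable_diff integrable_scaleR_right i0 i1)
    show "integrable M (\<lambda>\<omega>. (y - s)\<^sup>2 / 2 * (Q \<omega>)\<^sup>2)" using Q2 by (intro integrable_mult_right)
  qed (rule pt)
  also have "\<dots> = (\<integral>\<omega>. (Q \<omega>)\<^sup>2 \<partial>M) / 2 * (y - s)\<^sup>2" by simp
  finally show "norm ((\<integral>\<omega>. iexp (y * Q \<omega> + L \<omega>) \<partial>M) - (\<integral>\<omega>. iexp (s * Q \<omega> + L \<omega>) \<partial>M) - (y - s) *\<^sub>R (\<integral>\<omega>. \<i> * Q \<omega> * iexp (s * Q \<omega> + L \<omega>) \<partial>M)) 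
    \<le> (\<integral>\<omega>. (Q \<omega>)\<^sup>2 \<partial>M) / 2 * (y - s)\<^sup>2" by (simp only: eq)
qed

text \<open>This is nonnegativity of the variance of the absolute value of \<open>V\<close>.\<close>

lemma (in prob_space) expectation_abs_le_sqrt:
  assumes [measurable]: "V \<in> borel_measurable M" and V: "integrable M (\<lambda>\<omega>. (V \<omega>)\<^sup>2)"
  shows "(\<integral>\<omega>. \<bar>V \<omega>\<bar> \<partial>M) \<le> sqrt (\<integral>\<omega>. (V \<omega>)\<^sup>2 \<partial>M)"
proof -
  have i: "integrable M (\<lambda>\<omega>. \<bar>V \<omega>\<bar>)"
    by (intro integrable_abs square_integrable_imp_integrable[OF _ V]) measurable
  have "0 \<le> (\<integral>\<omega>. (V \<omega>)\<^sup>2 \<partial>M) - (\<integral>\<omega>. \<bar>V \<omega>\<bar> \<partial>M)\<^sup>2"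
    using variance_eq[OF i] V variance_positive[of "\<lambda>\<omega>. \<bar>V \<omega>\<bar>"] by simp
  then show ?thesis by (intro real_le_rsqrt) simp
qed

section \<open>Quantitative Gaussian approximation of the joint characteristic function\<close>

context gaussian_family begin

lemma linear_sq_integrable [simp]: "integrable M (\<lambda>\<omega>. (\<Sum>c\<in>I. g c * Y c \<omega>)\<^sup>2)"
  by (rule combination_power_integrable)

lemma linear_abs_bound: "(\<integral>\<omega>. \<bar>\<Sum>c\<in>I. g c * Y c \<omega>\<bar> \<partial>M) \<le> sqrt (\<Sum>i\<in>I. \<Sum>j\<in>I. g i * g j * G i j)"
  using expectation_abs_le_sqrt[OF combination_measurable linear_sq_integrable, of g] unfolding combination_square .

lemma square_centered_mult_integrable:
  assumes "a \<in> I" "b \<in> I"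
  shows "integrable M (\<lambda>\<omega>. ((Y a \<omega>)\<^sup>2 - g) * ((Y b \<omega>)\<^sup>2 - h))"
proof (rule Bochner_Integration.integrable_bound)
  have sq: "integrable M (\<lambda>\<omega>. ((Y a \<omega>)\<^sup>2 - g)\<^sup>2)" if "a \<in> I" for a g
  proof -
    have "(y\<^sup>2 - g)\<^sup>2 = y ^ 4 - 2 * g * y\<^sup>2 + g\<^sup>2" for y :: real
      by (simp add: power2_eq_square power4_eq_xxxx algebra_simps)
    then show ?thesis using Y_power_integrable[OF that, of 4] Y_power_integrable[OF that, of 2] by simp
  qed
  show "integrable M (\<lambda>\<omega>. (((Y a \<omega>)\<^sup>2 - g)\<^sup>2 + ((Y b \<omega>)\<^sup>2 - h)\<^sup>2) / 2)"
    using sq assms by simp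
  show "AE \<omega> in M. norm (((Y a \<omega>)\<^sup>2 - g) * ((Y b \<omega>)\<^sup>2 - h)) \<le> norm ((((Y a \<omega>)\<^sup>2 - g)\<^sup>2 + ((Y b \<omega>)\<^sup>2 - h)\<^sup>2) / 2)"
  proof (rule AE_I2)
    fix \<omega>
    have "0 \<le> (((Y a \<omega>)\<^sup>2 - g)\<^sup>2 + ((Y b \<omega>)\<^sup>2 - h)\<^sup>2) / 2" by simp
    then show "norm (((Y a \<omega>)\<^sup>2 - g) * ((Y b \<omega>)\<^sup>2 - h)) \<le> norm ((((Y a \<omega>)\<^sup>2 - g)\<^sup>2 + ((Y b \<omega>)\<^sup>2 - h)\<^sup>2) / 2)"
      using abs_mult_le_squares[of "(Y a \<omega>)\<^sup>2 - g" "(Y b \<omega>)\<^sup>2 - h"] by (simp only: real_norm_def abs_of_nonneg)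
  qed
qed (use assms in auto)

text \<open>The left side is the trace of the cube of \<open>G\<close>, and \<rho> bounds the
  operator norm of \<open>G\<close> by Schur's test. The elementary version splits the product of
  two entries by the arithmetic-geometric mean and sums the third entry over its free index.\<close>

lemma quad_form_cubic_bound:
  assumes rho: "\<And>a. a \<in> I \<Longrightarrow> (\<Sum>c\<in>I. \<bar>G a c\<bar>) \<le> \<rho>"
  shows "(\<Sum>a\<in>I. \<Sum>c\<in>I. \<Sum>d\<in>I. G a c * G a d * G c d) \<le> \<rho> * (\<Sum>a\<in>I. \<Sum>c\<in>I. (G a c)\<^sup>2)"
proof -
  have "(\<Sum>a\<in>I. \<Sum>c\<in>I. \<Sum>d\<in>I. G a c * G a d * G c d) \<le> (\<Sum>a\<in>I. \<Sum>c\<in>I. \<Sum>d\<in>I. ((G a c)\<^sup>2 * \<bar>G c d\<bar> + (G a d)\<^sup>2 * \<bar>G c d\<bar>) / 2)"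
  proof (intro sum_mono)
    fix a c d
    have "G a c * G a d * G c d \<le> \<bar>G a c * G a d\<bar> * \<bar>G c d\<bar>" by (simp add: abs_mult[symmetric])
    also have "\<dots> \<le> ((G a c)\<^sup>2 + (G a d)\<^sup>2) / 2 * \<bar>G c d\<bar>" by (intro mult_right_mono abs_mult_le_squares) auto
    finally show "G a c * G a d * G c d \<le> ((G a c)\<^sup>2 * \<bar>G c d\<bar> + (G a d)\<^sup>2 * \<bar>G c d\<bar>) / 2" by (simp add: algebra_simps)
  qed
  also have "\<dots> = ((\<Sum>a\<in>I. \<Sum>c\<in>I. \<Sum>d\<in>I. (G a c)\<^sup>2 * \<bar>G c d\<bar>) + (\<Sum>a\<in>I. \<Sum>c\<in>I. \<Sum>d\<in>I. (G a d)\<^sup>2 * \<bar>G c d\<bar>)) / 2"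
    by (simp add: sum.distrib sum_divide_distrib[symmetric])
  also have "(\<Sum>a\<in>I. \<Sum>c\<in>I. \<Sum>d\<in>I. (G a d)\<^sup>2 * \<bar>G c d\<bar>) = (\<Sum>a\<in>I. \<Sum>c\<in>I. \<Sum>d\<in>I. (G a c)\<^sup>2 * \<bar>G c d\<bar>)"
  proof (rule sum.cong[OF refl])
    fix a
    have "(\<Sum>c\<in>I. \<Sum>d\<in>I. (G a d)\<^sup>2 * \<bar>G c d\<bar>) = (\<Sum>d\<in>I. \<Sum>c\<in>I. (G a d)\<^sup>2 * \<bar>G c d\<bar>)" by (rule sum.swap)
    then show "(\<Sum>c\<in>I. \<Sum>d\<in>I. (G a d)\<^sup>2 * \<bar>G c d\<bar>) = (\<Sum>c\<in>I. \<Sum>d\<in>I. (G a c)\<^sup>2 * \<bar>G c d\<bar>)"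
      by (simp add: G_sym)
  qed
  also have "((\<Sum>a\<in>I. \<Sum>c\<in>I. \<Sum>d\<in>I. (G a c)\<^sup>2 * \<bar>G c d\<bar>) + (\<Sum>a\<in>I. \<Sum>c\<in>I. \<Sum>d\<in>I. (G a c)\<^sup>2 * \<bar>G c d\<bar>)) / 2 = (\<Sum>a\<in>I. \<Sum>c\<in>I. (G a c)\<^sup>2 * (\<Sum>d\<in>I. \<bar>G c d\<bar>))"
    unfolding sum_distrib_left by simp
  also have "\<dots> \<le> (\<Sum>a\<in>I. \<Sum>c\<in>I. (G a c)\<^sup>2 * \<rho>)"
    by (intro sum_mono mult_left_mono rho) auto
  finally show ?thesis by (simp add: sum_distrib_left mult.commute)
qed

text \<open>Integrating by parts twice shows that \<open>\<phi> x = E (exp (i x Q + i L))\<close> nearly solves \<open>\<phi>' = - 2 x w \<phi>\<close> with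
  \<open>w = q\<^sup>2 T\<close>; the mean value theorem is applied to \<open>exp (w x\<^sup>2) \<phi> x\<close>.\<close>

lemma char_quadratic_linear_approx:
  assumes rho: "\<And>a. a \<in> I \<Longrightarrow> (\<Sum>c\<in>I. \<bar>G a c\<bar>) \<le> \<rho>" and rho0: "\<rho> > 0" and q: "q \<ge> 0"
  defines "T \<equiv> (\<Sum>a\<in>I. \<Sum>c\<in>I. (G a c)\<^sup>2)" and "N \<equiv> real (card I)"
  shows "cmod ((\<integral>\<omega>. iexp (s * (q * (\<Sum>a\<in>I. (Y a \<omega>)\<^sup>2 - G a a)) + u * (\<Sum>a\<in>I. Y a \<omega>)) \<partial>M)
      - exp (- (s\<^sup>2 * (q\<^sup>2 * T)) - u\<^sup>2 * (\<Sum>a\<in>I. \<Sum>c\<in>I. G a c) / 2))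
    \<le> \<bar>s\<bar> * (q * (4 * s\<^sup>2 * q\<^sup>2 * \<rho> * T + \<bar>s\<bar> * q * \<bar>u\<bar> * \<rho> * sqrt \<rho> * (T + N) + \<bar>u\<bar> * sqrt (N * \<rho> ^ 3)))"
proof -
  define Q where "Q \<omega> = q * (\<Sum>a\<in>I. (Y a \<omega>)\<^sup>2 - G a a)" for \<omega>
  define L where "L \<omega> = u * (\<Sum>a\<in>I. Y a \<omega>)" for \<omega>
  have [measurable]: "Q \<in> borel_measurable M" "L \<in> borel_measurable M" unfolding Q_def L_def by measurable
  have Q2: "integrable M (\<lambda>\<omega>. (Q \<omega>)\<^sup>2)"
    unfolding Q_def power_mult_distrib power2_eq_square[of "sum _ _"] sum_product
    by (intro integrable_mult_right Bochner_Integration.integrable_sum square_centered_mult_integrable)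
  have Q1: "integrable M Q" by (rule square_integrable_imp_integrable[OF _ Q2]) measurable
  define e where "e x \<omega> = iexp (x * Q \<omega> + L \<omega>)" for x \<omega>
  have e_meas [measurable]: "e x \<in> borel_measurable M" for x unfolding e_def by measurable
  have e1 [simp]: "cmod (e x \<omega>) = 1" for x \<omega> by (simp add: e_def)
  have ie: "integrable M (\<lambda>\<omega>. of_real (f \<omega>) * e x \<omega>)" if "integrable M f" for f x
    using that by (intro Bochner_Integration.integrable_bound[OF that]) (auto simp: norm_mult)
  define \<phi> where "\<phi> x = (\<integral>\<omega>. e x \<omega> \<partial>M)" for x
  \<comment> \<open>The phase produced by centering the squares. It is constant in \<omega>, so the
    by-parts identity carries over from \<open>quad_exp\<close> to \<open>e\<close>.\<close>
  define k where "k x = iexp (- x * q * (\<Sum>a\<in>I. G a a))" for x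
  have e_quad: "e x \<omega> = k x * quad_exp (x * q) u (\<lambda>i. Y i \<omega>)" for x \<omega>
    unfolding e_def k_def quad_exp_def exp_add[symmetric] distrib_left[symmetric] of_real_add[symmetric] Q_def L_def
    by (simp add: sum_subtractf algebra_simps)
  have kE: "(\<integral>\<omega>. f \<omega> * e x \<omega> \<partial>M) = k x * (\<integral>\<omega>. f \<omega> * quad_exp (x * q) u (\<lambda>i. Y i \<omega>) \<partial>M)" for f x
  proof -
    have "(\<integral>\<omega>. f \<omega> * e x \<omega> \<partial>M) = (\<integral>\<omega>. k x * (f \<omega> * quad_exp (x * q) u (\<lambda>i. Y i \<omega>)) \<partial>M)"
      by (simp add: e_quad mult_ac)
    then show ?thesis by simp
  qed
  define E2 where "E2 x a b = (\<integral>\<omega>. of_real (Y a \<omega> * Y b \<omega>) * e x \<omega> \<partial>M)" for x a b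
  define E1 where "E1 x a = (\<integral>\<omega>. of_real (Y a \<omega>) * e x \<omega> \<partial>M)" for x a
  have parts: "E2 x a b = of_real (G a b) * \<phi> x + (\<Sum>c\<in>I. of_real (G a c) * (2 * \<i> * (x * q) * E2 x b c + \<i> * u * E1 x b))"
    if "a \<in> I" "b \<in> I" for x a b
  proof -
    define J0 where "J0 = (\<integral>\<omega>. quad_exp (x * q) u (\<lambda>i. Y i \<omega>) \<partial>M)"
    define J1 where "J1 c = (\<integral>\<omega>. of_real (Y c \<omega>) * quad_exp (x * q) u (\<lambda>i. Y i \<omega>) \<partial>M)" for c
    define J2 where "J2 c d = (\<integral>\<omega>. of_real (Y c \<omega> * Y d \<omega>) * quad_exp (x * q) u (\<lambda>i. Y i \<omega>) \<partial>M)" for c d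
    have \<phi>: "\<phi> x = k x * J0" using kE[of "\<lambda>_. 1" x] by (simp add: \<phi>_def J0_def)
    have E1: "E1 x c = k x * J1 c" for c unfolding E1_def J1_def by (rule kE)
    have E2: "E2 x c d = k x * J2 c d" for c d unfolding E2_def J2_def by (rule kE)
    have "J2 a b = of_real (G a b) * J0 + (\<Sum>c\<in>I. of_real (G a c) * (2 * \<i> * (x * q) * J2 b c + \<i> * u * J1 b))"
      unfolding J0_def J1_def J2_def by (rule quad_exp_by_parts[OF that])
    then show ?thesis unfolding \<phi> E1 E2 by (simp add: algebra_simps sum_distrib_left)
  qed
  have bound: "\<bar>x\<bar> \<le> \<bar>s\<bar> \<Longrightarrow> cmod ((\<integral>\<omega>. \<i> * Q \<omega> * e x \<omega> \<partial>M) + 2 * x * (q\<^sup>2 * T) * \<phi> x) \<le> 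
      q * (4 * s\<^sup>2 * q\<^sup>2 * \<rho> * T + \<bar>s\<bar> * q * \<bar>u\<bar> * \<rho> * sqrt \<rho> * (T + N) + \<bar>u\<bar> * sqrt (N * \<rho> ^ 3))" for x
  proof -
    assume x: "\<bar>x\<bar> \<le> \<bar>s\<bar>"
    \<comment> \<open>\<open>V\<close> is the matrix \<open>G\<close> applied to the vector
      \<open>Y\<close>, and \<open>g\<close> is \<open>G\<close> applied to the vector of ones. The
      three remainders are the tilted expectations of the squared norm of \<open>V\<close>, of the
      inner product of \<open>V\<close> and \<open>g\<close>, and of that of \<open>g\<close> and
      \<open>Y\<close>.\<close>
    define V where "V a \<omega> = (\<Sum>c\<in>I. G a c * Y c \<omega>)" for a \<omega>
    define g where "g a = (\<Sum>c\<in>I. G a c)" for a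
    have g: "\<bar>g a\<bar> \<le> \<rho>" if "a \<in> I" for a unfolding g_def using rho[OF that] by (rule order_trans[OF sum_abs])
    have [measurable]: "V a \<in> borel_measurable M" for a unfolding V_def by measurable
    have V2: "integrable M (\<lambda>\<omega>. (V a \<omega>)\<^sup>2)" for a unfolding V_def by simp
    have V1: "integrable M (V a)" for a by (rule square_integrable_imp_integrable[OF _ V2]) measurable
    define S3 where "S3 = (\<integral>\<omega>. of_real (\<Sum>a\<in>I. (V a \<omega>)\<^sup>2) * e x \<omega> \<partial>M)"
    define S2 where "S2 = (\<integral>\<omega>. of_real (\<Sum>a\<in>I. V a \<omega> * g a) * e x \<omega> \<partial>M)"
    define S1 where "S1 = (\<integral>\<omega>. of_real (\<Sum>a\<in>I. g a * Y a \<omega>) * e x \<omega> \<partial>M)"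
    have S3: "S3 = (\<Sum>a\<in>I. \<Sum>c\<in>I. \<Sum>d\<in>I. of_real (G a c * G a d) * E2 x c d)"
    proof -
      have "S3 = (\<integral>\<omega>. (\<Sum>a\<in>I. \<Sum>c\<in>I. \<Sum>d\<in>I. of_real (G a c * G a d) * (of_real (Y c \<omega> * Y d \<omega>) * e x \<omega>)) \<partial>M)"
        unfolding S3_def V_def power2_eq_square sum_product of_real_sum sum_distrib_right by (simp add: sum_distrib_left mult_ac)
      also have "\<dots> = (\<Sum>a\<in>I. \<Sum>c\<in>I. \<Sum>d\<in>I. of_real (G a c * G a d) * E2 x c d)"
        unfolding E2_def
        by (simp only: Bochner_Integration.integral_sum Bochner_Integration.integrable_sum integrable_mult_right ie Y_mult_integrable integral_mult_right_zero cong: sum.cong)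
      finally show ?thesis .
    qed
    have S2: "S2 = (\<Sum>a\<in>I. \<Sum>c\<in>I. \<Sum>d\<in>I. of_real (G a c * G a d) * E1 x c)"
    proof -
      have "S2 = (\<integral>\<omega>. (\<Sum>a\<in>I. \<Sum>c\<in>I. \<Sum>d\<in>I. of_real (G a c * G a d) * (of_real (Y c \<omega>) * e x \<omega>)) \<partial>M)"
        unfolding S2_def V_def g_def sum_product of_real_sum sum_distrib_right by (simp add: sum_distrib_left mult_ac)
      also have "\<dots> = (\<Sum>a\<in>I. \<Sum>c\<in>I. \<Sum>d\<in>I. of_real (G a c * G a d) * E1 x c)"
        unfolding E1_def
        by (simp only: Bochner_Integration.integral_sum Bochner_Integration.integrable_sum integrable_mult_right ie Y_integrable integral_mult_right_zero cong: sum.cong)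
      finally show ?thesis .
    qed
    have S1: "S1 = (\<Sum>a\<in>I. \<Sum>c\<in>I. of_real (G a c) * E1 x a)"
    proof -
      have "S1 = (\<integral>\<omega>. (\<Sum>a\<in>I. \<Sum>c\<in>I. of_real (G a c) * (of_real (Y a \<omega>) * e x \<omega>)) \<partial>M)"
        unfolding S1_def g_def of_real_sum sum_distrib_right by (simp add: sum_distrib_right mult_ac)
      also have "\<dots> = (\<Sum>a\<in>I. \<Sum>c\<in>I. of_real (G a c) * E1 x a)"
        unfolding E1_def
        by (simp only: Bochner_Integration.integral_sum Bochner_Integration.integrable_sum integrable_mult_right ie Y_integrable integral_mult_right_zero cong: sum.cong)
      finally show ?thesis .
    qed
    have EQ: "(\<integral>\<omega>. of_real (Q \<omega>) * e x \<omega> \<partial>M) = q * (\<Sum>a\<in>I. E2 x a a - of_real (G a a) * \<phi> x)"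
    proof -
      have "(\<integral>\<omega>. of_real (Q \<omega>) * e x \<omega> \<partial>M) = (\<integral>\<omega>. q * (\<Sum>a\<in>I. of_real (Y a \<omega> * Y a \<omega>) * e x \<omega> - of_real (G a a) * (of_real 1 * e x \<omega>)) \<partial>M)"
        unfolding Q_def by (simp add: algebra_simps sum_distrib_left sum_distrib_right power2_eq_square sum_subtractf)
      also have "\<dots> = q * (\<Sum>a\<in>I. E2 x a a - of_real (G a a) * (\<integral>\<omega>. of_real 1 * e x \<omega> \<partial>M))"
        unfolding E2_def
        by (simp only: Bochner_Integration.integral_sum Bochner_Integration.integral_diff Bochner_Integration.integrable_diff Bochner_Integration.integrable_sum integrable_mult_right ie Y_mult_integrable integrable_const integral_mult_right_zero cong: sum.cong)
      finally show ?thesis by (simp add: \<phi>_def)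
    qed
    have "E2 x a a - of_real (G a a) * \<phi> x = 2 * \<i> * (x * q) * (\<Sum>c\<in>I. of_real ((G a c)\<^sup>2)) * \<phi> x
       + (2 * \<i> * (x * q))\<^sup>2 * (\<Sum>c\<in>I. \<Sum>d\<in>I. of_real (G a c * G a d) * E2 x c d)
       + (2 * \<i> * (x * q)) * (\<i> * u) * (\<Sum>c\<in>I. \<Sum>d\<in>I. of_real (G a c * G a d) * E1 x c)
       + \<i> * u * (\<Sum>c\<in>I. of_real (G a c) * E1 x a)" if a: "a \<in> I" for a
    proof -
      have "E2 x a a - of_real (G a a) * \<phi> x = (\<Sum>c\<in>I. of_real (G a c) * (2 * \<i> * (x * q) * E2 x a c + \<i> * u * E1 x a))"
        using parts[OF a a, of x] by simp
      \<comment> \<open>The second integration by parts acts on the mixed moments left by the first.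
        Only its covariance term contributes to the main part; there it meets the factor
        \<open>G a c\<close> again and produces the squared entries summed in
        \<open>T\<close>.\<close>
      also have "\<dots> = (\<Sum>c\<in>I. of_real (G a c) * (2 * \<i> * (x * q) * (of_real (G a c) * \<phi> x + (\<Sum>d\<in>I. of_real (G a d) * (2 * \<i> * (x * q) * E2 x c d + \<i> * u * E1 x c))) + \<i> * u * E1 x a))"
        using parts[OF a, of _ x] by simp
      finally show ?thesis
        by (simp add: sum_distrib_left sum_distrib_right sum.distrib power2_eq_square algebra_simps)
    qed
    then have "(\<integral>\<omega>. of_real (Q \<omega>) * e x \<omega> \<partial>M) = q * (2 * \<i> * (x * q) * of_real T * \<phi> x
       + (2 * \<i> * (x * q))\<^sup>2 * S3 + (2 * \<i> * (x * q)) * (\<i> * u) * S2 + \<i> * u * S1)"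
      unfolding EQ S1 S2 S3 T_def by (simp add: sum.distrib sum_distrib_left sum_distrib_right)
    then have eq: "(\<integral>\<omega>. \<i> * Q \<omega> * e x \<omega> \<partial>M) + 2 * x * (q\<^sup>2 * T) * \<phi> x = 
       \<i> * (q * ((2 * \<i> * (x * q))\<^sup>2 * S3 + (2 * \<i> * (x * q)) * (\<i> * u) * S2 + \<i> * u * S1))"
      by (simp add: mult.assoc) (simp add: algebra_simps power2_eq_square)
    have "cmod (\<i> * (q * ((2 * \<i> * (x * q))\<^sup>2 * S3 + (2 * \<i> * (x * q)) * (\<i> * u) * S2 + \<i> * u * S1))) \<le> q * (4 * x\<^sup>2 * q\<^sup>2 * cmod S3 + 2 * \<bar>x\<bar> * q * \<bar>u\<bar> * cmod S2 + \<bar>u\<bar> * cmod S1)"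
    proof -
      have "cmod ((2 * \<i> * (x * q))\<^sup>2 * S3 + (2 * \<i> * (x * q)) * (\<i> * u) * S2 + \<i> * u * S1) \<le> 4 * x\<^sup>2 * q\<^sup>2 * cmod S3 + 2 * \<bar>x\<bar> * q * \<bar>u\<bar> * cmod S2 + \<bar>u\<bar> * cmod S1"
        using q by (intro order_trans[OF norm_triangle_ineq] add_mono) (auto simp: norm_mult norm_power power_mult_distrib abs_mult)
      then show ?thesis using q by (simp add: norm_mult mult_left_mono)
    qed
    also have "\<dots> \<le> q * (4 * s\<^sup>2 * q\<^sup>2 * (\<rho> * T) + 2 * \<bar>s\<bar> * q * \<bar>u\<bar> * (\<rho> * (sqrt \<rho> * (T + N) / 2)) + \<bar>u\<bar> * sqrt (N * \<rho> ^ 3))"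
    proof -
      have EV: "(\<Sum>a\<in>I. (\<integral>\<omega>. (V a \<omega>)\<^sup>2 \<partial>M)) \<le> \<rho> * T"
        unfolding V_def combination_square T_def using quad_form_cubic_bound[OF rho] by simp
      have normE: "cmod (\<integral>\<omega>. of_real (f \<omega>) * e x \<omega> \<partial>M) \<le> (\<integral>\<omega>. \<bar>f \<omega>\<bar> \<partial>M)" for f
        by (rule order_trans[OF integral_norm_bound]) (simp add: norm_mult)
      have b3: "cmod S3 \<le> \<rho> * T"
      proof -
        have "cmod S3 \<le> (\<integral>\<omega>. (\<Sum>a\<in>I. (V a \<omega>)\<^sup>2) \<partial>M)"
          unfolding S3_def by (rule order_trans[OF normE]) (simp add: sum_nonneg)
        also have "\<dots> = (\<Sum>a\<in>I. (\<integral>\<omega>. (V a \<omega>)\<^sup>2 \<partial>M))" using V2 by simp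
        finally show ?thesis using EV by simp
      qed
      have b2: "cmod S2 \<le> \<rho> * (sqrt \<rho> * (T + N) / 2)"
      proof -
        have "cmod S2 \<le> (\<integral>\<omega>. \<bar>\<Sum>a\<in>I. V a \<omega> * g a\<bar> \<partial>M)" unfolding S2_def by (rule normE)
        also have "\<dots> \<le> (\<integral>\<omega>. (\<Sum>a\<in>I. \<rho> * \<bar>V a \<omega>\<bar>) \<partial>M)"
          using V1 g by (intro integral_mono order_trans[OF sum_abs sum_mono]) (auto simp: abs_mult mult.commute intro!: mult_right_mono)
        also have "\<dots> = \<rho> * (\<Sum>a\<in>I. (\<integral>\<omega>. \<bar>V a \<omega>\<bar> \<partial>M))" using V1 by (simp add: sum_distrib_left)
        \<comment> \<open>The weight \<open>sqrt \<rho>\<close> in the arithmetic-geometric mean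
          balances the two parts: the second moments sum to at most \<rho> T, so both parts acquire
          the common factor \<open>sqrt \<rho>\<close>.\<close>
        also have "(\<Sum>a\<in>I. (\<integral>\<omega>. \<bar>V a \<omega>\<bar> \<partial>M)) \<le> (\<Sum>a\<in>I. ((\<integral>\<omega>. (V a \<omega>)\<^sup>2 \<partial>M) / sqrt \<rho> + sqrt \<rho>) / 2)"
        proof (rule sum_mono)
          fix a
          have "(\<integral>\<omega>. \<bar>V a \<omega>\<bar> \<partial>M) \<le> sqrt (\<integral>\<omega>. (V a \<omega>)\<^sup>2 \<partial>M)" by (rule expectation_abs_le_sqrt[OF _ V2]) simp
          also have "\<dots> = sqrt ((\<integral>\<omega>. (V a \<omega>)\<^sup>2 \<partial>M) / sqrt \<rho> * sqrt \<rho>)" using rho0 by simp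
          also have "\<dots> \<le> ((\<integral>\<omega>. (V a \<omega>)\<^sup>2 \<partial>M) / sqrt \<rho> + sqrt \<rho>) / 2"
            using rho0 by (intro arith_geo_mean_sqrt divide_nonneg_nonneg Bochner_Integration.integral_nonneg) auto
          finally show "(\<integral>\<omega>. \<bar>V a \<omega>\<bar> \<partial>M) \<le> ((\<integral>\<omega>. (V a \<omega>)\<^sup>2 \<partial>M) / sqrt \<rho> + sqrt \<rho>) / 2" .
        qed
        also have "\<dots> = ((\<Sum>a\<in>I. (\<integral>\<omega>. (V a \<omega>)\<^sup>2 \<partial>M)) / sqrt \<rho> + N * sqrt \<rho>) / 2"
          by (simp add: sum.distrib sum_divide_distrib[symmetric] N_def)
        also have "\<dots> \<le> (\<rho> * T / sqrt \<rho> + N * sqrt \<rho>) / 2"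
          using EV rho0 by (intro divide_right_mono add_mono) auto
        also have "\<rho> * T / sqrt \<rho> = sqrt \<rho> * T" 
          using real_sqrt_mult_self[of \<rho>] rho0 by (simp add: field_simps)
        finally show ?thesis using rho0 by (simp add: algebra_simps mult_left_mono)
      qed
      have b1: "cmod S1 \<le> sqrt (N * \<rho> ^ 3)"
      proof -
        have "cmod S1 \<le> (\<integral>\<omega>. \<bar>\<Sum>a\<in>I. g a * Y a \<omega>\<bar> \<partial>M)" unfolding S1_def by (rule normE)
        also have "\<dots> \<le> sqrt (\<Sum>i\<in>I. \<Sum>j\<in>I. g i * g j * G i j)" by (rule linear_abs_bound)
        also have "(\<Sum>i\<in>I. \<Sum>j\<in>I. g i * g j * G i j) \<le> (\<Sum>i\<in>I. \<Sum>j\<in>I. \<rho> * \<rho> * \<bar>G i j\<bar>)"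
        proof (intro sum_mono)
          fix i j assume "i \<in> I" "j \<in> I"
          have "g i * g j * G i j \<le> \<bar>g i\<bar> * \<bar>g j\<bar> * \<bar>G i j\<bar>" by (simp add: abs_mult[symmetric])
          also have "\<dots> \<le> \<rho> * \<rho> * \<bar>G i j\<bar>" using g \<open>i \<in> I\<close> \<open>j \<in> I\<close> rho0 by (intro mult_right_mono mult_mono) auto
          finally show "g i * g j * G i j \<le> \<rho> * \<rho> * \<bar>G i j\<bar>" .
        qed
        also have "\<dots> = (\<Sum>i\<in>I. \<rho> * \<rho> * (\<Sum>j\<in>I. \<bar>G i j\<bar>))" by (simp add: sum_distrib_left)
        also have "\<dots> \<le> (\<Sum>i\<in>I. \<rho> * \<rho> * \<rho>)" using rho rho0 by (intro sum_mono mult_left_mono) auto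
        also have "\<dots> = N * \<rho> ^ 3" by (simp add: N_def power3_eq_cube)
        finally show ?thesis by simp
      qed
      have "x\<^sup>2 \<le> s\<^sup>2" using x by (simp add: abs_le_square_iff)
      then show ?thesis
        using q x b1 b2 b3 norm_ge_zero[of S1] norm_ge_zero[of S2] norm_ge_zero[of S3]
        by (intro mult_left_mono[OF _ q] add_mono mult_mono) (auto intro!: mult_nonneg_nonneg)
    qed
    finally show ?thesis unfolding eq by (simp add: algebra_simps add_divide_distrib)
  qed
  define Bd where "Bd = q * (4 * s\<^sup>2 * q\<^sup>2 * \<rho> * T + \<bar>s\<bar> * q * \<bar>u\<bar> * \<rho> * sqrt \<rho> * (T + N) + \<bar>u\<bar> * sqrt (N * \<rho> ^ 3))"
  define w where "w = q\<^sup>2 * T"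
  have w0: "w \<ge> 0" unfolding w_def T_def by (intro mult_nonneg_nonneg sum_nonneg) auto
  have d\<phi>: "(\<phi> has_vector_derivative (\<integral>\<omega>. \<i> * Q \<omega> * e x \<omega> \<partial>M)) (at x)" for x
    unfolding \<phi>_def e_def by (rule has_vector_derivative_char[OF _ _ Q2 Q1]) auto
  define \<psi> where "\<psi> x = exp (x\<^sup>2 * w) *\<^sub>R \<phi> x" for x
  define \<psi>' where "\<psi>' x = exp (x\<^sup>2 * w) *\<^sub>R ((\<integral>\<omega>. \<i> * Q \<omega> * e x \<omega> \<partial>M) + 2 * x * (q\<^sup>2 * T) * \<phi> x)" for x
  have d\<psi>: "(\<psi> has_vector_derivative \<psi>' x) (at x)" for x
    unfolding \<psi>_def
    by (rule has_vector_derivative_eq_rhs, rule has_vector_derivative_scaleR[OF _ d\<phi>])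
       (auto intro!: derivative_eq_intros simp: \<psi>'_def w_def scaleR_conv_of_real algebra_simps)
  have b\<psi>: "norm (\<psi>' x) \<le> exp (s\<^sup>2 * w) * Bd" if x: "\<bar>x\<bar> \<le> \<bar>s\<bar>" for x
  proof -
    have "x\<^sup>2 \<le> s\<^sup>2" using x by (simp add: abs_le_square_iff)
    then have "exp (x\<^sup>2 * w) \<le> exp (s\<^sup>2 * w)" using w0 by (simp add: mult_right_mono)
    then show ?thesis unfolding \<psi>'_def norm_scaleR Bd_def using bound[OF x]
      by (intro mult_mono) auto
  qed
  \<comment> \<open>The interval is symmetric about 0 so that positive and negative s are handled
    together.\<close>
  have "norm (\<psi> s - \<psi> 0) \<le> exp (s\<^sup>2 * w) * Bd * norm (s - 0)"
  proof (rule differentiable_bound[where S = "{-\<bar>s\<bar>..\<bar>s\<bar>}"])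
    show "(\<psi> has_derivative (\<lambda>h. h *\<^sub>R \<psi>' x)) (at x within {-\<bar>s\<bar>..\<bar>s\<bar>})" for x
      using d\<psi>[of x] unfolding has_vector_derivative_def by (rule has_derivative_at_withinI)
    show "onorm (\<lambda>h. h *\<^sub>R \<psi>' x) \<le> exp (s\<^sup>2 * w) * Bd" if "x \<in> {-\<bar>s\<bar>..\<bar>s\<bar>}" for x
    proof (rule onorm_le)
      fix h :: real
      show "norm (h *\<^sub>R \<psi>' x) \<le> exp (s\<^sup>2 * w) * Bd * norm h"
        using mult_right_mono[OF b\<psi>[of x], of "\<bar>h\<bar>"] that by (auto simp: mult.commute)
    qed
  qed auto
  \<comment> \<open>On the interval the integrating factor is largest at s, so multiplying back by
    its inverse at s removes the exponential from the bound entirely.\<close>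
  then have "exp (- s\<^sup>2 * w) * norm (\<psi> s - \<psi> 0) \<le> exp (- s\<^sup>2 * w) * (exp (s\<^sup>2 * w) * Bd * \<bar>s\<bar>)"
    by (intro mult_left_mono) auto
  also have "\<dots> = (exp (- s\<^sup>2 * w) * exp (s\<^sup>2 * w)) * (\<bar>s\<bar> * Bd)" by (simp only: ac_simps)
  also have "exp (- s\<^sup>2 * w) * exp (s\<^sup>2 * w) = 1" by (simp flip: exp_add)
  also have "exp (- s\<^sup>2 * w) * norm (\<psi> s - \<psi> 0) = norm (exp (- s\<^sup>2 * w) *\<^sub>R (\<psi> s - \<psi> 0))" by simp
  also have "exp (- s\<^sup>2 * w) *\<^sub>R (\<psi> s - \<psi> 0) = \<phi> s - exp (- s\<^sup>2 * w) *\<^sub>R \<phi> 0"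
    by (simp add: \<psi>_def scaleR_right_diff_distrib flip: exp_add)
  \<comment> \<open>At 0 the quadratic form has disappeared. The initial value is the exact
    characteristic function of a normal variable and supplies the factor depending on
    \<open>u\<close>.\<close>
  also have "\<phi> 0 = exp (- (u\<^sup>2 * (\<Sum>a\<in>I. \<Sum>c\<in>I. G a c)) / 2)"
    using char_combination[of "\<lambda>_. u"] unfolding \<phi>_def e_def L_def
    by (simp add: sum_distrib_left power2_eq_square mult_ac)
  finally have fin: "norm (\<phi> s - exp (- s\<^sup>2 * w) *\<^sub>R complex_of_real (exp (- (u\<^sup>2 * (\<Sum>a\<in>I. \<Sum>c\<in>I. G a c)) / 2))) \<le> 1 * (\<bar>s\<bar> * Bd)" .
  have E: "exp (- s\<^sup>2 * w) *\<^sub>R complex_of_real (exp (- (u\<^sup>2 * S) / 2)) = complex_of_real (exp (- (s\<^sup>2 * (q\<^sup>2 * T)) - u\<^sup>2 * S / 2))" for S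
    unfolding scaleR_conv_of_real of_real_mult[symmetric] exp_add[symmetric] w_def by simp
  show ?thesis
    using fin unfolding E unfolding \<phi>_def e_def Q_def L_def Bd_def mult_1 .
qed

end

section \<open>Joint convergence in law\<close>

text \<open>Levy's continuity theorem for the laws of \<open>Z n\<close> tilted by
  \<open>W n\<close>. The hypothesis at frequency 0 gives convergence of the normalizing masses to
  \<open>w\<close>, which is positive; multiplying by the masses then undoes the
  normalization.\<close>

lemma (in prob_space) tilted_continuity:
  fixes W Z :: "nat \<Rightarrow> 'a \<Rightarrow> real"
  assumes W [measurable]: "\<And>n. W n \<in> borel_measurable M" and Z [measurable]: "\<And>n. Z n \<in> borel_measurable M"
    and W0: "\<And>n \<omega>. 0 \<le> W n \<omega>" and WB: "\<And>n \<omega>. W n \<omega> \<le> B"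
    and \<mu>: "real_distribution \<mu>" and w: "0 < w"
    and lim: "\<And>s. (\<lambda>n. \<integral>\<omega>. W n \<omega> * iexp (s * Z n \<omega>) \<partial>M) \<longlonglongrightarrow> w * char \<mu> s"
    and k: "\<And>x. isCont k x" "\<And>x. \<bar>k x\<bar> \<le> K"
  shows "(\<lambda>n. \<integral>\<omega>. W n \<omega> * k (Z n \<omega>) \<partial>M) \<longlonglongrightarrow> w * (\<integral>x. k x \<partial>\<mu>)"
proof -
  interpret \<mu>: real_distribution \<mu> by fact
  have [measurable]: "k \<in> borel_measurable borel"
    using k(1) by (intro borel_measurable_continuous_onI) (auto simp: continuous_on_eq_continuous_at)
  have iW: "integrable M (W n)" for n by (rule integrable_bounded[where B = B]) (use W0 WB in auto)
  define m where "m n = (\<integral>\<omega>. W n \<omega> \<partial>M)" for n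
  have "(\<lambda>n. complex_of_real (m n)) \<longlonglongrightarrow> complex_of_real w"
    using lim[of 0] \<mu>.char_zero by (simp add: m_def)
  then have m: "m \<longlonglongrightarrow> w" by (subst (asm) tendsto_of_real_iff)
  with w have m0: "\<forall>\<^sub>F n in sequentially. m n > 0" by (simp add: order_tendstoD)
  \<comment> \<open>The mass may vanish for finitely many n; there the limit law itself serves as a
    placeholder, so that every member of the sequence is a distribution.\<close>
  define \<nu> where "\<nu> n = (if m n > 0 then distr (density M (\<lambda>\<omega>. ennreal (W n \<omega> / m n))) borel (Z n) else \<mu>)" for n
  have \<nu>: "real_distribution (\<nu> n)" for n
    unfolding \<nu>_def m_def using real_distribution_tilted[OF W Z W0 iW] \<mu> by auto
  have int\<nu>: "(\<integral>x. h x \<partial>\<nu> n) = (\<integral>\<omega>. W n \<omega> *\<^sub>R h (Z n \<omega>) \<partial>M) /\<^sub>R m n" if "m n > 0" "h \<in> borel_measurable borel"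
    for h :: "real \<Rightarrow> 'c::{banach, second_countable_topology}" and n
    using integral_tilted[OF W Z W0 iW, of n h] that unfolding \<nu>_def m_def by simp
  have "weak_conv_m \<nu> \<mu>"
  proof (rule levy_continuity[OF \<nu> \<mu>])
    fix t
    have "(\<lambda>n. (\<integral>\<omega>. W n \<omega> * iexp (t * Z n \<omega>) \<partial>M) / m n) \<longlonglongrightarrow> w * char \<mu> t / w"
      using w by (intro tendsto_intros lim m) auto
    also have "w * char \<mu> t / w = char \<mu> t" using w by simp
    finally show "(\<lambda>n. char (\<nu> n) t) \<longlonglongrightarrow> char \<mu> t"
    proof (rule Lim_transform_eventually)
      show "\<forall>\<^sub>F n in sequentially. (\<integral>\<omega>. W n \<omega> * iexp (t * Z n \<omega>) \<partial>M) / m n = char (\<nu> n) t"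
        using m0 by eventually_elim (simp add: char_def int\<nu> scaleR_conv_of_real divide_inverse mult.commute)
    qed
  qed
  from weak_conv_imp_integral_bdd_continuous_conv[OF \<nu> \<mu> this, of k K] k
  have "(\<lambda>n. m n * (\<integral>x. k x \<partial>\<nu> n)) \<longlonglongrightarrow> w * (\<integral>x. k x \<partial>\<mu>)" by (intro tendsto_intros m) auto
  then show ?thesis
  proof (rule Lim_transform_eventually)
    show "\<forall>\<^sub>F n in sequentially. m n * (\<integral>x. k x \<partial>\<nu> n) = (\<integral>\<omega>. W n \<omega> * k (Z n \<omega>) \<partial>M)"
      using m0 by eventually_elim (simp add: int\<nu>)
  qed
qed

text \<open>Two tiltings exchange exponentials for test functions one coordinate at a time. The
  exponential in \<open>A\<close> is replaced by \<open>h\<close> under a trigonometric weight in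
  \<open>B\<close>, and the exponential in \<open>B\<close> is replaced by \<open>k\<close> under a
  weight built from \<open>h (A n)\<close>. Constants keep the weights positive and are subtracted
  afterwards.\<close>

lemma (in prob_space) joint_char_imp_product_conv:
  fixes A B :: "nat \<Rightarrow> 'a \<Rightarrow> real" and h k :: "real \<Rightarrow> real"
  assumes A [measurable]: "\<And>n. A n \<in> borel_measurable M" and B [measurable]: "\<And>n. B n \<in> borel_measurable M"
    and \<mu>: "real_distribution \<mu>" and \<nu>: "real_distribution \<nu>"
    and lim: "\<And>s t. (\<lambda>n. \<integral>\<omega>. iexp (s * A n \<omega> + t * B n \<omega>) \<partial>M) \<longlonglongrightarrow> char \<mu> s * char \<nu> t"
    and h: "\<And>x. isCont h x" "\<And>x. \<bar>h x\<bar> \<le> K" and k: "\<And>x. isCont k x" "\<And>x. \<bar>k x\<bar> \<le> K'"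
  shows "(\<lambda>n. \<integral>\<omega>. h (A n \<omega>) * k (B n \<omega>) \<partial>M) \<longlonglongrightarrow> (\<integral>x. h x \<partial>\<mu>) * (\<integral>x. k x \<partial>\<nu>)"
proof -
  interpret \<mu>: real_distribution \<mu> by fact
  interpret \<nu>: real_distribution \<nu> by fact
  have bm: "h \<in> borel_measurable borel" if "\<And>x. isCont h x" for h :: "real \<Rightarrow> real"
    using that by (intro borel_measurable_continuous_onI) (auto simp: continuous_on_eq_continuous_at)
  have step1: "(\<lambda>n. \<integral>\<omega>. of_real (h (A n \<omega>)) * iexp (t * B n \<omega>) \<partial>M) \<longlonglongrightarrow> of_real (\<integral>x. h x \<partial>\<mu>) * char \<nu> t"
    if h: "\<And>x. isCont h x" "\<And>x. \<bar>h x\<bar> \<le> K" for h K t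
  proof -
    note [measurable] = bm[OF h(1)]
    have ih: "integrable M (\<lambda>\<omega>. h (A n \<omega>))" for n
      by (rule integrable_bounded[where B=K]) (use h in auto)
    \<comment> \<open>The weight lies between 1 and 3. The choices c = 1 and c = -i extract the real
      and the imaginary part of the exponential in \<open>B\<close>.\<close>
    have trig: "(\<lambda>n. \<integral>\<omega>. (2 + Re (c * iexp (t * B n \<omega>))) * h (A n \<omega>) \<partial>M) \<longlonglongrightarrow> (2 + Re (c * char \<nu> t)) * (\<integral>x. h x \<partial>\<mu>)"
      if c: "cmod c = 1" for c
    proof (rule tilted_continuity[where B = 3 and K = K])
      have le: "\<bar>Re (c * z)\<bar> \<le> 1" if "cmod z \<le> 1" for z
        using abs_Re_le_cmod[of "c * z"] c that by (simp add: norm_mult)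
      show "0 \<le> 2 + Re (c * iexp (t * B n \<omega>))" "2 + Re (c * iexp (t * B n \<omega>)) \<le> 3" for n \<omega>
        using le[of "iexp (t * B n \<omega>)"] by auto
      show "0 < 2 + Re (c * char \<nu> t)" using le[OF \<nu>.cmod_char_le_1, of t] by auto
      fix s
      have Re2: "of_real (2 + Re (c * iexp b)) * iexp a = 2 * iexp a + (c / 2) * iexp (a + b) + (cnj c / 2) * iexp (a - b)" for a b
      proof -
        have re: "of_real (Re z) = (z + cnj z) / 2" for z by (simp add: complex_eq_iff)
        have R: "of_real (2 + Re (c * iexp b)) = 2 + (c * iexp b + cnj c * iexp (- b)) / 2"
          unfolding of_real_add re complex_cnj_mult exp_cnj by simp
        show ?thesis unfolding R by (simp add: distrib_left distrib_right right_diff_distrib exp_add exp_diff exp_minus field_simps)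
      qed
      have i: "integrable M (\<lambda>\<omega>. iexp (a * A n \<omega> + b * B n \<omega>))" for a b n
        by (rule integrable_bounded[where B=1]) auto
      have "(\<lambda>n. 2 * (\<integral>\<omega>. iexp (s * A n \<omega> + 0 * B n \<omega>) \<partial>M) + (c / 2) * (\<integral>\<omega>. iexp (s * A n \<omega> + t * B n \<omega>) \<partial>M) 
          + (cnj c / 2) * (\<integral>\<omega>. iexp (s * A n \<omega> + (- t) * B n \<omega>) \<partial>M))
        \<longlonglongrightarrow> 2 * (char \<mu> s * char \<nu> 0) + (c / 2) * (char \<mu> s * char \<nu> t) + (cnj c / 2) * (char \<mu> s * char \<nu> (- t))"
        by (intro tendsto_intros lim)
      also have "(\<lambda>n. 2 * (\<integral>\<omega>. iexp (s * A n \<omega> + 0 * B n \<omega>) \<partial>M) + (c / 2) * (\<integral>\<omega>. iexp (s * A n \<omega> + t * B n \<omega>) \<partial>M) 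
          + (cnj c / 2) * (\<integral>\<omega>. iexp (s * A n \<omega> + (- t) * B n \<omega>) \<partial>M))
        = (\<lambda>n. \<integral>\<omega>. of_real (2 + Re (c * iexp (t * B n \<omega>))) * iexp (s * A n \<omega>) \<partial>M)"
      proof
        fix n
        show "2 * (\<integral>\<omega>. iexp (s * A n \<omega> + 0 * B n \<omega>) \<partial>M) + (c / 2) * (\<integral>\<omega>. iexp (s * A n \<omega> + t * B n \<omega>) \<partial>M) 
          + (cnj c / 2) * (\<integral>\<omega>. iexp (s * A n \<omega> + (- t) * B n \<omega>) \<partial>M) =
          (\<integral>\<omega>. of_real (2 + Re (c * iexp (t * B n \<omega>))) * iexp (s * A n \<omega>) \<partial>M)"
          unfolding Re2 using i[of s n 0] i[of s n t] i[of s n "-t"]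
          by (simp del: of_real_add of_real_mult of_real_diff of_real_minus)
      qed
      also have "char \<nu> (- t) = cnj (char \<nu> t)"
        unfolding char_def Bochner_Integration.integral_cnj[symmetric] by (simp add: exp_cnj)
      also have "2 * (char \<mu> s * char \<nu> 0) + (c / 2) * (char \<mu> s * char \<nu> t) + (cnj c / 2) * (char \<mu> s * cnj (char \<nu> t))
        = (2 + (c * char \<nu> t + cnj (c * char \<nu> t)) / 2) * char \<mu> s"
        by (simp add: \<nu>.char_zero field_simps)
      also have "\<dots> = of_real (2 + Re (c * char \<nu> t)) * char \<mu> s"
        unfolding complex_add_cnj by simp
      finally show "(\<lambda>n. \<integral>\<omega>. of_real (2 + Re (c * iexp (t * B n \<omega>))) * iexp (s * A n \<omega>) \<partial>M) \<longlonglongrightarrow> of_real (2 + Re (c * char \<nu> t)) * char \<mu> s" .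
    qed (use h \<mu> in auto)
    have one: "(\<lambda>n. \<integral>\<omega>. 1 * h (A n \<omega>) \<partial>M) \<longlonglongrightarrow> 1 * (\<integral>x. h x \<partial>\<mu>)"
    proof (rule tilted_continuity[where B = 1 and K = K])
      show "(\<lambda>n. \<integral>\<omega>. of_real 1 * iexp (s * A n \<omega>) \<partial>M) \<longlonglongrightarrow> of_real 1 * char \<mu> s" for s
        using lim[of s 0] by (simp add: \<nu>.char_zero)
    qed (use h \<mu> in auto)
    have trig': "(\<lambda>n. \<integral>\<omega>. Re (c * iexp (t * B n \<omega>)) * h (A n \<omega>) \<partial>M) \<longlonglongrightarrow> Re (c * char \<nu> t) * (\<integral>x. h x \<partial>\<mu>)"
      if c: "cmod c = 1" for c
    proof -
      have ic: "integrable M (\<lambda>\<omega>. Re (c * iexp (t * B n \<omega>)) * h (A n \<omega>))" for n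
      proof (rule integrable_bounded[where B=K])
        fix \<omega>
        have "\<bar>Re (c * iexp (t * B n \<omega>))\<bar> * \<bar>h (A n \<omega>)\<bar> \<le> 1 * K"
          using abs_Re_le_cmod[of "c * iexp (t * B n \<omega>)"] c h(2)[of "A n \<omega>"] by (intro mult_mono) (auto simp: norm_mult)
        then show "norm (Re (c * iexp (t * B n \<omega>)) * h (A n \<omega>)) \<le> K" by (simp add: abs_mult)
      qed simp
      have "(\<lambda>n. (\<integral>\<omega>. (2 + Re (c * iexp (t * B n \<omega>))) * h (A n \<omega>) \<partial>M) - 2 * (\<integral>\<omega>. 1 * h (A n \<omega>) \<partial>M)) 
        \<longlonglongrightarrow> (2 + Re (c * char \<nu> t)) * (\<integral>x. h x \<partial>\<mu>) - 2 * (1 * (\<integral>x. h x \<partial>\<mu>))"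
        by (intro tendsto_intros trig[OF c] one)
      moreover have "(\<integral>\<omega>. (2 + Re (c * iexp (t * B n \<omega>))) * h (A n \<omega>) \<partial>M) - 2 * (\<integral>\<omega>. 1 * h (A n \<omega>) \<partial>M) = (\<integral>\<omega>. Re (c * iexp (t * B n \<omega>)) * h (A n \<omega>) \<partial>M)" for n
        unfolding distrib_right using ic ih by simp
      ultimately show ?thesis by (simp add: algebra_simps)
    qed
    have ii: "integrable M (\<lambda>\<omega>. of_real (h (A n \<omega>)) * iexp (t * B n \<omega>))" for n
      by (rule integrable_bounded[where B=K]) (use h in \<open>auto simp: norm_mult\<close>)
    have imI: "Im z = Re (- \<i> * z)" for z by simp
    have Imeq: "Im (\<integral>\<omega>. of_real (h (A n \<omega>)) * iexp (t * B n \<omega>) \<partial>M) = (\<integral>\<omega>. Re (- \<i> * iexp (t * B n \<omega>)) * h (A n \<omega>) \<partial>M)" for n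
      by (subst integral_Im[OF ii, symmetric]) (simp add: mult.commute)
    have Reeq: "Re (\<integral>\<omega>. of_real (h (A n \<omega>)) * iexp (t * B n \<omega>) \<partial>M) = (\<integral>\<omega>. Re (1 * iexp (t * B n \<omega>)) * h (A n \<omega>) \<partial>M)" for n
      by (subst integral_Re[OF ii, symmetric]) (simp add: mult.commute)
    show ?thesis
      unfolding tendsto_complex_iff Imeq Reeq
      using trig'[of 1] trig'[of "- \<i>"] by (simp add: mult.commute)
  qed
  \<comment> \<open>Adding K + 1 makes the weight at least 1, hence also its limiting mass.\<close>
  have step2: "(\<lambda>n. \<integral>\<omega>. (h (A n \<omega>) + (K + 1)) * k (B n \<omega>) \<partial>M) \<longlonglongrightarrow> ((\<integral>x. h x \<partial>\<mu>) + (K + 1)) * (\<integral>x. k x \<partial>\<nu>)"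
    if h: "\<And>x. isCont h x" "\<And>x. \<bar>h x\<bar> \<le> K" for h K
  proof (rule tilted_continuity[where B = "2 * K + 1" and K = K'])
    note [measurable] = bm[OF h(1)]
    show "(\<lambda>\<omega>. h (A n \<omega>) + (K + 1)) \<in> borel_measurable M" for n by measurable
    show "0 \<le> h (A n \<omega>) + (K + 1)" "h (A n \<omega>) + (K + 1) \<le> 2 * K + 1" for n \<omega>
      using h(2)[of "A n \<omega>"] by auto
    have ih: "integrable \<mu> h" by (rule \<mu>.integrable_bounded[where B=K]) (use h in auto)
    have "\<bar>\<integral>x. h x \<partial>\<mu>\<bar> \<le> K" 
      by (rule order_trans[OF integral_abs_bound \<mu>.integral_le_const]) (use h ih in auto)
    then show "0 < (\<integral>x. h x \<partial>\<mu>) + (K + 1)" by auto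
    have "(\<integral>x. h x + (K + 1) \<partial>\<mu>) = (\<integral>x. h x \<partial>\<mu>) + (K + 1)" using ih \<mu>.prob_space by simp
    moreover have "\<bar>h x + (K + 1)\<bar> \<le> 2 * K + 1" for x using h(2)[of x] by auto
    ultimately show "(\<lambda>n. \<integral>\<omega>. of_real (h (A n \<omega>) + (K + 1)) * iexp (s * B n \<omega>) \<partial>M) \<longlonglongrightarrow> of_real ((\<integral>x. h x \<partial>\<mu>) + (K + 1)) * char \<nu> s" for s
      using step1[of "\<lambda>x. h x + (K + 1)" "2 * K + 1" s] h(1) by simp
  qed (use k \<nu> in auto)
  note [measurable] = bm[OF h(1)] bm[OF k(1)]
  have K: "0 \<le> K" using h(2)[of 0] by auto
  \<comment> \<open>The same limit for the zero function in place of \<open>h\<close> is subtracted,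
    which cancels the shift.\<close>
  have "(\<lambda>n. (\<integral>\<omega>. (h (A n \<omega>) + (K + 1)) * k (B n \<omega>) \<partial>M) - (\<integral>\<omega>. (0 + (K + 1)) * k (B n \<omega>) \<partial>M)) 
    \<longlonglongrightarrow> ((\<integral>x. h x \<partial>\<mu>) + (K + 1)) * (\<integral>x. k x \<partial>\<nu>) - ((\<integral>x. 0 \<partial>\<mu>) + (K + 1)) * (\<integral>x. k x \<partial>\<nu>)"
    using K by (intro tendsto_diff step2 h) auto
  moreover have "(\<integral>\<omega>. (h (A n \<omega>) + (K + 1)) * k (B n \<omega>) \<partial>M) - (\<integral>\<omega>. (0 + (K + 1)) * k (B n \<omega>) \<partial>M) = (\<integral>\<omega>. h (A n \<omega>) * k (B n \<omega>) \<partial>M)" for n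
  proof -
    have "integrable M (\<lambda>\<omega>. h (A n \<omega>) * k (B n \<omega>))"
      by (rule integrable_bounded[where B="K * K'"]) (use h k K in \<open>auto simp: abs_mult intro!: mult_mono\<close>)
    moreover have "integrable M (\<lambda>\<omega>. k (B n \<omega>))"
      by (rule integrable_bounded[where B="K'"]) (use k in auto)
    ultimately show ?thesis unfolding distrib_right by simp
  qed
  ultimately show ?thesis by (simp add: algebra_simps)
qed

text \<open>On a compact square these functions are uniformly dense by Stone--Weierstrass; the cutoffs \<open>tent\<close>
  reduce bounded continuous functions on the plane to this case.\<close>

inductive separated_sum :: "(real^2 \<Rightarrow> real) \<Rightarrow> bool" where
  base: "continuous_on UNIV a \<Longrightarrow> continuous_on UNIV b \<Longrightarrow> separated_sum (\<lambda>x. a (x $ 1) * b (x $ 2))"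
| add: "separated_sum f \<Longrightarrow> separated_sum g \<Longrightarrow> separated_sum (\<lambda>x. f x + g x)"

text \<open>Closure under products makes these functions an algebra, as Stone--Weierstrass
  requires.\<close>

lemma separated_sum_mult:
  assumes "separated_sum f" "separated_sum g" shows "separated_sum (\<lambda>x. f x * g x)"
  using assms(2)
proof induction
  case (base a b)
  from assms(1) show ?case
  proof induction
    case (base c d)
    have "separated_sum (\<lambda>x. (c (x $ 1) * a (x $ 1)) * (d (x $ 2) * b (x $ 2)))"
      using base \<open>continuous_on UNIV a\<close> \<open>continuous_on UNIV b\<close>
      by (intro separated_sum.base[of "\<lambda>y. c y * a y" "\<lambda>y. d y * b y"] continuous_intros)
    then show ?case by (simp add: mult_ac)
  next
    case (add f g)
    then show ?case using separated_sum.add[OF add.IH] by (simp add: distrib_right)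
  qed
next
  case (add g h)
  then show ?case using separated_sum.add[OF add.IH] by (simp add: distrib_left)
qed

lemma separated_sum_continuous: "separated_sum f \<Longrightarrow> continuous_on S f"
proof (induction rule: separated_sum.induct)
  case (base a b)
  then show ?case
    by (intro continuous_intros continuous_on_compose2[OF base(1)] continuous_on_compose2[OF base(2)]) auto
qed (intro continuous_intros)

definition tent :: "real \<Rightarrow> real \<Rightarrow> real" where
  "tent K x = max 0 (min 1 (K + 1 - \<bar>x\<bar>))"

lemma tent_bounds: "0 \<le> tent K x" "tent K x \<le> 1" by (auto simp: tent_def)
lemma tent_eq_0: "\<bar>x\<bar> \<ge> K + 1 \<Longrightarrow> tent K x = 0" by (auto simp: tent_def)
lemma continuous_tent: "continuous_on S (tent K)" unfolding tent_def by (intro continuous_intros)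
lemma tent_lim: "(\<lambda>n. tent (real n) x) \<longlonglongrightarrow> 1"
proof (rule tendsto_eventually)
  show "\<forall>\<^sub>F n in sequentially. tent (real n) x = 1"
    using eventually_ge_at_top[of "nat \<lceil>\<bar>x\<bar>\<rceil>"] by eventually_elim (simp add: tent_def)
qed

lemma (in real_distribution) tent_integral_lim: "(\<lambda>n. \<integral>x. tent (real n) x \<partial>M) \<longlonglongrightarrow> 1"
proof -
  have "(\<lambda>n. \<integral>x. tent (real n) x \<partial>M) \<longlonglongrightarrow> (\<integral>x. 1 \<partial>M)"
  proof (rule integral_dominated_convergence[where w = "\<lambda>_. 1"])
    show "tent (real n) \<in> borel_measurable M" for n
      using borel_measurable_continuous_onI[OF continuous_tent, of "real n"] by simp
  qed (use tent_lim tent_bounds in auto)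
  then show ?thesis using prob_space by simp
qed

text \<open>Product test functions have the right limits. A bounded continuous function is
  approximated by a separated sum on a square, and the cutoff confines the error to the complement
  of a smaller square. The mass there is controlled under \<open>L\<close> by choosing the square,
  and along the sequence by applying the product limit to the cutoff itself, so that tightness needs
  no separate argument.\<close>

lemma weak_conv_vec2:
  fixes A B :: "nat \<Rightarrow> 'a \<Rightarrow> real" and L :: "(real^2) measure"
  assumes M: "prob_space M"
    and A [measurable]: "\<And>n. A n \<in> borel_measurable M" and B [measurable]: "\<And>n. B n \<in> borel_measurable M"
    and \<mu>: "real_distribution \<mu>" and \<nu>: "real_distribution \<nu>" and L: "prob_space L" and sets_L: "sets L = sets borel"
    and L_prod: "\<And>h k :: real \<Rightarrow> real. continuous_on UNIV h \<Longrightarrow> continuous_on UNIV k \<Longrightarrow> bounded (range h) \<Longrightarrow> bounded (range k) \<Longrightarrow>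
       (\<integral>x. h (x $ 1) * k (x $ 2) \<partial>L) = (\<integral>x. h x \<partial>\<mu>) * (\<integral>x. k x \<partial>\<nu>)"
    and lim: "\<And>s t. (\<lambda>n. \<integral>\<omega>. iexp (s * A n \<omega> + t * B n \<omega>) \<partial>M) \<longlonglongrightarrow> char \<mu> s * char \<nu> t"
  shows "converges_in_law M (\<lambda>n \<omega>. vector [A n \<omega>, B n \<omega>] :: real^2) L"
  unfolding converges_in_law_def
proof (intro conjI allI impI)
  interpret M: prob_space M by fact
  interpret L: prob_space L by fact
  interpret \<mu>: real_distribution \<mu> by fact
  interpret \<nu>: real_distribution \<nu> by fact
  define V where "V n \<omega> = (vector [A n \<omega>, B n \<omega>] :: real^2)" for n \<omega>
  have V12 [simp]: "V n \<omega> $ 1 = A n \<omega>" "V n \<omega> $ 2 = B n \<omega>" for n \<omega> by (simp_all add: V_def)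
  show V_meas: "V n \<in> borel_measurable M" for n
    by (rule borel_measurable_euclidean_space[THEN iffD2])
      (auto simp: Basis_vec_def inner_axis exhaust_2 V_def forall_2)
  note [measurable] = V_meas
  fix g :: "real^2 \<Rightarrow> real" assume g: "continuous_on UNIV g" and "bounded (range g)"
  then obtain G where G: "G > 0" "\<And>x. \<bar>g x\<bar> \<le> G" unfolding bounded_pos by auto
  have [measurable]: "g \<in> borel_measurable borel" using g by (rule borel_measurable_continuous_onI)
  define T where "T K x = tent K (x $ 1) * tent K (x $ 2)" for K and x :: "real^2"
  have T: "0 \<le> T K x" "T K x \<le> 1" for K x
    using tent_bounds mult_mono[of "tent K (x $ 1)" 1 "tent K (x $ 2)" 1] by (auto simp: T_def)
  have T_cont: "continuous_on S (T K)" for S K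
    unfolding T_def by (intro continuous_intros continuous_on_compose2[OF continuous_tent]) auto
  have T_meas [measurable]: "T K \<in> borel_measurable borel" for K by (intro borel_measurable_continuous_onI T_cont)
  \<comment> \<open>The factors of a separated sum may be unbounded, such as the coordinate
    functions that separate points; the cutoff makes them admissible test functions.\<close>
  have tent_bd: "bounded (range (\<lambda>x. a x * tent K x))" and tent_cont: "continuous_on UNIV (\<lambda>x. a x * tent K x)"
    if a: "continuous_on UNIV a" for a :: "real \<Rightarrow> real" and K
  proof -
    show "continuous_on UNIV (\<lambda>x. a x * tent K x)" using a by (intro continuous_intros continuous_tent)
    have "compact (a ` {-\<bar>K+1\<bar>..\<bar>K+1\<bar>})"
      by (intro compact_continuous_image continuous_on_subset[OF a]) auto
    then obtain c where c: "\<And>x. x \<in> {-\<bar>K+1\<bar>..\<bar>K+1\<bar>} \<Longrightarrow> \<bar>a x\<bar> \<le> c" and c0: "c > 0"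
      unfolding bounded_pos using compact_imp_bounded[THEN bounded_pos[THEN iffD1]] by (metis imageI real_norm_def)
    have "\<bar>a x * tent K x\<bar> \<le> c" for x
    proof (cases "\<bar>x\<bar> \<ge> K + 1")
      case False
      then have "\<bar>a x\<bar> * \<bar>tent K x\<bar> \<le> c * 1" using tent_bounds[of K x] c0 by (intro mult_mono c) auto
      then show ?thesis by (simp add: abs_mult)
    qed (use c0 tent_eq_0 in auto)
    then show "bounded (range (\<lambda>x. a x * tent K x))" unfolding bounded_iff by auto
  qed
  have sep: "(\<lambda>n. \<integral>\<omega>. p (V n \<omega>) * T K (V n \<omega>) \<partial>M) \<longlonglongrightarrow> (\<integral>x. p x * T K x \<partial>L) \<and> 
      (\<exists>c. \<forall>x. \<bar>p x * T K x\<bar> \<le> c)"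
    if "separated_sum p" for p K
    using that
  proof induction
    case (base a b)
    obtain c d where c: "\<bar>a x * tent K x\<bar> \<le> c" and d: "\<bar>b x * tent K x\<bar> \<le> d" for x
      using tent_bd[OF base(1), of K] tent_bd[OF base(2), of K] unfolding bounded_iff by auto
    have "isCont (\<lambda>x. a x * tent K x) x" "isCont (\<lambda>x. b x * tent K x) x" for x
      using tent_cont[OF base(1), of K] tent_cont[OF base(2), of K] by (auto simp: continuous_on_eq_continuous_at)
    from M.joint_char_imp_product_conv[OF A B \<mu> \<nu> lim this(1) c this(2) d]
    have "(\<lambda>n. \<integral>\<omega>. (a (V n \<omega> $ 1) * b (V n \<omega> $ 2)) * T K (V n \<omega>) \<partial>M) \<longlonglongrightarrow> (\<integral>x. a x * tent K x \<partial>\<mu>) * (\<integral>x. b x * tent K x \<partial>\<nu>)"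
      by (simp add: T_def mult_ac)
    also have "(\<integral>x. a x * tent K x \<partial>\<mu>) * (\<integral>x. b x * tent K x \<partial>\<nu>) = (\<integral>x. (a (x $ 1) * tent K (x $ 1)) * (b (x $ 2) * tent K (x $ 2)) \<partial>L)"
      by (rule L_prod[OF tent_cont[OF base(1), of K] tent_cont[OF base(2), of K] tent_bd[OF base(1), of K] tent_bd[OF base(2), of K], symmetric])
    also have "\<dots> = (\<integral>x. (a (x $ 1) * b (x $ 2)) * T K x \<partial>L)" by (simp add: T_def mult_ac)
    finally have 1: "(\<lambda>n. \<integral>\<omega>. (a (V n \<omega> $ 1) * b (V n \<omega> $ 2)) * T K (V n \<omega>) \<partial>M) \<longlonglongrightarrow> (\<integral>x. (a (x $ 1) * b (x $ 2)) * T K x \<partial>L)" .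
    have "\<bar>(a (x $ 1) * b (x $ 2)) * T K x\<bar> \<le> c * d" for x
    proof -
      have "\<bar>a (x $ 1) * tent K (x $ 1)\<bar> * \<bar>b (x $ 2) * tent K (x $ 2)\<bar> \<le> c * d"
        using c[of 0] by (intro mult_mono c d) auto
      then show ?thesis by (simp add: T_def abs_mult mult_ac)
    qed
    with 1 show ?case by blast
  next
    case (add p q)
    from add.IH obtain c d where c: "\<And>x. \<bar>p x * T K x\<bar> \<le> c" and d: "\<And>x. \<bar>q x * T K x\<bar> \<le> d" by auto
    have [measurable]: "p \<in> borel_measurable borel" "q \<in> borel_measurable borel"
      using add.hyps by (auto intro!: borel_measurable_continuous_onI separated_sum_continuous)
    have i: "integrable M (\<lambda>\<omega>. p (V n \<omega>) * T K (V n \<omega>))" "integrable M (\<lambda>\<omega>. q (V n \<omega>) * T K (V n \<omega>))" for n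
      by (rule M.integrable_bounded[where B=c], use c in auto)
         (rule M.integrable_bounded[where B=d], use d in auto)
    have j: "integrable L (\<lambda>x. p x * T K x)" "integrable L (\<lambda>x. q x * T K x)"
      by (rule L.integrable_bounded[where B=c], use c sets_L in \<open>auto cong: measurable_cong_sets\<close>)
         (rule L.integrable_bounded[where B=d], use d sets_L in \<open>auto cong: measurable_cong_sets\<close>)
    have "(\<lambda>n. \<integral>\<omega>. (p (V n \<omega>) + q (V n \<omega>)) * T K (V n \<omega>) \<partial>M) \<longlonglongrightarrow> (\<integral>x. (p x + q x) * T K x \<partial>L)"
      unfolding distrib_right using i j add.IH by (simp add: tendsto_add)
    moreover have "\<bar>(p x + q x) * T K x\<bar> \<le> c + d" for x
      using c[of x] d[of x] unfolding distrib_right by linarith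
    ultimately show ?case by blast
  qed
  have one: "separated_sum (\<lambda>x. 1)" using separated_sum.base[of "\<lambda>_. 1" "\<lambda>_. 1"] by simp
  show "(\<lambda>n. \<integral>\<omega>. g (V n \<omega>) \<partial>M) \<longlonglongrightarrow> (\<integral>x. g x \<partial>L)"
  proof (rule tendstoI)
    fix e :: real assume e: "e > 0"
    \<comment> \<open>The error splits into at most 2 \<epsilon> under \<open>L\<close>, at most 2
      \<epsilon> along the sequence and less than \<epsilon> between the two approximants, together
      below e.\<close>
    define \<epsilon> where "\<epsilon> = e / 6"
    have \<epsilon>: "\<epsilon> > 0" using e by (simp add: \<epsilon>_def)
    have "(\<lambda>n. G * (1 - (\<integral>x. tent (real n) x \<partial>\<mu>) * (\<integral>x. tent (real n) x \<partial>\<nu>))) \<longlonglongrightarrow> G * (1 - 1 * 1)"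
      by (intro tendsto_intros \<mu>.tent_integral_lim \<nu>.tent_integral_lim)
    then have "\<forall>\<^sub>F n in sequentially. G * (1 - (\<integral>x. tent (real n) x \<partial>\<mu>) * (\<integral>x. tent (real n) x \<partial>\<nu>)) < \<epsilon>"
      using \<epsilon> by (auto dest!: order_tendstoD(2))
    then obtain m :: nat where m: "G * (1 - (\<integral>x. tent (real m) x \<partial>\<mu>) * (\<integral>x. tent (real m) x \<partial>\<nu>)) < \<epsilon>"
      by (auto simp: eventually_sequentially)
    define K where "K = real m"
    have c1: "continuous_on UNIV (\<lambda>_::real. 1::real)" by simp
    have LT: "(\<integral>x. T K x \<partial>L) = (\<integral>x. tent K x \<partial>\<mu>) * (\<integral>x. tent K x \<partial>\<nu>)"
      using L_prod[OF tent_cont[OF c1, of K] tent_cont[OF c1, of K] tent_bd[OF c1, of K] tent_bd[OF c1, of K]] by (simp add: T_def)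
    define S where "S = {x :: real^2. \<bar>x $ 1\<bar> \<le> K + 1 \<and> \<bar>x $ 2\<bar> \<le> K + 1}"
    have "S = cbox (vector [- (K+1), - (K+1)]) (vector [K+1, K+1])"
      by (auto simp: S_def mem_box_cart forall_2 abs_le_iff)
    then have "compact S" by simp
    interpret ring: function_ring_on "Collect separated_sum" S
    proof
      show "(\<lambda>_. c) \<in> Collect separated_sum" for c
        using separated_sum.base[of "\<lambda>_. c" "\<lambda>_. 1"] by simp
      show "\<exists>f\<in>Collect separated_sum. f x \<noteq> f y" if "x \<noteq> y" for x y :: "real^2"
      proof (cases "x $ 1 = y $ 1")
        case True
        then have "x $ 2 \<noteq> y $ 2" using that by (auto simp: vec_eq_iff forall_2)
        then show ?thesis using separated_sum.base[of "\<lambda>_. 1" "\<lambda>x. x"] by auto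
      next
        case False
        then show ?thesis using separated_sum.base[of "\<lambda>x. x" "\<lambda>_. 1"] by auto
      qed
    qed (use \<open>compact S\<close> separated_sum_continuous separated_sum_mult separated_sum.add in auto)
    obtain p where p: "separated_sum p" "\<And>x. x \<in> S \<Longrightarrow> \<bar>g x - p x\<bar> < \<epsilon>"
      using ring.Stone_Weierstrass_basic[OF continuous_on_subset[OF g] \<epsilon>] by auto
    have [measurable]: "p \<in> borel_measurable borel"
      using p by (auto intro!: borel_measurable_continuous_onI separated_sum_continuous)
    obtain c where c: "\<And>x. \<bar>p x * T K x\<bar> \<le> c" using sep[OF p(1), of K] by auto
    \<comment> \<open>Where the cutoff is positive the approximation by \<open>p\<close> applies;
      the rest of \<open>g\<close> is weighted by one minus the cutoff. No bound on \<open>p\<close>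
      outside the square \<open>S\<close> enters, since the cutoff vanishes there.\<close>
    have pt: "\<bar>g x - p x * T K x\<bar> \<le> G * (1 - T K x) + \<epsilon>" for x
    proof -
      have "\<bar>g x - p x\<bar> * T K x \<le> \<epsilon>"
      proof (cases "x \<in> S")
        case True
        then show ?thesis using p(2)[OF True] T[of K x] \<epsilon> mult_mono[of "\<bar>g x - p x\<bar>" \<epsilon> "T K x" 1] by auto
      next
        case False
        then have "T K x = 0" using tent_eq_0[of K] by (auto simp: S_def T_def)
        then show ?thesis using \<epsilon> by simp
      qed
      moreover have "\<bar>g x\<bar> * (1 - T K x) \<le> G * (1 - T K x)" using G T by (intro mult_right_mono) auto
      moreover have "g x - p x * T K x = g x * (1 - T K x) + (g x - p x) * T K x" by (simp add: algebra_simps)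
      ultimately show ?thesis
        using abs_triangle_ineq[of "g x * (1 - T K x)" "(g x - p x) * T K x"] T[of K x] by (simp add: abs_mult)
    qed
    have gen: "\<bar>(\<integral>\<omega>. g (v \<omega>) \<partial>P) - (\<integral>\<omega>. p (v \<omega>) * T K (v \<omega>) \<partial>P)\<bar> \<le> G * (1 - (\<integral>\<omega>. T K (v \<omega>) \<partial>P)) + \<epsilon>"
      if P: "prob_space P" and [measurable]: "v \<in> borel_measurable P" for P :: "'z measure" and v
    proof -
      interpret P: prob_space P by fact
      have i: "integrable P (\<lambda>\<omega>. g (v \<omega>))" "integrable P (\<lambda>\<omega>. p (v \<omega>) * T K (v \<omega>))" "integrable P (\<lambda>\<omega>. T K (v \<omega>))"
        by (rule P.integrable_bounded[where B=G], use G in auto)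
           (rule P.integrable_bounded[where B=c], use c in auto, rule P.integrable_bounded[where B=1], use T in auto)
      have "\<bar>(\<integral>\<omega>. g (v \<omega>) \<partial>P) - (\<integral>\<omega>. p (v \<omega>) * T K (v \<omega>) \<partial>P)\<bar> = \<bar>\<integral>\<omega>. g (v \<omega>) - p (v \<omega>) * T K (v \<omega>) \<partial>P\<bar>" using i by simp
      also have "\<dots> \<le> (\<integral>\<omega>. G * (1 - T K (v \<omega>)) + \<epsilon> \<partial>P)"
        by (rule order_trans[OF integral_abs_bound integral_mono]) (use i pt in auto)
      also have "\<dots> = G * (1 - (\<integral>\<omega>. T K (v \<omega>) \<partial>P)) + \<epsilon>" using i by (simp add: P.prob_space)
      finally show ?thesis .
    qed
    have L1: "\<bar>(\<integral>x. g x \<partial>L) - (\<integral>x. p x * T K x \<partial>L)\<bar> \<le> 2 * \<epsilon>"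
    proof -
      have "(\<lambda>x. x) \<in> borel_measurable L" using sets_L by (simp cong: measurable_cong_sets)
      from gen[OF L this] m[folded K_def, folded LT] show ?thesis by simp
    qed
    have "(\<lambda>n. \<integral>\<omega>. p (V n \<omega>) * T K (V n \<omega>) \<partial>M) \<longlonglongrightarrow> (\<integral>x. p x * T K x \<partial>L)" using sep[OF p(1)] by blast
    from tendstoD[OF this \<epsilon>]
    have e1: "\<forall>\<^sub>F n in sequentially. \<bar>(\<integral>\<omega>. p (V n \<omega>) * T K (V n \<omega>) \<partial>M) - (\<integral>x. p x * T K x \<partial>L)\<bar> < \<epsilon>" by (simp add: dist_real_def)
    \<comment> \<open>Tightness along the sequence, read off from the limit for the constant
      function 1 times the cutoff.\<close>
    have "(\<lambda>n. G * (1 - (\<integral>\<omega>. T K (V n \<omega>) \<partial>M))) \<longlonglongrightarrow> G * (1 - (\<integral>x. T K x \<partial>L))"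
      using sep[OF one, of K] by (intro tendsto_intros) simp
    then have "\<forall>\<^sub>F n in sequentially. G * (1 - (\<integral>\<omega>. T K (V n \<omega>) \<partial>M)) < \<epsilon>"
      by (rule order_tendstoD) (use m LT K_def in auto)
    with e1 show "\<forall>\<^sub>F n in sequentially. dist (\<integral>\<omega>. g (V n \<omega>) \<partial>M) (\<integral>x. g x \<partial>L) < e"
    proof eventually_elim
      case (elim n)
      have "\<bar>(\<integral>\<omega>. g (V n \<omega>) \<partial>M) - (\<integral>\<omega>. p (V n \<omega>) * T K (V n \<omega>) \<partial>M)\<bar> \<le> 2 * \<epsilon>"
        using gen[OF M V_meas, of n] elim by simp
      then show ?case using elim L1 unfolding dist_real_def \<epsilon>_def by linarith
    qed
  qed
qed

section \<open>Sums of slowly decaying sequences\<close>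

text \<open>From some index N on, each increment of \<open>x\<close> differs from l times that of
  \<open>y\<close> by at most e/2 times the latter. These errors telescope, and the fixed offset at
  N is negligible because \<open>y\<close> tends to infinity.\<close>

lemma stolz_cesaro:
  fixes x y :: "nat \<Rightarrow> real"
  assumes y_mono: "\<And>n. y n < y (Suc n)" and y_top: "filterlim y at_top sequentially"
    and lim: "(\<lambda>n. (x (Suc n) - x n) / (y (Suc n) - y n)) \<longlonglongrightarrow> l"
  shows "(\<lambda>n. x n / y n) \<longlonglongrightarrow> l"
proof (rule tendstoI)
  fix e :: real assume e: "e > 0"
  have "\<forall>\<^sub>F n in sequentially. \<bar>(x (Suc n) - x n) / (y (Suc n) - y n) - l\<bar> < e / 2"
    using tendstoD[OF lim, of "e / 2"] e by (simp add: dist_real_def)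
  moreover have "\<forall>\<^sub>F n in sequentially. y n > 0" using y_top by (simp add: filterlim_at_top_dense)
  ultimately have "\<forall>\<^sub>F n in sequentially. \<bar>(x (Suc n) - x n) / (y (Suc n) - y n) - l\<bar> < e / 2 \<and> y n > 0"
    by (rule eventually_conj)
  then obtain N where N: "\<And>n. n \<ge> N \<Longrightarrow> \<bar>(x (Suc n) - x n) / (y (Suc n) - y n) - l\<bar> < e / 2" "\<And>n. n \<ge> N \<Longrightarrow> y n > 0"
    unfolding eventually_sequentially by blast
  have incr: "\<bar>(x (Suc n) - x n) - l * (y (Suc n) - y n)\<bar> \<le> e / 2 * (y (Suc n) - y n)" if "n \<ge> N" for n
  proof -
    let ?d = "y (Suc n) - y n"
    have d: "?d > 0" using y_mono[of n] by simp
    have "(x (Suc n) - x n) - l * ?d = ((x (Suc n) - x n) / ?d - l) * ?d" 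
      using d left_diff_distrib[of "(x (Suc n) - x n) / ?d" l ?d] by simp
    then have "\<bar>(x (Suc n) - x n) - l * ?d\<bar> = \<bar>(x (Suc n) - x n) / ?d - l\<bar> * ?d" using d by (simp add: abs_mult)
    also have "\<dots> \<le> e / 2 * ?d" using N(1)[OF that] d by (intro mult_right_mono) auto
    finally show ?thesis .
  qed
  have main: "\<bar>(x n - x N) - l * (y n - y N)\<bar> \<le> e / 2 * (y n - y N)" if "n \<ge> N" for n
    using that
  proof (induction n rule: dec_induct)
    case (step m)
    have "(x (Suc m) - x N) - l * (y (Suc m) - y N) = ((x (Suc m) - x m) - l * (y (Suc m) - y m)) + ((x m - x N) - l * (y m - y N))"
      by (simp add: algebra_simps)
    also have "\<bar>\<dots>\<bar> \<le> e / 2 * (y (Suc m) - y m) + e / 2 * (y m - y N)"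
      by (rule order_trans[OF abs_triangle_ineq add_mono]) (use incr[of m] step in auto)
    also have "\<dots> = e / 2 * (y (Suc m) - y N)" unfolding distrib_left[symmetric] by simp
    finally show ?case .
  qed simp
  define c where "c = \<bar>x N - l * y N\<bar>"
  have "(\<lambda>n. c / y n) \<longlonglongrightarrow> 0" by (intro real_tendsto_divide_at_top[OF tendsto_const y_top])
  then have "\<forall>\<^sub>F n in sequentially. c / y n < e / 2" using e by (intro order_tendstoD) auto
  moreover have "\<forall>\<^sub>F n in sequentially. n \<ge> N" by (rule eventually_ge_at_top)
  ultimately show "\<forall>\<^sub>F n in sequentially. dist (x n / y n) l < e"
  proof eventually_elim
    case (elim n)
    have y: "y n > 0" "y N > 0" using N(2) elim by auto
    have "\<bar>x n - l * y n\<bar> \<le> e / 2 * (y n - y N) + c"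
    proof -
      have "x n - l * y n = ((x n - x N) - l * (y n - y N)) + (x N - l * y N)" by (simp add: algebra_simps)
      then show ?thesis
        using main[OF elim(2)] abs_triangle_ineq[of "(x n - x N) - l * (y n - y N)" "x N - l * y N"] unfolding c_def by linarith
    qed
    also have "\<dots> \<le> e / 2 * y n + c" using y e by simp
    also have "\<dots> < e / 2 * y n + e / 2 * y n" using elim y by (simp add: field_simps)
    also have "\<dots> = e * y n" by simp
    finally have "\<bar>x n - l * y n\<bar> < e * y n" .
    then have "\<bar>x n - l * y n\<bar> / y n < e" using y by (simp add: divide_less_eq)
    moreover have "x n / y n - l = (x n - l * y n) / y n" using y by (simp add: diff_divide_distrib)
    ultimately show ?case using y by (simp add: dist_real_def)
  qed
qed

section \<open>Partial sums of sequences of power growth or decay\<close>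

lemma powr_diff_asymp:
  fixes p :: real assumes "p > -1"
  shows "(\<lambda>n. (real (Suc n) powr (p + 1) - real n powr (p + 1)) / real n powr p) \<longlonglongrightarrow> p + 1"
  using assms by real_asymp

text \<open>The sums are compared with the powers \<open>n powr (p + 1)\<close>, whose increments
  are asymptotic to (p + 1) times \<open>n powr p\<close>. With p = 0 this is the Cesaro mean; with
  p = 2H - 2 and then p = 2H - 1 it yields the variance growth of long-memory sums.\<close>

lemma sum_powr_asymp:
  fixes a :: "nat \<Rightarrow> real"
  assumes p: "p > -1" and a: "(\<lambda>n. a n / real n powr p) \<longlonglongrightarrow> c"
  shows "(\<lambda>n. (\<Sum>k<n. a k) / real n powr (p + 1)) \<longlonglongrightarrow> c / (p + 1)"
proof (rule stolz_cesaro)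
  show "real n powr (p + 1) < real (Suc n) powr (p + 1)" for n using p by (intro powr_less_mono2) auto
  show "filterlim (\<lambda>n. real n powr (p + 1)) at_top sequentially" using p by real_asymp
  have "(\<lambda>n. (a n / real n powr p) / ((real (Suc n) powr (p + 1) - real n powr (p + 1)) / real n powr p)) \<longlonglongrightarrow> c / (p + 1)"
    using p by (intro tendsto_divide a powr_diff_asymp) auto
  then show "(\<lambda>n. ((\<Sum>k<Suc n. a k) - (\<Sum>k<n. a k)) / (real (Suc n) powr (p + 1) - real n powr (p + 1))) \<longlonglongrightarrow> c / (p + 1)"
    by (rule Lim_transform_eventually) (use eventually_gt_at_top[of 0] in \<open>eventually_elim, auto\<close>)
qed

text \<open>The majorant for covariances at lag k, with 1 added so that lag 0 needs no exception. It
  is used with \<delta> = 2 - 2H, which lies between 1/2 and 1: too slow to be summable, fast enough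
  to be square summable.\<close>

definition decay :: "real \<Rightarrow> int \<Rightarrow> real" where
  "decay \<delta> k = (1 + \<bar>real_of_int k\<bar>) powr (- \<delta>)"

lemma decay_pos: "0 < decay \<delta> k" by (auto simp: decay_def)
lemma decay_minus: "decay \<delta> (- k) = decay \<delta> k" by (simp add: decay_def)

text \<open>Peetre's inequality: 1 + |k| is at most (1 + |k - m|)(1 + |m|). Since \<delta> is at
  most 1, the power of the factor in m can be replaced by the factor itself.\<close>

lemma decay_shift:
  assumes "0 \<le> \<delta>" "\<delta> \<le> 1"
  shows "decay \<delta> (k - m) \<le> decay \<delta> k * (1 + \<bar>real_of_int m\<bar>)"
proof -
  let ?k = "1 + \<bar>real_of_int k\<bar>" and ?m = "1 + \<bar>real_of_int m\<bar>" and ?d = "1 + \<bar>real_of_int (k - m)\<bar>"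
  have "\<bar>real_of_int k\<bar> \<le> \<bar>real_of_int (k - m)\<bar> + \<bar>real_of_int m\<bar>" by simp
  also have "\<dots> \<le> \<bar>real_of_int (k - m)\<bar> + \<bar>real_of_int m\<bar> + \<bar>real_of_int (k - m)\<bar> * \<bar>real_of_int m\<bar>" by simp
  finally have "?k \<le> ?d * ?m" by (simp add: algebra_simps)
  then have "?k powr \<delta> \<le> (?d * ?m) powr \<delta>" using assms by (intro powr_mono2) auto
  also have "\<dots> = ?d powr \<delta> * ?m powr \<delta>" by (simp add: powr_mult)
  also have "\<dots> \<le> ?d powr \<delta> * ?m" using powr_mono[of \<delta> 1 ?m] assms by (intro mult_left_mono) auto
  finally have "?k powr \<delta> / (?d powr \<delta> * ?k powr \<delta>) \<le> ?d powr \<delta> * ?m / (?d powr \<delta> * ?k powr \<delta>)"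
    by (intro divide_right_mono) auto
  moreover have "1 + \<bar>real_of_int k - real_of_int m\<bar> \<noteq> 0" by linarith
  ultimately show ?thesis by (simp add: decay_def powr_minus field_simps)
qed

text \<open>A row splits at the diagonal into two one-sided sums, each bounded by the sum over all
  lags below n; hence the doubled constant. The one-sided sum has the stated order by comparison
  with powers.\<close>

lemma decay_sum_bound:
  assumes "0 < \<delta>" "\<delta> < 1"
  obtains K where "K > 0" "\<And>n a. a \<in> {1..n} \<Longrightarrow> (\<Sum>b=1..n. decay \<delta> (int a - int b)) \<le> K * real n powr (1 - \<delta>)"
proof -
  have "(\<lambda>n. decay \<delta> (int n) / real n powr (- \<delta>)) \<longlonglongrightarrow> 1"
    unfolding decay_def of_int_of_nat_eq abs_of_nat using assms by real_asymp
  from sum_powr_asymp[OF _ this] assms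
  have "(\<lambda>n. (\<Sum>k<n. decay \<delta> (int k)) / real n powr (1 - \<delta>)) \<longlonglongrightarrow> 1 / (1 - \<delta>)" by (simp add: add.commute)
  then have "Bseq (\<lambda>n. (\<Sum>k<n. decay \<delta> (int k)) / real n powr (1 - \<delta>))" by (rule convergentI[THEN convergent_imp_Bseq])
  then obtain K where K: "K > 0" "\<And>n. \<bar>(\<Sum>k<n. decay \<delta> (int k)) / real n powr (1 - \<delta>)\<bar> \<le> K" unfolding Bseq_def by auto
  have S: "(\<Sum>k<n. decay \<delta> (int k)) \<le> K * real n powr (1 - \<delta>)" if "n > 0" for n
    using K(2)[of n] that by (simp add: abs_le_iff divide_le_eq)
  have "(\<Sum>b=1..n. decay \<delta> (int a - int b)) \<le> 2 * K * real n powr (1 - \<delta>)" if a: "a \<in> {1..n}" for n a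
  proof -
    have "(\<Sum>b=1..n. decay \<delta> (int a - int b)) = (\<Sum>b\<in>{1..a}. decay \<delta> (int a - int b)) + (\<Sum>b\<in>{a<..n}. decay \<delta> (int a - int b))"
      using a by (subst sum.union_disjoint[symmetric]) (auto intro!: sum.cong)
    also have "(\<Sum>b\<in>{1..a}. decay \<delta> (int a - int b)) = (\<Sum>k<a. decay \<delta> (int k))"
      by (rule sum.reindex_bij_witness[of _ "\<lambda>k. a - k" "\<lambda>b. a - b"]) (auto simp: of_nat_diff)
    also have "\<dots> \<le> (\<Sum>k<n. decay \<delta> (int k))"
      using a by (intro sum_mono2) (auto intro: less_imp_le decay_pos)
    also have "(\<Sum>b\<in>{a<..n}. decay \<delta> (int a - int b)) = (\<Sum>k\<in>{1..n-a}. decay \<delta> (int k))"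
    proof (rule sum.reindex_bij_witness[of _ "\<lambda>k. k + a" "\<lambda>b. b - a"])
      show "decay \<delta> (int (b - a)) = decay \<delta> (int a - int b)" if "b \<in> {a<..n}" for b
        using that decay_minus[of \<delta> "int a - int b"] by (simp add: of_nat_diff)
    qed auto
    also have "\<dots> \<le> (\<Sum>k<n. decay \<delta> (int k))"
      using a by (intro sum_mono2) (auto intro: less_imp_le decay_pos)
    finally show ?thesis using S[of n] a by simp
  qed
  with K(1) show ?thesis by (intro that[of "2 * K"]) auto
qed

text \<open>For \<delta> = 2 - 2H the condition reads H < 3/4; it is what makes the limit variance
  of the quadratic form finite.\<close>

lemma decay_square_summable:
  assumes "1 / 2 < \<delta>" shows "(\<lambda>k::int. (decay \<delta> k)\<^sup>2) summable_on UNIV"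
proof -
  have sq: "(decay \<delta> k)\<^sup>2 = (1 + \<bar>real_of_int k\<bar>) powr (- 2 * \<delta>)" for k
    by (simp add: decay_def power2_eq_square flip: powr_add)
  have "summable (\<lambda>n. real (Suc n) powr (- 2 * \<delta>))"
    using summable_real_powr_iff[of "- 2 * \<delta>"] assms by (subst summable_Suc_iff) simp
  then have "summable (\<lambda>n. (decay \<delta> (int n))\<^sup>2)" unfolding sq by (simp add: add.commute)
  then have s: "(\<lambda>n. (decay \<delta> (int n))\<^sup>2) summable_on UNIV"
    by (intro norm_summable_imp_summable_on) simp
  have "(\<lambda>k. (decay \<delta> k)\<^sup>2) summable_on (range int)"
    using s by (subst summable_on_reindex) (auto simp: o_def)
  moreover have "(\<lambda>k. (decay \<delta> k)\<^sup>2) summable_on (range (\<lambda>n. - int n))"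
    using s by (subst summable_on_reindex) (auto simp: o_def inj_on_def decay_minus)
  ultimately have "(\<lambda>k. (decay \<delta> k)\<^sup>2) summable_on (range int \<union> range (\<lambda>n. - int n))"
    by (rule summable_on_union)
  also have "range int \<union> range (\<lambda>n. - int n) = UNIV"
  proof (intro equalityI subsetI UNIV_I)
    fix k :: int show "k \<in> range int \<union> range (\<lambda>n. - int n)" by (cases k rule: int_cases2) auto
  qed
  finally show ?thesis .
qed

text \<open>Tannery's theorem, applied lag by lag: for each fixed lag the Cesaro mean of the squared
  covariances converges, and the lags are dominated by a summable sequence.\<close>

lemma covariance_square_sum_lim:
  fixes G :: "nat \<Rightarrow> nat \<Rightarrow> real" and r d :: "int \<Rightarrow> real"
  assumes bound: "\<And>a b. \<bar>G a b\<bar> \<le> d (int a - int b)" and d: "(\<lambda>k. (d k)\<^sup>2) summable_on UNIV"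
    and lim: "\<And>k. (\<lambda>b. G (nat (int b + k)) b) \<longlonglongrightarrow> r k"
  shows "(\<lambda>n. (\<Sum>a=1..n. \<Sum>b=1..n. (G a b)\<^sup>2) / real n) \<longlonglongrightarrow> (\<Sum>\<^sub>\<infinity>k. (r k)\<^sup>2)"
proof -
  \<comment> \<open>The contribution of the pairs with a - b = k to the normalized double sum; the
    two inequalities express that a = b + k stays within 1..n.\<close>
  define g where "g n k = (\<Sum>b=1..n. if 1 \<le> int b + k \<and> int b + k \<le> int n then (G (nat (int b + k)) b)\<^sup>2 else 0) / real n" for n k
  have sq: "(G a b)\<^sup>2 \<le> (d (int a - int b))\<^sup>2" for a b 
    using power_mono[OF bound[of a b] abs_ge_zero, of 2] by simp
  have sq_lag: "(G (nat (int b + k)) b)\<^sup>2 \<le> (d k)\<^sup>2" if "1 \<le> int b + k" for b k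
    using sq[of "nat (int b + k)" b] that by simp
  have g0: "0 \<le> g n k" for n k unfolding g_def by (intro divide_nonneg_nonneg sum_nonneg) auto
  have gd: "g n k \<le> (d k)\<^sup>2" for n k
  proof -
    have "(\<Sum>b=1..n. if 1 \<le> int b + k \<and> int b + k \<le> int n then (G (nat (int b + k)) b)\<^sup>2 else 0) \<le> (\<Sum>b=1..n. (d k)\<^sup>2)"
    proof (rule sum_mono)
      fix b
      show "(if 1 \<le> int b + k \<and> int b + k \<le> int n then (G (nat (int b + k)) b)\<^sup>2 else 0) \<le> (d k)\<^sup>2"
        using sq_lag[of b k] by simp
    qed
    also have "\<dots> = (d k)\<^sup>2 * real n" by simp
    finally have "n > 0 \<Longrightarrow> g n k \<le> (d k)\<^sup>2" unfolding g_def by (subst pos_divide_le_eq) auto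
    moreover have "g 0 k \<le> (d k)\<^sup>2" by (simp add: g_def)
    ultimately show ?thesis by (cases "n = 0") auto
  qed
  have gl: "(\<lambda>n. g n k) \<longlonglongrightarrow> (r k)\<^sup>2" for k
  proof -
    define h where "h b = (if 1 \<le> int b + k then (G (nat (int b + k)) b)\<^sup>2 else 0)" for b
    have hd: "0 \<le> h b" "h b \<le> (d k)\<^sup>2" for b
      using sq_lag[of b k] by (simp_all add: h_def)
    have "h \<longlonglongrightarrow> (r k)\<^sup>2"
    proof (rule Lim_transform_eventually)
      show "(\<lambda>b. (G (nat (int b + k)) b)\<^sup>2) \<longlonglongrightarrow> (r k)\<^sup>2" by (intro tendsto_intros lim)
      show "\<forall>\<^sub>F b in sequentially. (G (nat (int b + k)) b)\<^sup>2 = h b"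
        using eventually_ge_at_top[of "nat (1 - k)"] by eventually_elim (auto simp: h_def)
    qed
    then have "(\<lambda>n. h n / real n powr 0) \<longlonglongrightarrow> (r k)\<^sup>2" 
      by (rule Lim_transform_eventually) (use eventually_gt_at_top[of 0] in \<open>eventually_elim, auto\<close>)
    from sum_powr_asymp[OF _ this]
    have "(\<lambda>n. (\<Sum>b<n. h b) / real n powr 1) \<longlonglongrightarrow> (r k)\<^sup>2" by simp
    then have h1: "(\<lambda>n. (\<Sum>b<n. h b) / real n) \<longlonglongrightarrow> (r k)\<^sup>2"
      by (rule Lim_transform_eventually) (use eventually_gt_at_top[of 0] in \<open>eventually_elim, auto\<close>)
    \<comment> \<open>At most |k| indices fall off the upper edge, and passing from 1..n to the
      indices below n exchanges two end terms; each term is at most \<open>d k\<close>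
      squared.\<close>
    have gh: "\<bar>g n k - (\<Sum>b<n. h b) / real n\<bar> \<le> ((\<bar>k\<bar> + 2) * (d k)\<^sup>2) / real n" for n
    proof -
      let ?T = "{b\<in>{1..n}. int n < int b + k}"
      have e: "(\<Sum>b=1..n. if 1 \<le> int b + k \<and> int b + k \<le> int n then (G (nat (int b + k)) b)\<^sup>2 else 0) = (\<Sum>b=1..n. h b) - (\<Sum>b\<in>?T. h b)"
        unfolding h_def by (subst sum.inter_filter) (auto simp flip: sum_subtractf intro!: sum.cong)
      have "?T \<subseteq> {nat (int n - \<bar>k\<bar>)..n} - {nat (int n - \<bar>k\<bar>)}" by auto
      then have "card ?T \<le> card ({nat (int n - \<bar>k\<bar>)..n} - {nat (int n - \<bar>k\<bar>)})" by (intro card_mono) auto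
      also have "\<dots> \<le> nat \<bar>k\<bar>" by simp
      finally have c: "real (card ?T) \<le> \<bar>k\<bar>" by linarith
      have T: "0 \<le> (\<Sum>b\<in>?T. h b)" "(\<Sum>b\<in>?T. h b) \<le> \<bar>k\<bar> * (d k)\<^sup>2"
        using hd sum_bounded_above[of ?T h "(d k)\<^sup>2"] mult_right_mono[OF c, of "(d k)\<^sup>2"] by (auto intro!: sum_nonneg)
      have "(\<Sum>b=1..n. h b) - (\<Sum>b<n. h b) = (if n = 0 then 0 else h n - h 0)"
      proof (cases n)
        case (Suc m)
        have "(\<Sum>b<Suc m. h b) = h 0 + (\<Sum>b=1..m. h b)"
          by (simp add: sum.lessThan_Suc_shift sum.atLeast1_atMost_eq del: sum.lessThan_Suc)
        then show ?thesis using Suc by simp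
      qed simp
      then have "\<bar>(\<Sum>b=1..n. h b) - (\<Sum>b<n. h b)\<bar> \<le> (d k)\<^sup>2"
        using hd[of n] hd[of 0] by (auto simp: abs_le_iff)
      then have "\<bar>(\<Sum>b=1..n. h b) - (\<Sum>b\<in>?T. h b) - (\<Sum>b<n. h b)\<bar> \<le> (\<bar>k\<bar> + 2) * (d k)\<^sup>2"
        using T zero_le_power2[of "d k"] by (auto simp: abs_le_iff algebra_simps)
      moreover have "g n k - (\<Sum>b<n. h b) / real n = ((\<Sum>b=1..n. h b) - (\<Sum>b\<in>?T. h b) - (\<Sum>b<n. h b)) / real n"
        unfolding g_def e by (simp only: diff_divide_distrib)
      ultimately show ?thesis unfolding abs_divide by (simp add: abs_divide divide_right_mono)
    qed
    have "(\<lambda>n. g n k - (\<Sum>b<n. h b) / real n) \<longlonglongrightarrow> 0"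
    proof (rule Lim_null_comparison)
      show "(\<lambda>n. ((\<bar>k\<bar> + 2) * (d k)\<^sup>2) / real n) \<longlonglongrightarrow> 0" by (rule lim_const_over_n)
      show "\<forall>\<^sub>F n in sequentially. norm (g n k - (\<Sum>b<n. h b) / real n) \<le> ((\<bar>k\<bar> + 2) * (d k)\<^sup>2) / real n"
        unfolding real_norm_def using gh by (rule always_eventually[OF allI])
    qed
    from tendsto_add[OF this h1] show ?thesis by (simp only: diff_add_cancel add_0)
  qed
  have tot: "(\<Sum>a=1..n. \<Sum>b=1..n. (G a b)\<^sup>2) / real n = (\<integral>k. g n k \<partial>count_space UNIV)" for n
  proof -
    have supp: "{k. g n k \<noteq> 0} \<subseteq> {- int n..int n}"
    proof
      fix k assume k: "k \<in> {k. g n k \<noteq> 0}"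
      have "\<exists>b\<in>{1..n}. 1 \<le> int b + k \<and> int b + k \<le> int n"
      proof (rule ccontr)
        assume "\<not> (\<exists>b\<in>{1..n}. 1 \<le> int b + k \<and> int b + k \<le> int n)"
        then have "(\<Sum>b=1..n. if 1 \<le> int b + k \<and> int b + k \<le> int n then (G (nat (int b + k)) b)\<^sup>2 else 0) = 0"
          by (intro sum.neutral ballI if_not_P) blast
        then have "g n k = 0" by (simp only: g_def div_0)
        with k show False by simp
      qed
      then show "k \<in> {- int n..int n}" by auto
    qed
    have "(\<integral>k. g n k \<partial>count_space UNIV) = (\<Sum>k | k \<in> UNIV \<and> g n k \<noteq> 0. g n k)"
      by (rule lebesgue_integral_count_space_finite_support) (use finite_subset[OF supp] in simp)
    also have "\<dots> = (\<Sum>k\<in>{- int n..int n}. g n k)"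
      using supp by (intro sum.mono_neutral_left) auto
    also have "\<dots> = (\<Sum>b=1..n. \<Sum>k\<in>{- int n..int n}. if 1 \<le> int b + k \<and> int b + k \<le> int n then (G (nat (int b + k)) b)\<^sup>2 else 0) / real n"
      unfolding g_def sum_divide_distrib[symmetric] by (subst sum.swap) (rule refl)
    also have "(\<Sum>b=1..n. \<Sum>k\<in>{- int n..int n}. if 1 \<le> int b + k \<and> int b + k \<le> int n then (G (nat (int b + k)) b)\<^sup>2 else 0) = (\<Sum>b=1..n. \<Sum>a=1..n. (G a b)\<^sup>2)"
    proof (rule sum.cong[OF refl])
      fix b assume b: "b \<in> {1..n}"
      have "(\<Sum>k\<in>{- int n..int n}. if 1 \<le> int b + k \<and> int b + k \<le> int n then (G (nat (int b + k)) b)\<^sup>2 else 0)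
        = (\<Sum>k\<in>{k\<in>{- int n..int n}. 1 \<le> int b + k \<and> int b + k \<le> int n}. (G (nat (int b + k)) b)\<^sup>2)"
        by (rule sum.inter_filter[symmetric]) simp
      also have "\<dots> = (\<Sum>a=1..n. (G a b)\<^sup>2)"
        by (rule sum.reindex_bij_witness[of _ "\<lambda>a. int a - int b" "\<lambda>k. nat (int b + k)"]) (use b in auto)
      finally show "(\<Sum>k\<in>{- int n..int n}. if 1 \<le> int b + k \<and> int b + k \<le> int n then (G (nat (int b + k)) b)\<^sup>2 else 0) = (\<Sum>a=1..n. (G a b)\<^sup>2)" .
    qed
    also have "\<dots> = (\<Sum>a=1..n. \<Sum>b=1..n. (G a b)\<^sup>2)" by (rule sum.swap)
    finally show ?thesis ..
  qed
  have dint: "integrable (count_space UNIV) (\<lambda>k. (d k)\<^sup>2)"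
    using d abs_summable_equivalent[of "\<lambda>k. (d k)\<^sup>2" UNIV] unfolding abs_summable_on_def by simp
  have rint: "integrable (count_space UNIV) (\<lambda>k. (r k)\<^sup>2)"
  proof (rule Bochner_Integration.integrable_bound[OF dint])
    have "(r k)\<^sup>2 \<le> (d k)\<^sup>2" for k by (rule LIMSEQ_le_const2[OF gl]) (use gd in auto)
    then show "AE k in count_space UNIV. norm ((r k)\<^sup>2) \<le> norm ((d k)\<^sup>2)" by simp
  qed simp
  \<comment> \<open>Dominated convergence for the counting measure on the lags.\<close>
  have "(\<lambda>n. \<integral>k. g n k \<partial>count_space UNIV) \<longlonglongrightarrow> (\<integral>k. (r k)\<^sup>2 \<partial>count_space UNIV)"
    by (rule integral_dominated_convergence[OF _ _ dint]) (use gl g0 gd in auto)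
  also have "(\<integral>k. (r k)\<^sup>2 \<partial>count_space UNIV) = (\<Sum>\<^sub>\<infinity>k. (r k)\<^sup>2)"
    using infsetsum_infsum[of "\<lambda>k. (r k)\<^sup>2" UNIV] rint unfolding abs_summable_on_def infsetsum_def by simp
  finally show ?thesis unfolding tot .
qed

section \<open>Autoregressions driven by stationary noise\<close>

text \<open>Everything about covariances of the autoregression uses second moments and weak
  stationarity only; Gaussianity and long memory are added later.\<close>

locale second_order_noise = prob_space M for M :: "'a measure" +
  fixes \<xi> :: "int \<Rightarrow> 'a \<Rightarrow> real" and R :: "int \<Rightarrow> real"
  assumes noise_measurable [measurable]: "\<And>t. \<xi> t \<in> borel_measurable M"
    and noise_square_integrable: "\<And>t. integrable M (\<lambda>\<omega>. (\<xi> t \<omega>)\<^sup>2)"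
    and noise_cov: "\<And>s t. (\<integral>\<omega>. \<xi> s \<omega> * \<xi> t \<omega> \<partial>M) = R (s - t)"
begin

lemma mult_integrable:
  fixes f g :: "'a \<Rightarrow> real"
  assumes [measurable]: "f \<in> borel_measurable M" "g \<in> borel_measurable M"
    and f: "integrable M (\<lambda>\<omega>. (f \<omega>)\<^sup>2)" and g: "integrable M (\<lambda>\<omega>. (g \<omega>)\<^sup>2)"
  shows "integrable M (\<lambda>\<omega>. f \<omega> * g \<omega>)"
proof (rule Bochner_Integration.integrable_bound)
  show "integrable M (\<lambda>\<omega>. ((f \<omega>)\<^sup>2 + (g \<omega>)\<^sup>2) / 2)" using f g by simp
  show "AE \<omega> in M. norm (f \<omega> * g \<omega>) \<le> norm (((f \<omega>)\<^sup>2 + (g \<omega>)\<^sup>2) / 2)"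
  proof (rule AE_I2)
    fix \<omega>
    have "0 \<le> ((f \<omega>)\<^sup>2 + (g \<omega>)\<^sup>2) / 2" by simp
    then show "norm (f \<omega> * g \<omega>) \<le> norm (((f \<omega>)\<^sup>2 + (g \<omega>)\<^sup>2) / 2)"
      using abs_mult_le_squares[of "f \<omega>" "g \<omega>"] by (simp only: real_norm_def abs_of_nonneg)
  qed
qed simp

lemma noise_mult_integrable [simp]: "integrable M (\<lambda>\<omega>. \<xi> s \<omega> * \<xi> t \<omega>)"
  by (rule mult_integrable) (simp_all add: noise_square_integrable)

lemma noise_square: "(\<integral>\<omega>. (\<xi> t \<omega>)\<^sup>2 \<partial>M) = R 0"
  using noise_cov[of t t] by (simp add: power2_eq_square)

lemma R_sym: "R (- k) = R k"
  using noise_cov[of 0 k] noise_cov[of k 0] by (simp add: mult.commute)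

text \<open>Both the stationary solution and the solution started at \<open>0\<close> are limits of, respectively equal to,
  such truncated moving averages.\<close>

definition trunc_ma :: "real \<Rightarrow> nat \<Rightarrow> int \<Rightarrow> 'a \<Rightarrow> real" where
  "trunc_ma x n t \<omega> = (\<Sum>i<n. x ^ i * \<xi> (t - int i) \<omega>)"

lemma trunc_ma_measurable [measurable]: "trunc_ma x n t \<in> borel_measurable M"
  unfolding trunc_ma_def by measurable

lemma ar_stat_measurable [measurable]: "ar_stat \<xi> x t \<in> borel_measurable M"
  unfolding ar_stat_def by measurable

lemma trunc_ma_mult_integrable [simp]: "integrable M (\<lambda>\<omega>. trunc_ma x m s \<omega> * trunc_ma x n t \<omega>)"
  unfolding trunc_ma_def sum_product by (intro Bochner_Integration.integrable_sum) (simp add: mult_ac)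

lemma trunc_ma_cov:
  "(\<integral>\<omega>. trunc_ma x m s \<omega> * trunc_ma x n t \<omega> \<partial>M) = (\<Sum>i<m. \<Sum>j<n. x ^ i * x ^ j * R (s - int i - (t - int j)))"
proof -
  have "trunc_ma x m s \<omega> * trunc_ma x n t \<omega> = (\<Sum>i<m. \<Sum>j<n. x ^ i * x ^ j * (\<xi> (s - int i) \<omega> * \<xi> (t - int j) \<omega>))" for \<omega>
    unfolding trunc_ma_def sum_product by (simp add: mult_ac)
  then show ?thesis by (simp add: noise_cov)
qed

lemma trunc_ma_noise_cov: "(\<integral>\<omega>. trunc_ma x m s \<omega> * \<xi> t \<omega> \<partial>M) = (\<Sum>i<m. x ^ i * R (s - int i - t))"
proof -
  have "trunc_ma x m s \<omega> * \<xi> t \<omega> = (\<Sum>i<m. x ^ i * (\<xi> (s - int i) \<omega> * \<xi> t \<omega>))" for \<omega>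
    unfolding trunc_ma_def sum_distrib_right by (simp add: mult_ac)
  then show ?thesis by (simp add: noise_cov)
qed

section \<open>Autoregressions with a fixed coefficient: stationary and started at 0\<close>

context
  fixes x :: real
  assumes x: "0 \<le> x" "x < 1"
begin

text \<open>By Tonelli the expected value of the series is a convergent geometric series, so the
  series is finite almost everywhere.\<close>

lemma AE_summable_noise_square: "AE \<omega> in M. summable (\<lambda>i. x ^ i * (\<xi> (t - int i) \<omega>)\<^sup>2)"
proof -
  have R0: "R 0 \<ge> 0" using noise_square[of 0] by (metis Bochner_Integration.integral_nonneg zero_le_power2)
  have "(\<integral>\<^sup>+\<omega>. (\<Sum>i. ennreal (x ^ i * (\<xi> (t - int i) \<omega>)\<^sup>2)) \<partial>M) = (\<Sum>i. \<integral>\<^sup>+\<omega>. ennreal (x ^ i * (\<xi> (t - int i) \<omega>)\<^sup>2) \<partial>M)"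
    by (rule nn_integral_suminf) measurable
  also have "\<dots> = (\<Sum>i. ennreal (x ^ i * R 0))"
  proof (rule suminf_cong)
    fix i
    have "(\<integral>\<^sup>+\<omega>. ennreal (x ^ i * (\<xi> (t - int i) \<omega>)\<^sup>2) \<partial>M) = ennreal (\<integral>\<omega>. x ^ i * (\<xi> (t - int i) \<omega>)\<^sup>2 \<partial>M)"
      using x noise_square_integrable by (intro nn_integral_eq_integral) auto
    then show "(\<integral>\<^sup>+\<omega>. ennreal (x ^ i * (\<xi> (t - int i) \<omega>)\<^sup>2) \<partial>M) = ennreal (x ^ i * R 0)"
      by (simp add: noise_square)
  qed
  also have "\<dots> = ennreal (\<Sum>i. x ^ i * R 0)"
    using x R0 by (intro suminf_ennreal2) (auto intro!: summable_mult2 summable_geometric)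
  finally have "(\<integral>\<^sup>+\<omega>. (\<Sum>i. ennreal (x ^ i * (\<xi> (t - int i) \<omega>)\<^sup>2)) \<partial>M) \<noteq> \<infinity>" by simp
  then have "AE \<omega> in M. (\<Sum>i. ennreal (x ^ i * (\<xi> (t - int i) \<omega>)\<^sup>2)) \<noteq> \<infinity>"
    by (intro nn_integral_PInf_AE) auto
  then show ?thesis
    by eventually_elim (use x in \<open>auto intro!: summable_suminf_not_top\<close>)
qed

text \<open>By Cauchy--Schwarz it dominates the square of every truncated moving average at time \<open>t\<close>.\<close>

definition dominating :: "int \<Rightarrow> 'a \<Rightarrow> real" where
  "dominating t \<omega> = (\<Sum>i. x ^ i * (\<xi> (t - int i) \<omega>)\<^sup>2) / (1 - x)"

lemma dominating_integrable: "integrable M (dominating t)"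
  unfolding dominating_def
proof (intro integrable_divide_zero impI integrable_suminf)
  show "integrable M (\<lambda>\<omega>. x ^ i * (\<xi> (t - int i) \<omega>)\<^sup>2)" for i by (simp add: noise_square_integrable)
  show "AE \<omega> in M. summable (\<lambda>i. norm (x ^ i * (\<xi> (t - int i) \<omega>)\<^sup>2))"
    using AE_summable_noise_square[of t] x by simp
  show "summable (\<lambda>i. \<integral>\<omega>. norm (x ^ i * (\<xi> (t - int i) \<omega>)\<^sup>2) \<partial>M)"
    using x by (simp add: noise_square summable_mult2 summable_geometric)
qed

text \<open>The inequality |a| <= 1 + a^2 turns summability of the weighted squares into absolute
  convergence. For the bound, Cauchy--Schwarz is applied with the geometric weights, whose total
  mass is at most 1 / (1 - x); this makes it uniform in the truncation.\<close>

lemma AE_trunc_ma: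
  "AE \<omega> in M. summable (\<lambda>i. x ^ i * \<xi> (t - int i) \<omega>) \<and> (\<lambda>n. trunc_ma x n t \<omega>) \<longlonglongrightarrow> ar_stat \<xi> x t \<omega> \<and>
     (\<forall>n. (trunc_ma x n t \<omega>)\<^sup>2 \<le> dominating t \<omega>)"
  using AE_summable_noise_square[of t]
proof eventually_elim
  case (elim \<omega>)
  let ?a = "\<lambda>i. \<xi> (t - int i) \<omega>"
  have geo: "summable (\<lambda>i. x ^ i)" using x by (simp add: summable_geometric)
  have "norm (x ^ i * ?a i) \<le> x ^ i + x ^ i * (?a i)\<^sup>2" for i
  proof -
    have "\<bar>?a i\<bar> \<le> 1 + (?a i)\<^sup>2" using abs_mult_le_squares[of 1 "?a i"] zero_le_power2[of "?a i"] by simp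
    from mult_left_mono[OF this, of "x ^ i"] show ?thesis using x by (simp add: abs_mult algebra_simps)
  qed
  then have s: "summable (\<lambda>i. x ^ i * ?a i)"
    by (intro summable_comparison_test[OF _ summable_add[OF geo elim]]) auto
  moreover have "(\<lambda>n. trunc_ma x n t \<omega>) \<longlonglongrightarrow> ar_stat \<xi> x t \<omega>"
    unfolding trunc_ma_def ar_stat_def using summable_LIMSEQ[OF s] .
  moreover have "(trunc_ma x n t \<omega>)\<^sup>2 \<le> dominating t \<omega>" for n
  proof -
    have "(trunc_ma x n t \<omega>)\<^sup>2 = (\<Sum>i<n. \<Sum>j<n. x ^ i * x ^ j * (?a i * ?a j))"
      unfolding trunc_ma_def power2_eq_square sum_product by (simp add: mult_ac)
    also have "\<dots> \<le> (\<Sum>i<n. \<Sum>j<n. x ^ i * x ^ j * (((?a i)\<^sup>2 + (?a j)\<^sup>2) / 2))"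
    proof (intro sum_mono mult_left_mono)
      show "?a i * ?a j \<le> ((?a i)\<^sup>2 + (?a j)\<^sup>2) / 2" for i j
        using abs_mult_le_squares[of "?a i" "?a j"] by (rule order_trans[OF abs_ge_self])
    qed (use x in auto)
    also have "\<dots> = ((\<Sum>i<n. \<Sum>j<n. x ^ i * x ^ j * (?a i)\<^sup>2) + (\<Sum>i<n. \<Sum>j<n. x ^ i * x ^ j * (?a j)\<^sup>2)) / 2"
    proof -
      have e: "p * ((a + b) / 2) = (p * a + p * b) / 2" for p a b :: real by (simp add: distrib_left)
      show ?thesis unfolding e sum_divide_distrib[symmetric] sum.distrib ..
    qed
    also have "(\<Sum>i<n. \<Sum>j<n. x ^ i * x ^ j * (?a i)\<^sup>2) = (\<Sum>i<n. x ^ i) * (\<Sum>i<n. x ^ i * (?a i)\<^sup>2)"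
      by (subst sum.swap) (simp add: sum_product mult_ac)
    also have "(\<Sum>i<n. \<Sum>j<n. x ^ i * x ^ j * (?a j)\<^sup>2) = (\<Sum>i<n. x ^ i) * (\<Sum>i<n. x ^ i * (?a i)\<^sup>2)"
      by (simp add: sum_product mult_ac)
    also have "((\<Sum>i<n. x ^ i) * (\<Sum>i<n. x ^ i * (?a i)\<^sup>2) + (\<Sum>i<n. x ^ i) * (\<Sum>i<n. x ^ i * (?a i)\<^sup>2)) / 2 = (\<Sum>i<n. x ^ i) * (\<Sum>i<n. x ^ i * (?a i)\<^sup>2)" by simp
    also have "\<dots> \<le> (1 / (1 - x)) * (\<Sum>i. x ^ i * (?a i)\<^sup>2)"
      using x sum_le_suminf[OF geo, of "{..<n}"] suminf_geometric[of x]
      by (intro mult_mono sum_le_suminf[OF elim] sum_nonneg) auto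
    finally show ?thesis by (simp add: dominating_def)
  qed
  ultimately show ?case by blast
qed

lemma ar_stat_cov_lim:
  shows ar_stat_mult_integrable [simp]: "integrable M (\<lambda>\<omega>. ar_stat \<xi> x s \<omega> * ar_stat \<xi> x t \<omega>)"
    and "(\<lambda>n. \<integral>\<omega>. trunc_ma x n s \<omega> * trunc_ma x n t \<omega> \<partial>M) \<longlonglongrightarrow> (\<integral>\<omega>. ar_stat \<xi> x s \<omega> * ar_stat \<xi> x t \<omega> \<partial>M)"
proof -
  have w: "integrable M (\<lambda>\<omega>. (dominating s \<omega> + dominating t \<omega>) / 2)" using dominating_integrable by simp
  have lim: "AE \<omega> in M. (\<lambda>n. trunc_ma x n s \<omega> * trunc_ma x n t \<omega>) \<longlonglongrightarrow> ar_stat \<xi> x s \<omega> * ar_stat \<xi> x t \<omega>"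
    using AE_trunc_ma[of s] AE_trunc_ma[of t] by eventually_elim (auto intro: tendsto_mult)
  have bd: "AE \<omega> in M. norm (trunc_ma x n s \<omega> * trunc_ma x n t \<omega>) \<le> (dominating s \<omega> + dominating t \<omega>) / 2" for n
    using AE_trunc_ma[of s] AE_trunc_ma[of t]
  proof eventually_elim
    case (elim \<omega>)
    have "(trunc_ma x n s \<omega>)\<^sup>2 + (trunc_ma x n t \<omega>)\<^sup>2 \<le> dominating s \<omega> + dominating t \<omega>" using elim by (intro add_mono) auto
    then show ?case using abs_mult_le_squares[of "trunc_ma x n s \<omega>" "trunc_ma x n t \<omega>"] by simp
  qed
  show "integrable M (\<lambda>\<omega>. ar_stat \<xi> x s \<omega> * ar_stat \<xi> x t \<omega>)"
    by (rule integrable_dominated_convergence[OF _ _ w lim bd]) measurable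
  show "(\<lambda>n. \<integral>\<omega>. trunc_ma x n s \<omega> * trunc_ma x n t \<omega> \<partial>M) \<longlonglongrightarrow> (\<integral>\<omega>. ar_stat \<xi> x s \<omega> * ar_stat \<xi> x t \<omega> \<partial>M)"
    by (rule integral_dominated_convergence[OF _ _ w lim bd]) measurable
qed

text \<open>The covariance of the past solution with the next noise variable is the cross term in
  the closed form of the second moment; here it is the limit of explicit finite sums.\<close>

lemma ar_stat_noise_cov_lim:
  shows ar_stat_noise_integrable [simp]: "integrable M (\<lambda>\<omega>. ar_stat \<xi> x s \<omega> * \<xi> t \<omega>)"
    and "(\<lambda>n. \<integral>\<omega>. trunc_ma x n s \<omega> * \<xi> t \<omega> \<partial>M) \<longlonglongrightarrow> (\<integral>\<omega>. ar_stat \<xi> x s \<omega> * \<xi> t \<omega> \<partial>M)"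
proof -
  have w: "integrable M (\<lambda>\<omega>. (dominating s \<omega> + (\<xi> t \<omega>)\<^sup>2) / 2)" using dominating_integrable noise_square_integrable by simp
  have lim: "AE \<omega> in M. (\<lambda>n. trunc_ma x n s \<omega> * \<xi> t \<omega>) \<longlonglongrightarrow> ar_stat \<xi> x s \<omega> * \<xi> t \<omega>"
    using AE_trunc_ma[of s] by eventually_elim (auto intro: tendsto_mult)
  have bd: "AE \<omega> in M. norm (trunc_ma x n s \<omega> * \<xi> t \<omega>) \<le> (dominating s \<omega> + (\<xi> t \<omega>)\<^sup>2) / 2" for n
    using AE_trunc_ma[of s]
  proof eventually_elim
    case (elim \<omega>)
    have "(trunc_ma x n s \<omega>)\<^sup>2 + (\<xi> t \<omega>)\<^sup>2 \<le> dominating s \<omega> + (\<xi> t \<omega>)\<^sup>2" using elim by (intro add_mono) auto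
    then show ?case using abs_mult_le_squares[of "trunc_ma x n s \<omega>" "\<xi> t \<omega>"] by simp
  qed
  show "integrable M (\<lambda>\<omega>. ar_stat \<xi> x s \<omega> * \<xi> t \<omega>)"
    by (rule integrable_dominated_convergence[OF _ _ w lim bd]) measurable
  show "(\<lambda>n. \<integral>\<omega>. trunc_ma x n s \<omega> * \<xi> t \<omega> \<partial>M) \<longlonglongrightarrow> (\<integral>\<omega>. ar_stat \<xi> x s \<omega> * \<xi> t \<omega> \<partial>M)"
    by (rule integral_dominated_convergence[OF _ _ w lim bd]) measurable
qed

text \<open>For truncations of equal length the covariance is an explicit sum depending only on s -
  t; stationarity of the infinite series follows in the limit.\<close>

lemma ar_stat_cov: "(\<integral>\<omega>. ar_stat \<xi> x s \<omega> * ar_stat \<xi> x t \<omega> \<partial>M) = autocov M (ar_stat \<xi> x) (t - s)"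
proof -
  have "(\<integral>\<omega>. trunc_ma x n s \<omega> * trunc_ma x n t \<omega> \<partial>M) = (\<integral>\<omega>. trunc_ma x n 0 \<omega> * trunc_ma x n (t - s) \<omega> \<partial>M)" for n
    unfolding trunc_ma_cov by (intro sum.cong refl arg_cong2[where f="(*)"] arg_cong[where f=R]) auto
  then show ?thesis
    unfolding autocov_def using ar_stat_cov_lim(2)[of s t] ar_stat_cov_lim(2)[of 0 "t - s"]
    by (intro LIMSEQ_unique) simp_all
qed

lemma ar_stat_square: "(\<integral>\<omega>. (ar_stat \<xi> x t \<omega>)\<^sup>2 \<partial>M) = second_moment M \<xi> x"
  using ar_stat_cov[of t t] ar_stat_cov[of 0 0] by (simp add: second_moment_def power2_eq_square)

lemma autocov_ar_stat_0: "autocov M (ar_stat \<xi> x) 0 = second_moment M \<xi> x"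
  by (simp add: second_moment_def autocov_def power2_eq_square)

lemma autocov_ar_stat_le: "\<bar>autocov M (ar_stat \<xi> x) k\<bar> \<le> second_moment M \<xi> x"
proof -
  have "\<bar>autocov M (ar_stat \<xi> x) k\<bar> \<le> (\<integral>\<omega>. \<bar>ar_stat \<xi> x 0 \<omega> * ar_stat \<xi> x k \<omega>\<bar> \<partial>M)"
    unfolding autocov_def by (rule integral_abs_bound)
  also have "\<dots> \<le> (\<integral>\<omega>. ((ar_stat \<xi> x 0 \<omega>)\<^sup>2 + (ar_stat \<xi> x k \<omega>)\<^sup>2) / 2 \<partial>M)"
    using ar_stat_mult_integrable[of 0 k] ar_stat_mult_integrable[of k k] ar_stat_mult_integrable[of 0 0]
    by (intro integral_mono abs_mult_le_squares) (auto simp: power2_eq_square simp del: ar_stat_mult_integrable)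
  also have "\<dots> = second_moment M \<xi> x"
    using ar_stat_mult_integrable[of k k] ar_stat_mult_integrable[of 0 0] ar_stat_square
    by (simp add: power2_eq_square del: ar_stat_mult_integrable)
  finally show ?thesis .
qed

text \<open>Cutting the series after n terms leaves a tail that is the series at time 0 scaled by
  \<open>x ^ n\<close>. Thus the stationary solution and the one started at 0 differ by a
  geometrically small term.\<close>

lemma AE_ar_stat_shift: "AE \<omega> in M. ar_stat \<xi> x (int n) \<omega> = trunc_ma x n (int n) \<omega> + x ^ n * ar_stat \<xi> x 0 \<omega>"
  using AE_trunc_ma[of "int n"] AE_trunc_ma[of 0]
proof eventually_elim
  case (elim \<omega>)
  then have s: "summable (\<lambda>i. x ^ i * \<xi> (int n - int i) \<omega>)" and s0: "summable (\<lambda>i. x ^ i * \<xi> (0 - int i) \<omega>)" by auto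
  have "ar_stat \<xi> x (int n) \<omega> = (\<Sum>i. x ^ (i + n) * \<xi> (int n - int (i + n)) \<omega>) + trunc_ma x n (int n) \<omega>"
    unfolding ar_stat_def trunc_ma_def by (rule suminf_split_initial_segment[OF s])
  also have "(\<Sum>i. x ^ (i + n) * \<xi> (int n - int (i + n)) \<omega>) = (\<Sum>i. x ^ n * (x ^ i * \<xi> (0 - int i) \<omega>))"
    by (simp add: power_add mult_ac)
  also have "\<dots> = x ^ n * ar_stat \<xi> x 0 \<omega>" unfolding ar_stat_def by (rule suminf_mult[OF s0])
  finally show ?case by simp
qed

text \<open>Squaring the recursion \<open>Y 1 = x * Y 0 + \<xi> 1\<close> and equating the second
  moments at times 1 and 0 gives a linear equation for the second moment. The closed form involves a
  single power series, which makes differentiability in x accessible.\<close>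

lemma second_moment_formula: 
  "second_moment M \<xi> x = (R 0 + 2 * x * (\<Sum>i. R (int i + 1) * x ^ i)) / (1 - x\<^sup>2)"
proof -
  let ?Y = "ar_stat \<xi> x" and ?f = "second_moment M \<xi> x"
  have "?f = (\<integral>\<omega>. (?Y 1 \<omega>)\<^sup>2 \<partial>M)" by (rule ar_stat_square[symmetric])
  also have "\<dots> = (\<integral>\<omega>. (x * ?Y 0 \<omega> + \<xi> 1 \<omega>)\<^sup>2 \<partial>M)"
    using AE_ar_stat_shift[of 1] by (intro integral_cong_AE) (auto simp: trunc_ma_def add.commute)
  also have "\<dots> = (\<integral>\<omega>. x\<^sup>2 * (?Y 0 \<omega> * ?Y 0 \<omega>) + 2 * x * (?Y 0 \<omega> * \<xi> 1 \<omega>) + \<xi> 1 \<omega> * \<xi> 1 \<omega> \<partial>M)"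
    by (simp add: power2_eq_square algebra_simps)
  also have "\<dots> = x\<^sup>2 * ?f + 2 * x * (\<integral>\<omega>. ?Y 0 \<omega> * \<xi> 1 \<omega> \<partial>M) + R 0"
    using ar_stat_square[of 0] noise_cov[of 1 1] by (simp add: power2_eq_square)
  also have "(\<integral>\<omega>. ?Y 0 \<omega> * \<xi> 1 \<omega> \<partial>M) = (\<Sum>i. R (int i + 1) * x ^ i)"
  proof -
    have "R (- int i - 1) = R (int i + 1)" for i using R_sym[of "int i + 1"] by simp
    then have "(\<lambda>i. R (int i + 1) * x ^ i) sums (\<integral>\<omega>. ?Y 0 \<omega> * \<xi> 1 \<omega> \<partial>M)"
      using ar_stat_noise_cov_lim(2)[of 0 1] unfolding trunc_ma_noise_cov sums_def by (simp add: mult.commute)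
    then show ?thesis by (simp add: sums_iff)
  qed
  finally have "?f - x\<^sup>2 * ?f = R 0 + 2 * x * (\<Sum>i. R (int i + 1) * x ^ i)" by linarith
  moreover have "?f * (1 - x\<^sup>2) = ?f - x\<^sup>2 * ?f" by (simp add: algebra_simps)
  ultimately have m: "?f * (1 - x\<^sup>2) = R 0 + 2 * x * (\<Sum>i. R (int i + 1) * x ^ i)" by (simp only:)
  have nz: "1 - x\<^sup>2 \<noteq> 0" using x by (simp add: power2_eq_1_iff)
  show ?thesis by (rule nonzero_eq_divide_eq[OF nz, THEN iffD2, OF m])
qed

text \<open>Shifting the lag by i - j costs a factor at most (1 + i)(1 + j), which the geometric
  weights absorb. The constant does not depend on the truncations m and n, so the noise decay passes
  to all the covariances at once.\<close>

lemma trunc_ma_cov_bound: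
  assumes \<delta>: "0 \<le> \<delta>" "\<delta> \<le> 1" and R: "\<And>k. \<bar>R k\<bar> \<le> K * decay \<delta> k"
  shows "\<bar>\<integral>\<omega>. trunc_ma x m s \<omega> * trunc_ma x n t \<omega> \<partial>M\<bar> \<le> K * (\<Sum>i. x ^ i * (1 + real i))\<^sup>2 * decay \<delta> (s - t)"
proof -
  have K: "K \<ge> 0" using order_trans[OF abs_ge_zero R[of 0]] decay_pos[of \<delta> 0] by (simp add: zero_le_mult_iff)
  \<comment> \<open>Up to notation this is the termwise derivative of the geometric series.\<close>
  have sm: "summable (\<lambda>i. x ^ i * (1 + real i))"
  proof -
    have "summable (\<lambda>n. diffs (\<lambda>_. 1) n * x ^ n)"
    proof (rule termdiff_converges[where K = 1])
      show "norm x < 1" using x by simp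
      show "summable (\<lambda>n. 1 * y ^ n)" if "norm y < 1" for y :: real using summable_geometric[OF that] by simp
    qed
    moreover have "diffs (\<lambda>_. 1) n * x ^ n = x ^ n * (1 + real n)" for n by (simp add: diffs_def)
    ultimately show ?thesis by (simp only:)
  qed
  let ?S = "\<Sum>i. x ^ i * (1 + real i)"
  have "\<bar>\<integral>\<omega>. trunc_ma x m s \<omega> * trunc_ma x n t \<omega> \<partial>M\<bar> \<le> (\<Sum>i<m. \<Sum>j<n. x ^ i * x ^ j * (K * (decay \<delta> (s - t) * ((1 + real i) * (1 + real j)))))"
    unfolding trunc_ma_cov
  proof (intro order_trans[OF sum_abs sum_mono])
    fix i j
    have "\<bar>R (s - int i - (t - int j))\<bar> \<le> K * decay \<delta> ((s - t) - (int i - int j))" using R[of "s - int i - (t - int j)"] by (simp add: algebra_simps)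
    also have "\<dots> \<le> K * (decay \<delta> (s - t) * (1 + \<bar>real_of_int (int i - int j)\<bar>))"
      by (intro mult_left_mono decay_shift \<delta> K)
    also have "\<dots> \<le> K * (decay \<delta> (s - t) * ((1 + real i) * (1 + real j)))"
    proof (intro mult_left_mono K less_imp_le[OF decay_pos])
      have "0 \<le> real i * real j" by simp
      moreover have "(1 + real i) * (1 + real j) = 1 + real i + real j + real i * real j" by (simp add: algebra_simps)
      moreover have "\<bar>real_of_int (int i - int j)\<bar> \<le> real i + real j" by simp
      ultimately show "1 + \<bar>real_of_int (int i - int j)\<bar> \<le> (1 + real i) * (1 + real j)" by linarith
    qed
    finally show "\<bar>x ^ i * x ^ j * R (s - int i - (t - int j))\<bar> \<le> x ^ i * x ^ j * (K * (decay \<delta> (s - t) * ((1 + real i) * (1 + real j))))"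
      using x by (simp add: abs_mult mult_left_mono)
  qed
  also have "\<dots> = K * decay \<delta> (s - t) * ((\<Sum>i<m. x ^ i * (1 + real i)) * (\<Sum>j<n. x ^ j * (1 + real j)))"
    by (subst sum_product) (simp add: sum_distrib_left mult_ac)
  also have "\<dots> \<le> K * decay \<delta> (s - t) * (?S * ?S)"
  proof (rule mult_left_mono)
    have le: "(\<Sum>i<n. x ^ i * (1 + real i)) \<le> ?S" for n by (rule sum_le_suminf[OF sm]) (use x in auto)
    have nn: "0 \<le> (\<Sum>i<n. x ^ i * (1 + real i))" for n by (rule sum_nonneg) (use x in auto)
    show "(\<Sum>i<m. x ^ i * (1 + real i)) * (\<Sum>j<n. x ^ j * (1 + real j)) \<le> ?S * ?S"
      by (rule mult_mono[OF le le order_trans[OF nn le] nn])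
    show "0 \<le> K * decay \<delta> (s - t)" using K less_imp_le[OF decay_pos] by (rule mult_nonneg_nonneg)
  qed
  finally show ?thesis by (simp add: power2_eq_square mult_ac)
qed

text \<open>Truncating at time a after a terms keeps precisely the noise at times 1 to a, which
  gives the solution started from 0 at time 0.\<close>

definition start_cov :: "nat \<Rightarrow> nat \<Rightarrow> real" where
  "start_cov a b = (\<integral>\<omega>. trunc_ma x a (int a) \<omega> * trunc_ma x b (int b) \<omega> \<partial>M)"

text \<open>Each factor is replaced by the stationary solution minus its geometric correction;
  expanding the product leaves stationary covariances only.\<close>

lemma start_cov_eq:
  "start_cov a b = autocov M (ar_stat \<xi> x) (int a - int b) - x ^ b * autocov M (ar_stat \<xi> x) (int a)
     - x ^ a * autocov M (ar_stat \<xi> x) (int b) + x ^ (a + b) * second_moment M \<xi> x"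
proof -
  let ?Y = "ar_stat \<xi> x"
  have "start_cov a b = (\<integral>\<omega>. (?Y (int a) \<omega> - x ^ a * ?Y 0 \<omega>) * (?Y (int b) \<omega> - x ^ b * ?Y 0 \<omega>) \<partial>M)"
    unfolding start_cov_def using AE_ar_stat_shift[of a] AE_ar_stat_shift[of b] by (intro integral_cong_AE) auto
  also have "\<dots> = (\<integral>\<omega>. ?Y (int b) \<omega> * ?Y (int a) \<omega> - x ^ b * (?Y 0 \<omega> * ?Y (int a) \<omega>) - x ^ a * (?Y 0 \<omega> * ?Y (int b) \<omega>) + x ^ (a + b) * (?Y 0 \<omega> * ?Y 0 \<omega>) \<partial>M)"
    by (simp add: algebra_simps power_add)
  finally show ?thesis by (simp add: ar_stat_cov autocov_ar_stat_0)
qed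

text \<open>The deviation has the factor \<open>x ^ a\<close> by the explicit formula; the constant
  3 adds one second moment and two autocovariances, each at most the second moment. Being summable
  in a, the deviations contribute nothing on the scale of the square root of n.\<close>

lemma start_cov_diag: "\<bar>start_cov a a - second_moment M \<xi> x\<bar> \<le> 3 * second_moment M \<xi> x * x ^ a"
proof -
  let ?f = "second_moment M \<xi> x" and ?r = "autocov M (ar_stat \<xi> x) (int a)"
  have "start_cov a a - ?f = x ^ a * (x ^ a * ?f - 2 * ?r)"
    unfolding start_cov_eq by (simp add: autocov_ar_stat_0 power_add algebra_simps)
  then have "\<bar>start_cov a a - ?f\<bar> = x ^ a * \<bar>x ^ a * ?f - 2 * ?r\<bar>" using x by (simp add: abs_mult)
  also have "\<dots> \<le> x ^ a * (3 * ?f)"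
  proof (rule mult_left_mono)
    have f: "?f \<ge> 0" using autocov_ar_stat_le[of 0] by (rule order_trans[OF abs_ge_zero])
    have "x ^ a * ?f \<le> ?f" using x f by (simp add: mult_left_le_one_le power_le_one)
    moreover have "0 \<le> x ^ a * ?f" using x f by simp
    ultimately show "\<bar>x ^ a * ?f - 2 * ?r\<bar> \<le> 3 * ?f" using autocov_ar_stat_le[of "int a"] by linarith
  qed (use x in simp)
  finally show ?thesis by (simp add: mult_ac)
qed

text \<open>All correction terms contain a power of x tending to 0 times a bounded autocovariance.
  For b below -k the conversion \<open>nat\<close> truncates to 0, but the limit sees only large
  b.\<close>

lemma start_cov_lim: "(\<lambda>b. start_cov (nat (int b + k)) b) \<longlonglongrightarrow> autocov M (ar_stat \<xi> x) k"
proof -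
  let ?f = "second_moment M \<xi> x" and ?r = "autocov M (ar_stat \<xi> x)"
  have f: "?f \<ge> 0" using autocov_ar_stat_le[of 0] by (rule order_trans[OF abs_ge_zero])
  have pb: "(\<lambda>b. x ^ b) \<longlonglongrightarrow> 0" using x by (intro LIMSEQ_power_zero) auto
  have "filterlim (\<lambda>b::nat. nat (int b + k)) at_top sequentially"
    unfolding filterlim_at_top
  proof
    fix Z show "\<forall>\<^sub>F b in sequentially. Z \<le> nat (int b + k)"
      using eventually_ge_at_top[of "nat (int Z + \<bar>k\<bar>)"] by eventually_elim auto
  qed
  then have pa: "(\<lambda>b. x ^ nat (int b + k)) \<longlonglongrightarrow> 0" by (rule filterlim_compose[OF pb])
  have b0: "(\<lambda>b. u b * v b) \<longlonglongrightarrow> 0" if "u \<longlonglongrightarrow> 0" "\<And>b. \<bar>v b\<bar> \<le> ?f" for u v :: "nat \<Rightarrow> real"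
  proof (rule Lim_null_comparison)
    show "(\<lambda>b. \<bar>u b\<bar> * ?f) \<longlonglongrightarrow> 0" using tendsto_mult[OF tendsto_rabs_zero[OF that(1)] tendsto_const[of ?f]] by simp
    show "\<forall>\<^sub>F b in sequentially. norm (u b * v b) \<le> \<bar>u b\<bar> * ?f"
      using that(2) by (intro always_eventually allI) (simp add: abs_mult mult_left_mono)
  qed
  have t1: "(\<lambda>b. x ^ b * ?r (int (nat (int b + k)))) \<longlonglongrightarrow> 0" by (rule b0[OF pb autocov_ar_stat_le])
  have t2: "(\<lambda>b. x ^ nat (int b + k) * ?r (int b)) \<longlonglongrightarrow> 0" by (rule b0[OF pa autocov_ar_stat_le])
  have t3: "(\<lambda>b. (x ^ b * x ^ nat (int b + k)) * ?f) \<longlonglongrightarrow> 0 * 0 * ?f" by (rule tendsto_mult[OF tendsto_mult[OF pb pa] tendsto_const])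
  note tendsto_add[OF tendsto_diff[OF tendsto_diff[OF tendsto_const[of "?r k"] t1] t2] t3]
  then have "(\<lambda>b. ?r k - x ^ b * ?r (int (nat (int b + k))) - x ^ nat (int b + k) * ?r (int b) + (x ^ b * x ^ nat (int b + k)) * ?f) \<longlonglongrightarrow> ?r k" by simp
  then show ?thesis
  proof (rule Lim_transform_eventually)
    show "\<forall>\<^sub>F b in sequentially. ?r k - x ^ b * ?r (int (nat (int b + k))) - x ^ nat (int b + k) * ?r (int b) + (x ^ b * x ^ nat (int b + k)) * ?f = start_cov (nat (int b + k)) b"
      using eventually_ge_at_top[of "nat \<bar>k\<bar>"]
    proof eventually_elim
      case (elim b)
      then have "int (nat (int b + k)) - int b = k" by simp
      then show ?case unfolding start_cov_eq by (simp add: power_add mult_ac)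
    qed
  qed
qed

end

end

section \<open>Convergence in probability and tightness\<close>

context prob_space begin

text \<open>Convergence to 0 in probability. Measurability is included so that the rules below
  compose without side conditions.\<close>

definition vanishes :: "(nat \<Rightarrow> 'a \<Rightarrow> real) \<Rightarrow> bool" where
  "vanishes D \<longleftrightarrow> (\<forall>n. D n \<in> borel_measurable M) \<and> (\<forall>e>0. (\<lambda>n. prob {\<omega>\<in>space M. e < \<bar>D n \<omega>\<bar>}) \<longlonglongrightarrow> 0)"

text \<open>The bound is asked for only eventually in n, which is what weak convergence provides
  directly and all that limits require.\<close>

definition tight_rvs :: "(nat \<Rightarrow> 'a \<Rightarrow> real) \<Rightarrow> bool" where
  "tight_rvs D \<longleftrightarrow> (\<forall>n. D n \<in> borel_measurable M) \<and>
     (\<forall>e>0. \<exists>K>0. \<forall>\<^sub>F n in sequentially. prob {\<omega>\<in>space M. K < \<bar>D n \<omega>\<bar>} < e)"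

lemma vanishes_measurable: "vanishes D \<Longrightarrow> D n \<in> borel_measurable M" by (simp add: vanishes_def)
lemma tight_rvs_measurable: "tight_rvs D \<Longrightarrow> D n \<in> borel_measurable M" by (simp add: tight_rvs_def)

lemma vanishes_lim: "vanishes D \<Longrightarrow> 0 < e \<Longrightarrow> (\<lambda>n. prob {\<omega>\<in>space M. e < \<bar>D n \<omega>\<bar>}) \<longlonglongrightarrow> 0"
  by (simp add: vanishes_def)

lemma vanishesI_eventually:
  assumes D: "\<And>n. D n \<in> borel_measurable M"
    and *: "\<And>e r. 0 < e \<Longrightarrow> 0 < r \<Longrightarrow> \<forall>\<^sub>F n in sequentially. prob {\<omega>\<in>space M. e < \<bar>D n \<omega>\<bar>} < r"
  shows "vanishes D"
  unfolding vanishes_def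
proof (intro conjI allI impI D tendstoI)
  fix e r :: real assume "0 < e" "0 < r"
  from *[OF this] show "\<forall>\<^sub>F n in sequentially. dist (prob {\<omega>\<in>space M. e < \<bar>D n \<omega>\<bar>}) 0 < r" by simp
qed

lemma vanishes_eventually:
  assumes "vanishes D" "0 < e" "0 < r" 
  shows "\<forall>\<^sub>F n in sequentially. prob {\<omega>\<in>space M. e < \<bar>D n \<omega>\<bar>} < r"
  by (rule order_tendstoD(2)[OF vanishes_lim[OF assms(1,2)] assms(3)])

lemma prob_gt_union:
  fixes A B C :: "'a \<Rightarrow> real"
  assumes [measurable]: "A \<in> borel_measurable M" "B \<in> borel_measurable M" "C \<in> borel_measurable M"
    and imp: "\<And>\<omega>. \<omega> \<in> space M \<Longrightarrow> e < \<bar>C \<omega>\<bar> \<Longrightarrow> a < \<bar>A \<omega>\<bar> \<or> b < \<bar>B \<omega>\<bar>"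
  shows "prob {\<omega>\<in>space M. e < \<bar>C \<omega>\<bar>} \<le> prob {\<omega>\<in>space M. a < \<bar>A \<omega>\<bar>} + prob {\<omega>\<in>space M. b < \<bar>B \<omega>\<bar>}"
proof -
  have SA: "{\<omega>\<in>space M. a < \<bar>A \<omega>\<bar>} \<in> events" by measurable
  have SB: "{\<omega>\<in>space M. b < \<bar>B \<omega>\<bar>} \<in> events" by measurable
  have "prob {\<omega>\<in>space M. e < \<bar>C \<omega>\<bar>} \<le> prob ({\<omega>\<in>space M. a < \<bar>A \<omega>\<bar>} \<union> {\<omega>\<in>space M. b < \<bar>B \<omega>\<bar>})"
    by (rule finite_measure_mono[OF _ sets.Un[OF SA SB]]) (use imp in auto)
  also have "\<dots> \<le> prob {\<omega>\<in>space M. a < \<bar>A \<omega>\<bar>} + prob {\<omega>\<in>space M. b < \<bar>B \<omega>\<bar>}"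
    by (rule measure_Un_le[OF SA SB])
  finally show ?thesis .
qed

lemma vanishes_add:
  assumes A: "vanishes A" and B: "vanishes B" shows "vanishes (\<lambda>n \<omega>. A n \<omega> + B n \<omega>)"
proof (rule vanishesI_eventually)
  note [measurable] = vanishes_measurable[OF A] vanishes_measurable[OF B]
  show "(\<lambda>\<omega>. A n \<omega> + B n \<omega>) \<in> borel_measurable M" for n by measurable
  fix e r :: real assume e: "0 < e" and r: "0 < r"
  have "\<forall>\<^sub>F n in sequentially. prob {\<omega>\<in>space M. e / 2 < \<bar>A n \<omega>\<bar>} < r / 2" using A e r by (intro vanishes_eventually) auto
  moreover have "\<forall>\<^sub>F n in sequentially. prob {\<omega>\<in>space M. e / 2 < \<bar>B n \<omega>\<bar>} < r / 2" using B e r by (intro vanishes_eventually) auto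
  ultimately show "\<forall>\<^sub>F n in sequentially. prob {\<omega>\<in>space M. e < \<bar>A n \<omega> + B n \<omega>\<bar>} < r"
  proof eventually_elim
    case (elim n)
    have "prob {\<omega>\<in>space M. e < \<bar>A n \<omega> + B n \<omega>\<bar>} \<le> prob {\<omega>\<in>space M. e / 2 < \<bar>A n \<omega>\<bar>} + prob {\<omega>\<in>space M. e / 2 < \<bar>B n \<omega>\<bar>}"
      by (rule prob_gt_union) auto
    with elim show ?case by simp
  qed
qed

lemma tight_rvs_mult:
  assumes A: "tight_rvs A" and B: "tight_rvs B" shows "tight_rvs (\<lambda>n \<omega>. A n \<omega> * B n \<omega>)"
  unfolding tight_rvs_def
proof (intro conjI allI impI)
  note [measurable] = tight_rvs_measurable[OF A] tight_rvs_measurable[OF B]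
  show "(\<lambda>\<omega>. A n \<omega> * B n \<omega>) \<in> borel_measurable M" for n by measurable
  fix e :: real assume e: "e > 0"
  then have "e / 2 > 0" by simp
  with A B obtain K L where K: "K > 0" "\<forall>\<^sub>F n in sequentially. prob {\<omega>\<in>space M. K < \<bar>A n \<omega>\<bar>} < e / 2"
    and L: "L > 0" "\<forall>\<^sub>F n in sequentially. prob {\<omega>\<in>space M. L < \<bar>B n \<omega>\<bar>} < e / 2"
    unfolding tight_rvs_def by meson
  have "\<forall>\<^sub>F n in sequentially. prob {\<omega>\<in>space M. K * L < \<bar>A n \<omega> * B n \<omega>\<bar>} < e"
    using K(2) L(2)
  proof eventually_elim
    case (elim n)
    have "prob {\<omega>\<in>space M. K * L < \<bar>A n \<omega> * B n \<omega>\<bar>} \<le> prob {\<omega>\<in>space M. K < \<bar>A n \<omega>\<bar>} + prob {\<omega>\<in>space M. L < \<bar>B n \<omega>\<bar>}"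
    proof (rule prob_gt_union)
      fix \<omega> assume *: "K * L < \<bar>A n \<omega> * B n \<omega>\<bar>"
      show "K < \<bar>A n \<omega>\<bar> \<or> L < \<bar>B n \<omega>\<bar>"
      proof (rule ccontr)
        assume "\<not> (K < \<bar>A n \<omega>\<bar> \<or> L < \<bar>B n \<omega>\<bar>)"
        then have "\<bar>A n \<omega>\<bar> * \<bar>B n \<omega>\<bar> \<le> K * L" using K by (intro mult_mono) auto
        with * show False by (simp add: abs_mult)
      qed
    qed auto
    with elim show ?case by simp
  qed
  then show "\<exists>K>0. \<forall>\<^sub>F n in sequentially. prob {\<omega>\<in>space M. K < \<bar>A n \<omega> * B n \<omega>\<bar>} < e"
    using K(1) L(1) by (intro exI[of _ "K * L"]) auto
qed

lemma tight_rvs_null_mult: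
  assumes A: "tight_rvs A" and c: "c \<longlonglongrightarrow> 0" shows "vanishes (\<lambda>n \<omega>. c n * A n \<omega>)"
proof (rule vanishesI_eventually)
  note [measurable] = tight_rvs_measurable[OF A]
  show "(\<lambda>\<omega>. c n * A n \<omega>) \<in> borel_measurable M" for n by measurable
  fix e r :: real assume e: "0 < e" and r: "0 < r"
  obtain K where K: "K > 0" "\<forall>\<^sub>F n in sequentially. prob {\<omega>\<in>space M. K < \<bar>A n \<omega>\<bar>} < r"
    using A r unfolding tight_rvs_def by meson
  have "\<forall>\<^sub>F n in sequentially. dist (c n) 0 < e / K" using e K by (intro tendstoD[OF c]) auto
  with K(2) show "\<forall>\<^sub>F n in sequentially. prob {\<omega>\<in>space M. e < \<bar>c n * A n \<omega>\<bar>} < r"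
  proof eventually_elim
    case (elim n)
    have "prob {\<omega>\<in>space M. e < \<bar>c n * A n \<omega>\<bar>} \<le> prob {\<omega>\<in>space M. K < \<bar>A n \<omega>\<bar>}"
    proof (intro finite_measure_mono subsetI)
      fix \<omega> assume *: "\<omega> \<in> {\<omega>\<in>space M. e < \<bar>c n * A n \<omega>\<bar>}"
      have "K < \<bar>A n \<omega>\<bar>"
      proof (rule ccontr)
        assume "\<not> K < \<bar>A n \<omega>\<bar>"
        then have "\<bar>c n\<bar> * \<bar>A n \<omega>\<bar> \<le> e / K * K" using elim K e by (intro mult_mono) auto
        with * K show False by (simp add: abs_mult)
      qed
      with * show "\<omega> \<in> {\<omega>\<in>space M. K < \<bar>A n \<omega>\<bar>}" by simp
    qed measurable
    with elim show ?case by simp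
  qed
qed

lemma tight_rvs_vanishes_mult:
  assumes A: "tight_rvs A" and B: "vanishes B" shows "vanishes (\<lambda>n \<omega>. B n \<omega> * A n \<omega>)"
proof (rule vanishesI_eventually)
  note [measurable] = tight_rvs_measurable[OF A] vanishes_measurable[OF B]
  show "(\<lambda>\<omega>. B n \<omega> * A n \<omega>) \<in> borel_measurable M" for n by measurable
  fix e r :: real assume e: "0 < e" and r: "0 < r"
  then have "r / 2 > 0" by simp
  then obtain K where K: "K > 0" "\<forall>\<^sub>F n in sequentially. prob {\<omega>\<in>space M. K < \<bar>A n \<omega>\<bar>} < r / 2"
    using A unfolding tight_rvs_def by meson
  have "\<forall>\<^sub>F n in sequentially. prob {\<omega>\<in>space M. e / K < \<bar>B n \<omega>\<bar>} < r / 2" using e r K B by (intro vanishes_eventually) auto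
  with K(2) show "\<forall>\<^sub>F n in sequentially. prob {\<omega>\<in>space M. e < \<bar>B n \<omega> * A n \<omega>\<bar>} < r"
  proof eventually_elim
    case (elim n)
    have "prob {\<omega>\<in>space M. e < \<bar>B n \<omega> * A n \<omega>\<bar>} \<le> prob {\<omega>\<in>space M. K < \<bar>A n \<omega>\<bar>} + prob {\<omega>\<in>space M. e / K < \<bar>B n \<omega>\<bar>}"
    proof (rule prob_gt_union)
      fix \<omega> assume *: "e < \<bar>B n \<omega> * A n \<omega>\<bar>"
      show "K < \<bar>A n \<omega>\<bar> \<or> e / K < \<bar>B n \<omega>\<bar>"
      proof (rule ccontr)
        assume "\<not> (K < \<bar>A n \<omega>\<bar> \<or> e / K < \<bar>B n \<omega>\<bar>)"
        then have "\<bar>B n \<omega>\<bar> * \<bar>A n \<omega>\<bar> \<le> e / K * K" using K e by (intro mult_mono) auto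
        with * K show False by (simp add: abs_mult)
      qed
    qed auto
    with elim show ?case by simp
  qed
qed

lemma prob_gt_Markov:
  assumes [measurable]: "D \<in> borel_measurable M" and "integrable M D" "0 < e"
  shows "prob {\<omega>\<in>space M. e < \<bar>D \<omega>\<bar>} \<le> (\<integral>\<omega>. \<bar>D \<omega>\<bar> \<partial>M) / e"
proof -
  have "prob {\<omega>\<in>space M. e < \<bar>D \<omega>\<bar>} \<le> prob {\<omega>\<in>space M. e \<le> \<bar>D \<omega>\<bar>}" by (intro finite_measure_mono) auto
  also have "\<dots> \<le> (\<integral>\<omega>. \<bar>D \<omega>\<bar> \<partial>M) / e"
    using assms by (intro integral_Markov_inequality_measure[where A = "space M"]) auto
  finally show ?thesis .
qed

lemma vanishes_L1:
  assumes i: "\<And>n. integrable M (D n)" and "(\<lambda>n. \<integral>\<omega>. \<bar>D n \<omega>\<bar> \<partial>M) \<longlonglongrightarrow> 0"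
  shows "vanishes D"
  unfolding vanishes_def
proof (intro conjI allI impI)
  show m: "D n \<in> borel_measurable M" for n using i by auto
  fix e :: real assume e: "e > 0"
  show "(\<lambda>n. prob {\<omega>\<in>space M. e < \<bar>D n \<omega>\<bar>}) \<longlonglongrightarrow> 0"
  proof (rule Lim_null_comparison)
    show "\<forall>\<^sub>F n in sequentially. norm (prob {\<omega>\<in>space M. e < \<bar>D n \<omega>\<bar>}) \<le> (\<integral>\<omega>. \<bar>D n \<omega>\<bar> \<partial>M) / e"
      using prob_gt_Markov[OF m i e] by (intro always_eventually allI) simp
    show "(\<lambda>n. (\<integral>\<omega>. \<bar>D n \<omega>\<bar> \<partial>M) / e) \<longlonglongrightarrow> 0" by (rule tendsto_divide_zero[OF assms(2)])
  qed
qed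

lemma tight_rvs_L1:
  assumes i: "\<And>n. integrable M (D n)" and B: "\<And>n. (\<integral>\<omega>. \<bar>D n \<omega>\<bar> \<partial>M) \<le> B"
  shows "tight_rvs D"
  unfolding tight_rvs_def
proof (intro conjI allI impI)
  show m: "D n \<in> borel_measurable M" for n using i by auto
  fix e :: real assume e: "e > 0"
  have B0: "B \<ge> 0" using B[of 0] by (rule order_trans[rotated]) simp
  define K where "K = (B + 1) / e"
  have K: "K > 0" using e B0 by (simp add: K_def)
  have "prob {\<omega>\<in>space M. K < \<bar>D n \<omega>\<bar>} < e" for n
  proof -
    have "prob {\<omega>\<in>space M. K < \<bar>D n \<omega>\<bar>} \<le> (\<integral>\<omega>. \<bar>D n \<omega>\<bar> \<partial>M) / K" by (rule prob_gt_Markov[OF m i K])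
    also have "\<dots> \<le> B / K" using B K by (intro divide_right_mono) auto
    also have "\<dots> < e" using e B0 by (simp add: K_def field_simps)
    finally show ?thesis .
  qed
  then show "\<exists>K>0. \<forall>\<^sub>F n in sequentially. prob {\<omega>\<in>space M. K < \<bar>D n \<omega>\<bar>} < e" using K by auto
qed

text \<open>A Slutsky argument for characteristic functions: the exponentials with and without
  \<open>D\<close> differ by at most the minimum of |D| and 2, whatever \<open>A\<close> is.
  Splitting at |D| = e bounds the difference of expectations by e plus twice a vanishing
  probability.\<close>

lemma vanishes_char:
  assumes A [measurable]: "\<And>n. A n \<in> borel_measurable M" and D: "vanishes D"
    and lim: "(\<lambda>n. \<integral>\<omega>. iexp (A n \<omega>) \<partial>M) \<longlonglongrightarrow> l"
  shows "(\<lambda>n. \<integral>\<omega>. iexp (A n \<omega> + D n \<omega>) \<partial>M) \<longlonglongrightarrow> l"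
proof -
  note [measurable] = vanishes_measurable[OF D]
  have i: "integrable M (\<lambda>\<omega>. iexp (f \<omega>))" if [measurable]: "f \<in> borel_measurable M" for f
    by (rule integrable_bounded[where B=1]) auto
  have bound: "cmod ((\<integral>\<omega>. iexp (A n \<omega> + D n \<omega>) \<partial>M) - (\<integral>\<omega>. iexp (A n \<omega>) \<partial>M)) \<le> e + 2 * prob {\<omega>\<in>space M. e < \<bar>D n \<omega>\<bar>}"
    if e: "e > 0" for e n
  proof -
    have SD: "{\<omega>\<in>space M. e < \<bar>D n \<omega>\<bar>} \<in> events" by measurable
    have iI: "integrable M (indicat_real {\<omega>\<in>space M. e < \<bar>D n \<omega>\<bar>})"
      using SD by (intro integrable_real_indicator) (simp_all add: emeasure_eq_measure)
    have iA: "integrable M (\<lambda>\<omega>. iexp (A n \<omega>))" by (rule i) measurable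
    have iAD: "integrable M (\<lambda>\<omega>. iexp (A n \<omega> + D n \<omega>))" by (rule i) measurable
    have "cmod ((\<integral>\<omega>. iexp (A n \<omega> + D n \<omega>) \<partial>M) - (\<integral>\<omega>. iexp (A n \<omega>) \<partial>M)) = cmod (\<integral>\<omega>. iexp (A n \<omega> + D n \<omega>) - iexp (A n \<omega>) \<partial>M)"
      by (simp only: Bochner_Integration.integral_diff[OF iAD iA])
    also have "\<dots> \<le> (\<integral>\<omega>. e + 2 * indicator {\<omega>\<in>space M. e < \<bar>D n \<omega>\<bar>} \<omega> \<partial>M)"
    proof (rule order_trans[OF integral_norm_bound integral_mono])
      show "integrable M (\<lambda>\<omega>. cmod (iexp (A n \<omega> + D n \<omega>) - iexp (A n \<omega>)))"
        by (intro integrable_norm Bochner_Integration.integrable_diff iA iAD)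
      show "integrable M (\<lambda>\<omega>. e + 2 * indicat_real {\<omega>\<in>space M. e < \<bar>D n \<omega>\<bar>} \<omega>)"
        using iI by (intro Bochner_Integration.integrable_add integrable_mult_right integrable_const)
      fix \<omega> assume \<omega>: "\<omega> \<in> space M"
      have "iexp (A n \<omega> + D n \<omega>) - iexp (A n \<omega>) = iexp (A n \<omega>) * (iexp (D n \<omega>) - 1)"
        unfolding of_real_add distrib_left exp_add by (simp add: algebra_simps)
      then have eq: "cmod (iexp (A n \<omega> + D n \<omega>) - iexp (A n \<omega>)) = cmod (iexp (D n \<omega>) - 1)" by (simp add: norm_mult)
      have "cmod (iexp (D n \<omega>) - 1) \<le> \<bar>D n \<omega>\<bar>" using iexp_approx1[of "D n \<omega>" 0] by simp
      moreover have "cmod (iexp (D n \<omega>) - 1) \<le> 2" using norm_triangle_ineq4[of "iexp (D n \<omega>)" 1] by simp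
      ultimately show "cmod (iexp (A n \<omega> + D n \<omega>) - iexp (A n \<omega>)) \<le> e + 2 * indicator {\<omega>\<in>space M. e < \<bar>D n \<omega>\<bar>} \<omega>"
        unfolding eq using \<omega> e by (auto simp: indicator_def)
    qed
    also have "\<dots> = e + 2 * (\<integral>\<omega>. indicat_real {\<omega>\<in>space M. e < \<bar>D n \<omega>\<bar>} \<omega> \<partial>M)"
      using iI by (subst Bochner_Integration.integral_add) (auto simp: prob_space)
    also have "\<dots> = e + 2 * prob {\<omega>\<in>space M. e < \<bar>D n \<omega>\<bar>}" using SD by simp
    finally show ?thesis .
  qed
  have "(\<lambda>n. (\<integral>\<omega>. iexp (A n \<omega> + D n \<omega>) \<partial>M) - (\<integral>\<omega>. iexp (A n \<omega>) \<partial>M)) \<longlonglongrightarrow> 0"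
  proof (rule tendstoI)
    fix e :: real assume e: "e > 0"
    have "\<forall>\<^sub>F n in sequentially. prob {\<omega>\<in>space M. e / 2 < \<bar>D n \<omega>\<bar>} < e / 4" using e D by (intro vanishes_eventually) auto
    then show "\<forall>\<^sub>F n in sequentially. dist ((\<integral>\<omega>. iexp (A n \<omega> + D n \<omega>) \<partial>M) - (\<integral>\<omega>. iexp (A n \<omega>) \<partial>M)) 0 < e"
    proof eventually_elim
      case (elim n)
      have "cmod ((\<integral>\<omega>. iexp (A n \<omega> + D n \<omega>) \<partial>M) - (\<integral>\<omega>. iexp (A n \<omega>) \<partial>M)) < e" using bound[of "e / 2" n] e elim by linarith
      then show ?case by (simp add: dist_norm)
    qed
  qed
  from tendsto_add[OF this lim] show ?thesis by (simp only: diff_add_cancel add_0)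
qed

section \<open>Weak convergence, tightness and the delta method\<close>

lemma char_imp_weak_conv:
  assumes [measurable]: "\<And>n. Z n \<in> borel_measurable M" and \<mu>: "real_distribution \<mu>"
    and lim: "\<And>s. (\<lambda>n. \<integral>\<omega>. iexp (s * Z n \<omega>) \<partial>M) \<longlonglongrightarrow> char \<mu> s"
  shows "weak_conv_m (\<lambda>n. distr M borel (Z n)) \<mu>"
proof (rule levy_continuity[OF _ \<mu>])
  show "real_distribution (distr M borel (Z n))" for n by (rule real_distribution_distr) simp
  show "(\<lambda>n. char (distr M borel (Z n)) t) \<longlonglongrightarrow> char \<mu> t" for t
    unfolding char_def using lim[of t] by (subst integral_distr) (auto simp: char_def)
qed

text \<open>A wide cutoff has integral close to 1 under the limit law, hence eventually along the
  sequence. Since it vanishes beyond m + 1, the missing mass bounds the tail probability.\<close>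

lemma weak_conv_imp_tight:
  assumes Z [measurable]: "\<And>n. Z n \<in> borel_measurable M" and \<mu>: "real_distribution \<mu>"
    and wc: "weak_conv_m (\<lambda>n. distr M borel (Z n)) \<mu>"
  shows "tight_rvs Z"
  unfolding tight_rvs_def
proof (intro conjI allI impI Z)
  interpret \<mu>: real_distribution \<mu> by fact
  fix e :: real assume e: "e > 0"
  have "(\<lambda>m. 1 - (\<integral>x. tent (real m) x \<partial>\<mu>)) \<longlonglongrightarrow> 1 - 1" by (intro tendsto_intros \<mu>.tent_integral_lim)
  then have "\<forall>\<^sub>F m in sequentially. 1 - (\<integral>x. tent (real m) x \<partial>\<mu>) < e" using e by (auto dest!: order_tendstoD(2))
  then obtain m :: nat where m: "1 - (\<integral>x. tent (real m) x \<partial>\<mu>) < e" by (auto simp: eventually_sequentially)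
  have tm [measurable]: "tent (real m) \<in> borel_measurable borel" by (rule borel_measurable_continuous_onI[OF continuous_tent])
  have "(\<lambda>n. \<integral>x. tent (real m) x \<partial>distr M borel (Z n)) \<longlonglongrightarrow> (\<integral>x. tent (real m) x \<partial>\<mu>)"
  proof (rule weak_conv_imp_integral_bdd_continuous_conv[OF _ \<mu> wc])
    show "real_distribution (distr M borel (Z n))" for n by (rule real_distribution_distr) simp
    show "isCont (tent (real m)) x" for x using continuous_tent[of UNIV "real m"] by (simp add: continuous_on_eq_continuous_at)
    show "norm (tent (real m) x) \<le> 1" for x using tent_bounds[of "real m" x] by simp
  qed
  then have "(\<lambda>n. 1 - (\<integral>\<omega>. tent (real m) (Z n \<omega>) \<partial>M)) \<longlonglongrightarrow> 1 - (\<integral>x. tent (real m) x \<partial>\<mu>)"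
    by (intro tendsto_intros) (simp add: integral_distr)
  then have ev: "\<forall>\<^sub>F n in sequentially. 1 - (\<integral>\<omega>. tent (real m) (Z n \<omega>) \<partial>M) < e" using m by (rule order_tendstoD(2))
  have "prob {\<omega>\<in>space M. real m + 1 < \<bar>Z n \<omega>\<bar>} \<le> 1 - (\<integral>\<omega>. tent (real m) (Z n \<omega>) \<partial>M)" for n
  proof -
    have SZ: "{\<omega>\<in>space M. real m + 1 < \<bar>Z n \<omega>\<bar>} \<in> events" by measurable
    have i: "integrable M (\<lambda>\<omega>. tent (real m) (Z n \<omega>))"
      by (rule integrable_bounded[where B=1]) (use tent_bounds[of "real m"] in auto)
    have "prob {\<omega>\<in>space M. real m + 1 < \<bar>Z n \<omega>\<bar>} = (\<integral>\<omega>. indicator {\<omega>\<in>space M. real m + 1 < \<bar>Z n \<omega>\<bar>} \<omega> \<partial>M)" by simp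
    also have "\<dots> \<le> (\<integral>\<omega>. 1 - tent (real m) (Z n \<omega>) \<partial>M)"
    proof (rule integral_mono)
      show "indicat_real {\<omega>\<in>space M. real m + 1 < \<bar>Z n \<omega>\<bar>} \<omega> \<le> 1 - tent (real m) (Z n \<omega>)" for \<omega>
        using tent_bounds[of "real m" "Z n \<omega>"] tent_eq_0[of "real m" "Z n \<omega>"] by (auto simp: indicator_def)
      show "integrable M (indicat_real {\<omega>\<in>space M. real m + 1 < \<bar>Z n \<omega>\<bar>})"
        using SZ by (intro integrable_real_indicator) (simp_all add: emeasure_eq_measure)
    qed (use i in auto)
    also have "\<dots> = 1 - (\<integral>\<omega>. tent (real m) (Z n \<omega>) \<partial>M)" using i by (simp add: prob_space)
    finally show ?thesis .
  qed
  then have "\<forall>\<^sub>F n in sequentially. prob {\<omega>\<in>space M. real m + 1 < \<bar>Z n \<omega>\<bar>} < e"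
    using ev by (auto elim!: eventually_mono intro: le_less_trans)
  then show "\<exists>K>0. \<forall>\<^sub>F n in sequentially. prob {\<omega>\<in>space M. K < \<bar>Z n \<omega>\<bar>} < e"
    by (intro exI[of _ "real m + 1"]) auto
qed

text \<open>The remainder equals the error \<psi> of the difference quotient at \<open>V n\<close>,
  set to 0 at v, times the tight sequence. Differentiability is asked for at the single point v and
  mere measurability elsewhere, which suits an inverse function taking an arbitrary value off its
  natural domain.\<close>

lemma delta_method:
  fixes a :: "nat \<Rightarrow> real" and g :: "real \<Rightarrow> real"
  assumes V [measurable]: "\<And>n. V n \<in> borel_measurable M" and g [measurable]: "g \<in> borel_measurable borel"
    and a: "filterlim a at_top sequentially" and deriv: "(g has_real_derivative g') (at v)"
    and tight: "tight_rvs (\<lambda>n \<omega>. a n * (V n \<omega> - v))"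
  shows "vanishes (\<lambda>n \<omega>. a n * (g (V n \<omega>) - g v) - g' * (a n * (V n \<omega> - v)))"
proof -
  define \<psi> where "\<psi> y = (if y = v then 0 else (g y - g v) / (y - v) - g')" for y
  have [measurable]: "\<psi> \<in> borel_measurable borel" unfolding \<psi>_def by measurable
  have eq: "a n * (g y - g v) - g' * (a n * (y - v)) = \<psi> y * (a n * (y - v))" for n y
    by (cases "y = v") (simp_all add: \<psi>_def field_simps)
  have \<psi>0: "\<psi> \<midarrow>v\<rightarrow> 0"
  proof -
    have "((\<lambda>y. (g y - g v) / (y - v) - g') \<longlongrightarrow> g' - g') (at v)"
      using deriv unfolding has_field_derivative_iff by (intro tendsto_intros)
    then have "((\<lambda>y. (g y - g v) / (y - v) - g') \<longlongrightarrow> 0) (at v)" by simp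
    then show ?thesis
    proof (rule Lim_transform_eventually)
      show "\<forall>\<^sub>F y in at v. (g y - g v) / (y - v) - g' = \<psi> y"
        by (simp add: eventually_at_filter \<psi>_def)
    qed
  qed
  have "vanishes (\<lambda>n \<omega>. \<psi> (V n \<omega>))"
  proof (rule vanishesI_eventually)
    fix e r :: real assume e: "0 < e" and r: "0 < r"
    obtain d where d: "d > 0" "\<And>y. \<bar>y - v\<bar> < d \<Longrightarrow> \<bar>\<psi> y\<bar> < e"
    proof -
      obtain d where "d > 0" and d: "\<And>y. y \<noteq> v \<Longrightarrow> dist y v < d \<Longrightarrow> dist (\<psi> y) 0 < e"
        using tendstoD[OF \<psi>0 e] unfolding eventually_at by blast
      moreover have "\<bar>\<psi> y\<bar> < e" if "\<bar>y - v\<bar> < d" for y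
        using d[of y] that e by (cases "y = v") (auto simp: dist_real_def \<psi>_def)
      ultimately show ?thesis using that by blast
    qed
    \<comment> \<open>Once \<open>a n\<close> exceeds K / d, a deviation of \<open>V n\<close> from
      v by at least d makes the scaled deviation exceed K; thus tightness forces convergence of
      \<open>V n\<close> to v in probability.\<close>
    obtain K where K: "K > 0" "\<forall>\<^sub>F n in sequentially. prob {\<omega>\<in>space M. K < \<bar>a n * (V n \<omega> - v)\<bar>} < r"
      using tight r unfolding tight_rvs_def by meson
    have "\<forall>\<^sub>F n in sequentially. K / d < a n" using a by (simp add: filterlim_at_top_dense)
    with K(2) show "\<forall>\<^sub>F n in sequentially. prob {\<omega>\<in>space M. e < \<bar>\<psi> (V n \<omega>)\<bar>} < r"
    proof eventually_elim
      case (elim n)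
      have "prob {\<omega>\<in>space M. e < \<bar>\<psi> (V n \<omega>)\<bar>} \<le> prob {\<omega>\<in>space M. K < \<bar>a n * (V n \<omega> - v)\<bar>}"
      proof (intro finite_measure_mono subsetI)
        fix \<omega> assume *: "\<omega> \<in> {\<omega>\<in>space M. e < \<bar>\<psi> (V n \<omega>)\<bar>}"
        then have "d \<le> \<bar>V n \<omega> - v\<bar>" using d(2)[of "V n \<omega>"] by force
        moreover have a0: "0 < K / d" using K d by simp
        ultimately have "K / d * d < a n * \<bar>V n \<omega> - v\<bar>" using elim d
          by (intro mult_less_le_imp_less) auto
        moreover have "a n > 0" using a0 elim by linarith
        ultimately show "\<omega> \<in> {\<omega>\<in>space M. K < \<bar>a n * (V n \<omega> - v)\<bar>}" using * d by (simp add: abs_mult)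
      qed measurable
      with elim show ?case by simp
    qed
  qed measurable
  from tight_rvs_vanishes_mult[OF tight this] show ?thesis unfolding eq .
qed

end

section \<open>Bivariate normal laws with diagonal covariance\<close>

text \<open>Lebesgue measure on the plane is the image of the product measure indexed by the two
  basis vectors, so the product formula for integrals applies with one factor per basis
  vector.\<close>

lemma lborel_integral_vec2:
  fixes h k :: "real \<Rightarrow> real"
  assumes "integrable lborel h" "integrable lborel k"
  shows "integrable lborel (\<lambda>x :: real^2. h (x $ 1) * k (x $ 2))"
    and "(\<integral>x. h (x $ 1) * k (x $ 2) \<partial>(lborel :: (real^2) measure)) = (\<integral>x. h x \<partial>lborel) * (\<integral>x. k x \<partial>lborel)"
proof -
  interpret product_sigma_finite "\<lambda>_ :: real^2. lborel :: real measure" ..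
  let ?e1 = "axis 1 1 :: real^2" and ?e2 = "axis 2 1 :: real^2"
  have B: "(Basis :: (real^2) set) = {?e1, ?e2}"
    by (auto simp: Basis_vec_def UNIV_2)
  have ne: "?e1 \<noteq> ?e2" by (simp add: axis_eq_axis)
  define F where "F b = (if b = ?e1 then h else k)" for b :: "real^2"
  have iF: "integrable lborel (F b)" for b using assms by (simp add: F_def)
  have prodF: "(\<Prod>b\<in>Basis. F b (f b)) = h (f ?e1) * k (f ?e2)" for f using ne by (simp add: B F_def)
  have comp: "(\<Sum>b\<in>Basis. f b *\<^sub>R b) $ 1 = f ?e1" "(\<Sum>b\<in>Basis. f b *\<^sub>R b) $ 2 = f ?e2" for f :: "real^2 \<Rightarrow> real"
    using ne by (simp_all add: B axis_def)
  have m1: "(\<lambda>f. \<Sum>b\<in>Basis. f b *\<^sub>R b) \<in> measurable (PiM Basis (\<lambda>b :: real^2. lborel :: real measure)) borel"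
    by measurable
  have [measurable]: "h \<in> borel_measurable borel" "k \<in> borel_measurable borel"
    using borel_measurable_integrable[OF assms(1)] borel_measurable_integrable[OF assms(2)] by simp_all
  have m2: "(\<lambda>x :: real^2. h (x $ 1) * k (x $ 2)) \<in> borel_measurable borel" by measurable
  show "integrable lborel (\<lambda>x :: real^2. h (x $ 1) * k (x $ 2))"
    unfolding lborel_eq[where 'a="real^2"] integrable_distr_eq[OF m1 m2] comp
    using product_integrable_prod[of Basis F, OF finite_Basis iF] unfolding prodF .
  show "(\<integral>x. h (x $ 1) * k (x $ 2) \<partial>(lborel :: (real^2) measure)) = (\<integral>x. h x \<partial>lborel) * (\<integral>x. k x \<partial>lborel)"
    unfolding lborel_eq[where 'a="real^2"] integral_distr[OF m1 m2] comp
    using product_integral_prod[of Basis F, OF finite_Basis iF] ne unfolding prodF by (simp add: B F_def)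
qed

text \<open>With inverse and determinant explicit, the density factors into two one-dimensional
  normal densities with standard deviations \<open>sqrt a\<close> and \<open>sqrt b\<close>.\<close>

lemma mv_normal_law_diag:
  fixes a b :: real
  assumes a: "a > 0" and b: "b > 0"
  defines "L \<equiv> mv_normal_law (vector [vector [a, 0], vector [0, b]] :: real^2^2)"
  shows prob_space_mv_normal_law_diag: "prob_space L"
    and sets_mv_normal_law_diag: "sets L = sets borel"
    and integral_mv_normal_law_diag: "\<And>h k :: real \<Rightarrow> real. h \<in> borel_measurable borel \<Longrightarrow> k \<in> borel_measurable borel \<Longrightarrow>
      bounded (range h) \<Longrightarrow> bounded (range k) \<Longrightarrow>
      (\<integral>x. h (x $ 1) * k (x $ 2) \<partial>L) = (\<integral>x. h x \<partial>normal_law 0 a) * (\<integral>x. k x \<partial>normal_law 0 b)"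
proof -
  let ?S = "vector [vector [a, 0], vector [0, b]] :: real^2^2"
  let ?T = "vector [vector [1/a, 0], vector [0, 1/b]] :: real^2^2"
  let ?p = "normal_density 0 (sqrt a)" and ?q = "normal_density 0 (sqrt b)"
  have "?S ** ?T = mat 1" "?T ** ?S = mat 1"
    using a b by (auto simp: vec_eq_iff matrix_matrix_mult_def mat_def forall_2 sum_2)
  then have inv: "matrix_inv ?S = ?T"
  proof -
    assume *: "?S ** ?T = mat 1" "?T ** ?S = mat 1"
    \<comment> \<open>\<open>matrix_inv\<close> is a choice. The existence of \<open>?T\<close>
      makes the chosen matrix a two-sided inverse, and associativity then identifies it with
      \<open>?T\<close>.\<close>
    have "?S ** matrix_inv ?S = mat 1 \<and> matrix_inv ?S ** ?S = mat 1"
      unfolding matrix_inv_def by (rule someI[of _ ?T]) (use * in simp)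
    then have inv: "matrix_inv ?S ** ?S = mat 1" by simp
    have "matrix_inv ?S = matrix_inv ?S ** (?S ** ?T)" using * by simp
    also have "\<dots> = (matrix_inv ?S ** ?S) ** ?T" by (rule matrix_mul_assoc)
    finally show ?thesis unfolding inv by simp
  qed
  have det: "det ?S = a * b" by (simp add: det_2)
  have dens: "exp (- (x \<bullet> (matrix_inv ?S *v x)) / 2) / sqrt ((2 * pi) ^ CARD(2) * det ?S) = ?p (x $ 1) * ?q (x $ 2)" for x :: "real^2"
  proof -
    have "x \<bullet> (?T *v x) = (x $ 1)\<^sup>2 / a + (x $ 2)\<^sup>2 / b"
      by (simp add: inner_vec_def matrix_vector_mult_def sum_2 power2_eq_square)
    moreover have "sqrt ((2 * pi) ^ CARD(2) * (a * b)) = sqrt (2 * pi * a) * sqrt (2 * pi * b)"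
      by (simp add: real_sqrt_mult[symmetric] power2_eq_square mult_ac)
    moreover have "exp (- ((x $ 1)\<^sup>2 / a + (x $ 2)\<^sup>2 / b) / 2) = exp (- (x $ 1)\<^sup>2 / (2 * a)) * exp (- (x $ 2)\<^sup>2 / (2 * b))"
      by (simp add: exp_add[symmetric] field_simps)
    ultimately show ?thesis using a b unfolding inv det by (simp add: normal_density_def)
  qed
  have L: "L = density lborel (\<lambda>x :: real^2. ennreal (?p (x $ 1) * ?q (x $ 2)))"
    unfolding L_def mv_normal_law_def dens ..
  have int: "integrable lborel ?p" "integrable lborel ?q" using a b by auto
  have [measurable]: "(\<lambda>x :: real^2. ?p (x $ 1) * ?q (x $ 2)) \<in> borel_measurable borel" by measurable
  have "emeasure L (space L) = (\<integral>\<^sup>+x. ennreal (?p (x $ 1) * ?q (x $ 2)) \<partial>(lborel :: (real^2) measure))"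
    unfolding L by (simp add: emeasure_density)
  also have "\<dots> = ennreal (\<integral>x. ?p (x $ 1) * ?q (x $ 2) \<partial>(lborel :: (real^2) measure))"
    by (rule nn_integral_eq_integral[OF lborel_integral_vec2(1)[OF int]]) auto
  also have "\<dots> = 1" unfolding lborel_integral_vec2(2)[OF int] using a b by simp
  finally show "prob_space L" by (rule prob_spaceI)
  show "sets L = sets borel" unfolding L by simp
  fix h k :: "real \<Rightarrow> real"
  assume [measurable]: "h \<in> borel_measurable borel" "k \<in> borel_measurable borel" and bd: "bounded (range h)" "bounded (range k)"
  have ib: "integrable lborel (\<lambda>x. normal_density 0 s x * h x)" if s: "s > 0" and [measurable]: "h \<in> borel_measurable borel" and bdd: "bounded (range h)"
    for h :: "real \<Rightarrow> real" and s :: real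
  proof -
    obtain c where c: "\<And>x. \<bar>h x\<bar> \<le> c" using bdd unfolding bounded_iff by auto
    show ?thesis
    proof (rule Bochner_Integration.integrable_bound)
      show "integrable lborel (\<lambda>x. normal_density 0 s x * c)" using s by auto
      have "normal_density 0 s x * \<bar>h x\<bar> \<le> normal_density 0 s x * \<bar>c\<bar>" for x
        using c[of x] by (intro mult_left_mono) auto
      then show "AE x in lborel. norm (normal_density 0 s x * h x) \<le> norm (normal_density 0 s x * c)" by (simp add: abs_mult)
    qed simp
  qed
  have sa: "sqrt a > 0" and sb: "sqrt b > 0" using a b by auto
  have "(\<integral>x. h (x $ 1) * k (x $ 2) \<partial>L) = (\<integral>x. (?p (x $ 1) * ?q (x $ 2)) *\<^sub>R (h (x $ 1) * k (x $ 2)) \<partial>(lborel :: (real^2) measure))"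
    unfolding L by (rule integral_density) auto
  also have "\<dots> = (\<integral>x. (?p (x $ 1) * h (x $ 1)) * (?q (x $ 2) * k (x $ 2)) \<partial>(lborel :: (real^2) measure))"
    by (simp add: mult_ac)
  also have "\<dots> = (\<integral>x. ?p x * h x \<partial>lborel) * (\<integral>x. ?q x * k x \<partial>lborel)"
    by (rule lborel_integral_vec2(2)) (rule ib[OF sa _ bd(1)], simp, rule ib[OF sb _ bd(2)], simp)
  also have "(\<integral>x. ?p x * h x \<partial>lborel) = (\<integral>x. h x \<partial>normal_law 0 a)"
    using a by (simp add: normal_law_def integral_density)
  also have "(\<integral>x. ?q x * k x \<partial>lborel) = (\<integral>x. k x \<partial>normal_law 0 b)"
    using b by (simp add: normal_law_def integral_density)
  finally show "(\<integral>x. h (x $ 1) * k (x $ 2) \<partial>L) = (\<integral>x. h x \<partial>normal_law 0 a) * (\<integral>x. k x \<partial>normal_law 0 b)" .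
qed

section \<open>Inverting the second moment\<close>

text \<open>The total function \<open>inv_into\<close> is monotone on the range of f and constant
  off it, and the range is Borel as a countable union of compact images; hence measurability. The
  derivative is local: on a small interval around x the intermediate value theorem makes it a
  genuine inverse.\<close>

lemma strict_mono_inverse_properties:
  fixes f f' :: "real \<Rightarrow> real"
  assumes mono: "strict_mono_on {0<..<1} f"
    and deriv: "\<And>x. x \<in> {0<..<1} \<Longrightarrow> (f has_real_derivative f' x) (at x)"
  shows strict_mono_inverse_measurable: "inv_into {0<..<1} f \<in> borel_measurable borel"
    and strict_mono_inverse_deriv: "\<And>x. x \<in> {0<..<1} \<Longrightarrow> f' x \<noteq> 0 \<Longrightarrow>
      (inv_into {0<..<1} f has_real_derivative inverse (f' x)) (at (f x))"
proof -
  let ?g = "inv_into {0<..<1} f"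
  have inj: "inj_on f {0<..<1}" by (rule strict_mono_on_imp_inj_on[OF mono])
  have gf: "?g (f x) = x" if "x \<in> {0<..<1}" for x by (rule inv_into_f_f[OF inj that])
  have cont: "isCont f x" if "x \<in> {0<..<1}" for x using DERIV_isCont[OF deriv[OF that]] .
  show "?g \<in> borel_measurable borel"
  proof -
    let ?J = "f ` {0<..<1}"
    \<comment> \<open>Exhaustion of the open interval by compact ones, whose continuous images are
      closed; the 2 in the denominators makes the interval for n = 0 the point 1/2.\<close>
    have "{0<..<1::real} = (\<Union>n. {1 / (real n + 2)..1 - 1 / (real n + 2)})"
    proof (intro equalityI subsetI)
      fix x :: real assume x: "x \<in> {0<..<1}"
      define m where "m = min x (1 - x)"
      have m: "0 < m" "m \<le> x" "m \<le> 1 - x" using x by (auto simp: m_def)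
      obtain n where n: "1 / m < real n" using reals_Archimedean2 by blast
      have "1 < real n * m" using n m by (simp add: pos_divide_less_eq)
      also have "\<dots> \<le> m * (real n + 2)" using m by (simp add: algebra_simps)
      finally have "1 / (real n + 2) < m" by (simp add: pos_divide_less_eq)
      then show "x \<in> (\<Union>n. {1 / (real n + 2)..1 - 1 / (real n + 2)})" using m by (intro UN_I[of n]) auto
    next
      fix x :: real assume "x \<in> (\<Union>n. {1 / (real n + 2)..1 - 1 / (real n + 2)})"
      then obtain n where "1 / (real n + 2) \<le> x" "x \<le> 1 - 1 / (real n + 2)" by auto
      moreover have "0 < 1 / (real n + 2)" by simp
      ultimately show "x \<in> {0<..<1}" unfolding greaterThanLessThan_iff by linarith
    qed
    then have J: "?J = (\<Union>n. f ` {1 / (real n + 2)..1 - 1 / (real n + 2)})" by (simp only: image_UN)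
    have sub: "{1 / (real n + 2)..1 - 1 / (real n + 2)} \<subseteq> {0<..<1}" for n
    proof
      fix x assume "x \<in> {1 / (real n + 2)..1 - 1 / (real n + 2)}"
      moreover have "0 < 1 / (real n + 2)" by simp
      ultimately show "x \<in> {0<..<1}" unfolding greaterThanLessThan_iff atLeastAtMost_iff by linarith
    qed
    have "closed (f ` {1 / (real n + 2)..1 - 1 / (real n + 2)})" for n
    proof (rule compact_imp_closed, rule compact_continuous_image)
      show "continuous_on {1 / (real n + 2)..1 - 1 / (real n + 2)} f"
        by (rule continuous_at_imp_continuous_on) (use cont sub in blast)
    qed simp
    then have "f ` {1 / (real n + 2)..1 - 1 / (real n + 2)} \<in> sets borel" for n by (rule borel_closed)
    then have Jb: "?J \<in> sets borel" unfolding J by (intro sets.countable_UN) auto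
    have "mono_on ?J ?g"
    proof (rule mono_onI)
      fix r s assume "r \<in> ?J" "s \<in> ?J" and rs: "r \<le> s"
      then obtain x y where x: "x \<in> {0<..<1}" "r = f x" and y: "y \<in> {0<..<1}" "s = f y" by auto
      have "x \<le> y"
      proof (rule ccontr)
        assume "\<not> x \<le> y"
        then have "f y < f x" using strict_mono_onD[OF mono y(1) x(1)] by simp
        with rs x y show False by simp
      qed
      then show "?g r \<le> ?g s" using gf x y by simp
    qed
    then have 1: "?g \<in> borel_measurable (restrict_space borel ?J)" by (rule borel_measurable_mono_on_fnc)
    \<comment> \<open>Off the range the choice is made from an empty predicate, so its value does
      not depend on y.\<close>
    obtain c where c: "?g y = c" if "y \<notin> ?J" for y
    proof -
      have "?g y = (SOME x. False)" if "y \<notin> ?J" for y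
      proof -
        have "(\<lambda>x. x \<in> {0<..<1} \<and> f x = y) = (\<lambda>x. False)" using that by auto
        then show ?thesis unfolding inv_into_def by simp
      qed
      then show ?thesis using that by blast
    qed
    have "(\<lambda>y. if y \<in> ?J then ?g y else c) \<in> borel_measurable borel"
      using 1 Jb by (subst measurable_If_restrict_space_iff) (auto simp: space_restrict_space)
    moreover have "(\<lambda>y. if y \<in> ?J then ?g y else c) = ?g" using c by (auto simp: fun_eq_iff)
    ultimately show ?thesis by simp
  qed
  fix x :: real assume x: "x \<in> {0<..<1}" and nz: "f' x \<noteq> 0"
  define a where "a = x / 2"
  define b where "b = (x + 1) / 2"
  have ab: "0 < a" "a < x" "x < b" "b < 1" using x by (auto simp: a_def b_def)
  have sub: "z \<in> {0<..<1}" if "a \<le> z" "z \<le> b" for z using that ab by auto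
  show "(?g has_real_derivative inverse (f' x)) (at (f x))"
  proof (rule DERIV_inverse_function[where f = f and a = "f a" and b = "f b"])
    show "(f has_real_derivative f' x) (at (?g (f x)))" using deriv[OF x] gf[OF x] by simp
    show "f a < f x" "f x < f b" using strict_mono_onD[OF mono] ab sub[of a] sub[of b] x by auto
    show "f (?g y) = y" if y: "f a < y" "y < f b" for y
    proof -
      have "\<exists>z. a \<le> z \<and> z \<le> b \<and> f z = y" using y ab cont sub by (intro IVT) auto
      then show ?thesis using sub gf by auto
    qed
    show "isCont ?g (f x)"
      by (rule isCont_inverse_function2[of a x b]) (use ab gf sub cont in auto)
  qed (rule nz)
qed

section \<open>Differentiability of the second moment\<close>

lemma summable_bounded_power:
  fixes c :: "nat \<Rightarrow> real"
  assumes "\<And>n. \<bar>c n\<bar> \<le> K" "\<bar>x\<bar> < 1"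
  shows "summable (\<lambda>n. c n * x ^ n)"
proof (rule summable_comparison_test)
  show "summable (\<lambda>n. K * \<bar>x\<bar> ^ n)" using assms by (intro summable_mult summable_geometric) auto
  show "\<exists>N. \<forall>n\<ge>N. norm (c n * x ^ n) \<le> K * \<bar>x\<bar> ^ n"
    using assms by (auto simp: abs_mult power_abs intro!: mult_right_mono)
qed

context second_order_noise begin

lemma R_le: "\<bar>R k\<bar> \<le> R 0"
proof -
  have "\<bar>R k\<bar> \<le> (\<integral>\<omega>. \<bar>\<xi> k \<omega> * \<xi> 0 \<omega>\<bar> \<partial>M)"
    using noise_cov[of k 0] integral_abs_bound[of M "\<lambda>\<omega>. \<xi> k \<omega> * \<xi> 0 \<omega>"] by simp
  also have "\<dots> \<le> (\<integral>\<omega>. ((\<xi> k \<omega>)\<^sup>2 + (\<xi> 0 \<omega>)\<^sup>2) / 2 \<partial>M)"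
    by (intro integral_mono abs_mult_le_squares) (auto simp: noise_square_integrable)
  also have "\<dots> = R 0" by (simp add: noise_square noise_square_integrable)
  finally show ?thesis .
qed

text \<open>The coefficients of the power series in the closed form are covariances, bounded by
  \<open>R 0\<close>, so it may be differentiated termwise inside the unit interval, and the
  denominator has no zero there.\<close>

lemma second_moment_differentiable:
  assumes x: "x \<in> {0<..<1}"
  shows "(second_moment M \<xi> has_real_derivative deriv (second_moment M \<xi>) x) (at x)"
proof -
  define c where "c i = R (int i + 1)" for i
  let ?h = "\<lambda>x. (R 0 + 2 * x * (\<Sum>i. c i * x ^ i)) / (1 - x\<^sup>2)"
  have S: "((\<lambda>x. \<Sum>i. c i * x ^ i) has_real_derivative (\<Sum>i. diffs c i * x ^ i)) (at x)"
  proof (rule termdiffs_strong'[where K = 1])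
    show "summable (\<lambda>n. c n * z ^ n)" if "norm z < 1" for z
      using that R_le unfolding c_def by (intro summable_bounded_power[where K = "R 0"]) auto
  qed (use x in auto)
  have nz: "1 - x\<^sup>2 \<noteq> 0" using x by (simp add: power2_eq_1_iff)
  have lin: "((\<lambda>x. 2 * x) has_real_derivative 2) (at x)" by (auto intro!: derivative_eq_intros)
  have den: "((\<lambda>x. 1 - x\<^sup>2) has_real_derivative (- 2 * x)) (at x)" by (auto intro!: derivative_eq_intros)
  obtain D where "(?h has_real_derivative D) (at x)"
    using DERIV_divide[OF DERIV_add[OF DERIV_const DERIV_mult[OF lin S]] den nz, of "R 0"] by blast
  then have "(second_moment M \<xi> has_real_derivative D) (at x)"
  proof (rule DERIV_cong_ev[THEN iffD1, rotated -1])
    show "\<forall>\<^sub>F z in nhds x. ?h z = second_moment M \<xi> z"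
      using eventually_nhds_in_open[OF open_greaterThanLessThan x]
      by eventually_elim (simp add: second_moment_formula c_def)
  qed simp_all
  then show ?thesis using DERIV_imp_deriv by metis
qed

end

section \<open>Long-memory Gaussian noise\<close>

lemma integral_normal_law: "0 \<le> v \<Longrightarrow> (\<integral>x. x \<partial>normal_law m v) = m"
proof (cases "v = 0")
  case True
  then show ?thesis by (simp add: normal_law_def integral_return)
next
  case False
  assume "0 \<le> v"
  with False have "sqrt v > 0" by simp
  then have "(\<integral>x. normal_density m (sqrt v) x * x \<partial>lborel) = m"
    using normal_moment_nz_1[of "sqrt v" m] by (simp add: has_bochner_integral_iff)
  then show ?thesis using False by (simp add: normal_law_def integral_density)
qed

lemma gaussian_rv_centered:
  assumes Z: "gaussian_rv M Z" and mean: "(\<integral>\<omega>. Z \<omega> \<partial>M) = 0"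
  obtains v where "0 \<le> v" "distr M borel Z = normal_law 0 v"
proof -
  from Z obtain m v where [measurable]: "Z \<in> borel_measurable M" and v: "0 \<le> v" "distr M borel Z = normal_law m v"
    unfolding gaussian_rv_def by blast
  have "(\<integral>x. x \<partial>distr M borel Z) = (\<integral>\<omega>. Z \<omega> \<partial>M)" by (subst integral_distr) auto
  then have "m = 0" using mean integral_normal_law[OF v(1)] v(2) by simp
  with v show ?thesis using that by blast
qed

lemma centered_normal_integrable_power:
  assumes [measurable]: "Z \<in> borel_measurable M" and "0 \<le> v" "distr M borel Z = normal_law 0 v"
  shows "integrable M (\<lambda>\<omega>. Z \<omega> ^ k)"
  using integrable_normal_law_power[OF assms(2), of k] unfolding assms(3)[symmetric]
  by (subst (asm) integrable_distr_eq) auto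

lemma centered_normal_square:
  assumes [measurable]: "Z \<in> borel_measurable M" and "0 \<le> v" "distr M borel Z = normal_law 0 v"
  shows "(\<integral>\<omega>. (Z \<omega>)\<^sup>2 \<partial>M) = v"
  using integral_normal_law_square[OF assms(2)] unfolding assms(3)[symmetric]
  by (subst (asm) integral_distr) auto

locale long_memory_noise = prob_space M for M :: "'a measure" +
  fixes \<xi> :: "int \<Rightarrow> 'a \<Rightarrow> real" and H C :: real
  assumes H: "1 / 2 < H" "H < 3 / 4" and C: "0 < C"
    and gaussian: "gaussian_seq M \<xi>" and stationary: "stationary_seq M \<xi>"
    and zero_mean: "\<And>t. (\<integral>\<omega>. \<xi> t \<omega> \<partial>M) = 0"
    and long_memory: "autocov M \<xi> \<sim>[at_top] (\<lambda>k. C * \<bar>real_of_int k\<bar> powr (2 * H - 2))"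
begin

lemma \<xi>_measurable [measurable]: "\<xi> t \<in> borel_measurable M"
  using gaussian[unfolded gaussian_seq_def, rule_format, of "{t}" "\<lambda>_. 1"] by (simp add: gaussian_rv_def)

lemma \<xi>_power_integrable: "integrable M (\<lambda>\<omega>. \<xi> t \<omega> ^ k)"
proof -
  have "gaussian_rv M (\<xi> t)"
    using gaussian[unfolded gaussian_seq_def, rule_format, of "{t}" "\<lambda>_. 1"] by simp
  from gaussian_rv_centered[OF this zero_mean] obtain v where "0 \<le> v" "distr M borel (\<xi> t) = normal_law 0 v" by blast
  then show ?thesis by (rule centered_normal_integrable_power[OF \<xi>_measurable])
qed

text \<open>Stationarity concerns the law of the whole sequence; the product of two coordinates is a
  measurable functional of it.\<close>

lemma autocov_stationary: "(\<integral>\<omega>. \<xi> (s + h) \<omega> * \<xi> (t + h) \<omega> \<partial>M) = (\<integral>\<omega>. \<xi> s \<omega> * \<xi> t \<omega> \<partial>M)"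
proof -
  let ?P = "\<Pi>\<^sub>M t\<in>(UNIV :: int set). (borel :: real measure)"
  have m: "(\<lambda>\<omega> t. \<xi> (t + h) \<omega>) \<in> measurable M ?P" for h
    by (rule measurable_PiM_single') (auto simp: space_PiM)
  have F: "(\<lambda>x. x s * x t) \<in> borel_measurable ?P" by measurable
  have "(\<integral>x. x s * x t \<partial>distr M ?P (\<lambda>\<omega> t. \<xi> (t + h) \<omega>)) = (\<integral>x. x s * x t \<partial>distr M ?P (\<lambda>\<omega> t. \<xi> t \<omega>))"
    using stationary unfolding stationary_seq_def by simp
  then show ?thesis
    using integral_distr[OF m[of h] F] integral_distr[OF m[of 0] F] by simp
qed

sublocale second_order_noise M \<xi> "autocov M \<xi>"
proof
  show "(\<integral>\<omega>. \<xi> s \<omega> * \<xi> t \<omega> \<partial>M) = autocov M \<xi> (s - t)" for s t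
    using autocov_stationary[of "s - t" t 0] unfolding autocov_def by (simp add: mult.commute)
qed (use \<xi>_power_integrable in auto)

abbreviation R where "R \<equiv> autocov M \<xi>"

text \<open>The linear span of the noise variables. \<open>gaussian_seq\<close> speaks of exactly
  these variables, so Gaussianity of sums of moving averages reduces to closure under linear
  operations.\<close>

definition noise_span :: "('a \<Rightarrow> real) \<Rightarrow> bool" where
  "noise_span Z \<longleftrightarrow> (\<exists>J c. finite J \<and> Z = (\<lambda>\<omega>. \<Sum>t\<in>J. c t * \<xi> t \<omega>))"

lemma noise_span_single: "noise_span (\<lambda>\<omega>. b * \<xi> t \<omega>)"
  unfolding noise_span_def by (intro exI[of _ "{t}"] exI[of _ "\<lambda>_. b"]) simp

lemma noise_span_zero: "noise_span (\<lambda>\<omega>. 0)"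
  unfolding noise_span_def by (intro exI[of _ "{}"]) simp

lemma noise_span_scale: "noise_span Z \<Longrightarrow> noise_span (\<lambda>\<omega>. b * Z \<omega>)"
proof -
  assume "noise_span Z"
  then obtain J c where "finite J" "Z = (\<lambda>\<omega>. \<Sum>t\<in>J. c t * \<xi> t \<omega>)" unfolding noise_span_def by blast
  then show ?thesis unfolding noise_span_def
    by (intro exI[of _ J] exI[of _ "\<lambda>t. b * c t"]) (simp add: sum_distrib_left mult.assoc)
qed

lemma noise_span_add:
  assumes "noise_span Y" "noise_span Z" shows "noise_span (\<lambda>\<omega>. Y \<omega> + Z \<omega>)"
proof -
  obtain J c where Y: "finite J" "Y = (\<lambda>\<omega>. \<Sum>t\<in>J. c t * \<xi> t \<omega>)" using assms(1) unfolding noise_span_def by blast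
  obtain K d where Z: "finite K" "Z = (\<lambda>\<omega>. \<Sum>t\<in>K. d t * \<xi> t \<omega>)" using assms(2) unfolding noise_span_def by blast
  have ext: "(\<Sum>t\<in>J. c t * x t) = (\<Sum>t\<in>J\<union>K. (if t \<in> J then c t else 0) * x t)" if "finite J" "finite K" for J K c and x :: "int \<Rightarrow> real"
    using that by (intro sum.mono_neutral_cong_left) auto
  have "Y \<omega> + Z \<omega> = (\<Sum>t\<in>J\<union>K. ((if t \<in> J then c t else 0) + (if t \<in> K then d t else 0)) * \<xi> t \<omega>)" for \<omega>
    unfolding Y(2) Z(2) ext[OF Y(1) Z(1)] ext[OF Z(1) Y(1)] Un_commute[of K J] sum.distrib[symmetric] distrib_right ..
  then show ?thesis unfolding noise_span_def using Y(1) Z(1)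
    by (intro exI[of _ "J \<union> K"] exI[of _ "\<lambda>t. (if t \<in> J then c t else 0) + (if t \<in> K then d t else 0)"]) auto
qed

lemma noise_span_sum: "finite I \<Longrightarrow> (\<And>i. i \<in> I \<Longrightarrow> noise_span (Z i)) \<Longrightarrow> noise_span (\<lambda>\<omega>. \<Sum>i\<in>I. Z i \<omega>)"
  by (induction I rule: finite_induct) (auto intro: noise_span_zero noise_span_add)

lemma noise_span_normal:
  assumes "noise_span Z"
  shows "distr M borel Z = normal_law 0 (\<integral>\<omega>. (Z \<omega>)\<^sup>2 \<partial>M)"
proof -
  obtain J c where J: "finite J" and Z: "Z = (\<lambda>\<omega>. \<Sum>t\<in>J. c t * \<xi> t \<omega>)" using assms unfolding noise_span_def by blast
  have g: "gaussian_rv M Z" using gaussian J unfolding Z gaussian_seq_def by blast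
  then have [measurable]: "Z \<in> borel_measurable M" by (simp add: gaussian_rv_def)
  have "integrable M (\<xi> t)" for t using \<xi>_power_integrable[of t 1] by simp
  then have "(\<integral>\<omega>. Z \<omega> \<partial>M) = 0" unfolding Z by (simp add: zero_mean)
  from gaussian_rv_centered[OF g this] obtain v where v: "0 \<le> v" "distr M borel Z = normal_law 0 v" by blast
  then show ?thesis using centered_normal_square[OF _ v] by simp
qed

lemma noise_span_trunc_ma: "noise_span (trunc_ma x n t)"
  unfolding trunc_ma_def[abs_def] by (intro noise_span_sum noise_span_single) simp

text \<open>Asymptotic equivalence counts a quotient of two zeros as 1. Since C > 0, the comparison
  function is nonzero at every positive lag, so eventually the plain quotient remains.\<close>

lemma autocov_lim: "(\<lambda>n. R (int n) / real n powr (2 * H - 2)) \<longlonglongrightarrow> C"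
proof -
  let ?g = "\<lambda>k. C * \<bar>real_of_int k\<bar> powr (2 * H - 2)"
  have "((\<lambda>k. if R k = 0 \<and> ?g k = 0 then 1 else R k / ?g k) \<longlongrightarrow> 1) at_top"
    using long_memory unfolding asymp_equiv_def .
  from filterlim_compose[OF this filterlim_int_sequentially]
  have "(\<lambda>n. C * (if R (int n) = 0 \<and> ?g (int n) = 0 then 1 else R (int n) / ?g (int n))) \<longlonglongrightarrow> C * 1"
    by (intro tendsto_intros)
  then have "(\<lambda>n. C * (if R (int n) = 0 \<and> ?g (int n) = 0 then 1 else R (int n) / ?g (int n))) \<longlonglongrightarrow> C" by simp
  then show ?thesis
  proof (rule Lim_transform_eventually)
    show "\<forall>\<^sub>F n in sequentially. C * (if R (int n) = 0 \<and> ?g (int n) = 0 then 1 else R (int n) / ?g (int n)) = R (int n) / real n powr (2 * H - 2)"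
      using eventually_gt_at_top[of 0] by eventually_elim (use C in auto)
  qed
qed

text \<open>The quotient by the majorant converges along nonnegative lags, and a convergent sequence
  is bounded from its first term on; negative lags follow by symmetry.\<close>

lemma autocov_decay: obtains K where "\<And>k. \<bar>R k\<bar> \<le> K * decay (2 - 2 * H) k"
proof -
  have "(\<lambda>n. real n powr (2 * H - 2) / decay (2 - 2 * H) (int n)) \<longlonglongrightarrow> 1"
    unfolding decay_def of_int_of_nat_eq abs_of_nat using H by real_asymp
  from tendsto_mult[OF autocov_lim this]
  have "(\<lambda>n. R (int n) / decay (2 - 2 * H) (int n)) \<longlonglongrightarrow> C"
    by (simp add: Lim_transform_eventually) (rule Lim_transform_eventually, assumption, use eventually_gt_at_top[of 0] in \<open>eventually_elim, simp\<close>)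
  then have "Bseq (\<lambda>n. R (int n) / decay (2 - 2 * H) (int n))" by (rule convergentI[THEN convergent_imp_Bseq])
  then obtain K where K: "\<And>n. \<bar>R (int n) / decay (2 - 2 * H) (int n)\<bar> \<le> K" unfolding Bseq_def by auto
  have n: "\<bar>R (int n)\<bar> \<le> K * decay (2 - 2 * H) (int n)" for n
    using K[of n] decay_pos[of "2 - 2 * H" "int n"] by (simp add: abs_divide pos_divide_le_eq)
  have "\<bar>R k\<bar> \<le> K * decay (2 - 2 * H) k" for k
    using n[of "nat \<bar>k\<bar>"] R_sym[of k] decay_minus[of "2 - 2 * H" k] by (cases "k \<ge> 0") auto
  then show ?thesis using that by blast
qed

section \<open>Variance growth of the noise sums\<close>

definition noise_sum_var :: "nat \<Rightarrow> real" where
  "noise_sum_var n = (\<integral>\<omega>. (\<Sum>t=1..n. \<xi> (int t) \<omega>)\<^sup>2 \<partial>M)"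

text \<open>The increments of the variance are twice a partial sum of covariances minus
  \<open>R 0\<close>, so two summations of power asymptotics suffice. They divide 2 C by 2H - 1 and
  then by 2H.\<close>

lemma noise_sum_var_lim: "(\<lambda>n. noise_sum_var n / real n powr (2 * H)) \<longlonglongrightarrow> C / (H * (2 * H - 1))"
proof -
  have eq: "noise_sum_var n = (\<Sum>s=1..n. \<Sum>t=1..n. R (int s - int t))" for n
    unfolding noise_sum_var_def power2_eq_square sum_product by (simp add: noise_cov)
  have step: "noise_sum_var (Suc n) - noise_sum_var n = 2 * (\<Sum>k<Suc n. R (int k)) - R 0" for n
  proof -
    have a: "(\<Sum>t=1..n. R (int (Suc n) - int t)) = (\<Sum>k=1..n. R (int k))"
      by (rule sum.reindex_bij_witness[of _ "\<lambda>k. Suc n - k" "\<lambda>t. Suc n - t"]) (auto simp: of_nat_diff)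
    have b: "(\<Sum>s=1..n. R (int s - int (Suc n))) = (\<Sum>k=1..n. R (int k))"
      unfolding a[symmetric] by (intro sum.cong refl) (metis R_sym minus_diff_eq)
    have c: "(\<Sum>k<Suc n. R (int k)) = R 0 + (\<Sum>k=1..n. R (int k))"
      by (simp add: sum.lessThan_Suc_shift sum.atLeast1_atMost_eq del: sum.lessThan_Suc)
    have "noise_sum_var (Suc n) = (\<Sum>s=1..n. \<Sum>t=1..n. R (int s - int t)) + (\<Sum>s=1..n. R (int s - int (Suc n))) + (\<Sum>t=1..n. R (int (Suc n) - int t)) + R 0"
      unfolding eq by (simp add: sum.distrib)
    then show ?thesis unfolding a b c eq[of n] by simp
  qed
  have p: "(\<lambda>n. (\<Sum>k<n. R (int k)) / real n powr (2 * H - 1)) \<longlonglongrightarrow> C / (2 * H - 1)"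
    using sum_powr_asymp[OF _ autocov_lim] H by simp
  have "(\<lambda>n. (2 * (\<Sum>k<Suc n. R (int k)) - R 0) / real n powr (2 * H - 1)) \<longlonglongrightarrow> 2 * (C / (2 * H - 1) * 1) - 0"
  proof -
    have "(\<lambda>n. (\<Sum>k<Suc n. R (int k)) / real (Suc n) powr (2 * H - 1)) \<longlonglongrightarrow> C / (2 * H - 1)" by (rule LIMSEQ_Suc[OF p])
    moreover have "(\<lambda>n. real (Suc n) powr (2 * H - 1) / real n powr (2 * H - 1)) \<longlonglongrightarrow> 1" using H by real_asymp
    moreover have "(\<lambda>n. R 0 / real n powr (2 * H - 1)) \<longlonglongrightarrow> 0"
    proof -
      have "(\<lambda>n. 1 / real n powr (2 * H - 1)) \<longlonglongrightarrow> 0" using H by real_asymp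
      from tendsto_mult_right_zero[OF this, of "R 0"] show ?thesis by simp
    qed
    ultimately have "(\<lambda>n. 2 * ((\<Sum>k<Suc n. R (int k)) / real (Suc n) powr (2 * H - 1) * (real (Suc n) powr (2 * H - 1) / real n powr (2 * H - 1))) - R 0 / real n powr (2 * H - 1)) \<longlonglongrightarrow> 2 * (C / (2 * H - 1) * 1) - 0"
      by (intro tendsto_diff tendsto_mult_left tendsto_mult)
    then show ?thesis
      by (rule Lim_transform_eventually) (use eventually_gt_at_top[of 0] in \<open>eventually_elim, simp add: diff_divide_distrib\<close>)
  qed
  then have "(\<lambda>n. (noise_sum_var (Suc n) - noise_sum_var n) / real n powr (2 * H - 1)) \<longlonglongrightarrow> 2 * C / (2 * H - 1)"
    unfolding step by simp
  from sum_powr_asymp[OF _ this] H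
  have "(\<lambda>n. (\<Sum>k<n. noise_sum_var (Suc k) - noise_sum_var k) / real n powr (2 * H)) \<longlonglongrightarrow> 2 * C / (2 * H - 1) / (2 * H)" by simp
  moreover have "(\<Sum>k<n. noise_sum_var (Suc k) - noise_sum_var k) = noise_sum_var n" for n
    unfolding sum_lessThan_telescope by (simp add: eq)
  ultimately show ?thesis by (simp add: mult.commute)
qed

end

context prob_space begin

lemma vanishes_cong:
  assumes D: "vanishes D" and [measurable]: "\<And>n. E n \<in> borel_measurable M"
    and eq: "\<forall>\<^sub>F n in sequentially. \<forall>\<omega>\<in>space M. E n \<omega> = D n \<omega>"
  shows "vanishes E"
proof (rule vanishesI_eventually)
  fix e r :: real assume "0 < e" "0 < r"
  from vanishes_eventually[OF D this] eq show "\<forall>\<^sub>F n in sequentially. prob {\<omega>\<in>space M. e < \<bar>E n \<omega>\<bar>} < r"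
  proof eventually_elim
    case (elim n)
    have "{\<omega>\<in>space M. e < \<bar>E n \<omega>\<bar>} = {\<omega>\<in>space M. e < \<bar>D n \<omega>\<bar>}" using elim(2) by auto
    then show ?case using elim(1) by simp
  qed
qed simp

lemma vanishes_const: "c \<longlonglongrightarrow> 0 \<Longrightarrow> vanishes (\<lambda>n \<omega>. c n)"
  by (rule vanishes_L1) (simp_all add: prob_space tendsto_rabs_zero)

lemma vanishes_scale:
  assumes "vanishes D" shows "vanishes (\<lambda>n \<omega>. c * D n \<omega>)"
proof -
  have "tight_rvs (\<lambda>n \<omega>. c)" by (rule tight_rvs_L1[where B = "\<bar>c\<bar>"]) (simp_all add: prob_space)
  from tight_rvs_vanishes_mult[OF this assms] show ?thesis by (simp add: mult.commute)
qed

end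

section \<open>Asymptotics of the estimators\<close>

lemma sum_square_deviation:
  fixes x :: "nat \<Rightarrow> real"
  assumes n: "n > 0" and m: "m = (1 / real n) * (\<Sum>a=1..n. x a)"
  shows "(1 / real n) * (\<Sum>a=1..n. (x a - m)\<^sup>2) = (1 / real n) * (\<Sum>a=1..n. (x a)\<^sup>2) - m\<^sup>2"
proof -
  have s: "(\<Sum>a=1..n. x a) = real n * m" using n m by simp
  have "(\<Sum>a=1..n. (x a - m)\<^sup>2) = (\<Sum>a=1..n. (x a)\<^sup>2) - 2 * m * (\<Sum>a=1..n. x a) + real n * m\<^sup>2"
    by (simp add: power2_diff sum.distrib sum_subtractf sum_distrib_left mult_ac)
  also have "\<dots> = (\<Sum>a=1..n. (x a)\<^sup>2) - real n * m\<^sup>2" unfolding s by (simp add: power2_eq_square)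
  finally show ?thesis using n by (simp add: right_diff_distrib)
qed

locale long_memory_ar = long_memory_noise M \<xi> H C for M :: "'a measure" and \<xi> H C +
  fixes X :: "nat \<Rightarrow> 'a \<Rightarrow> real" and \<alpha> \<theta> :: real
  assumes \<theta>: "0 < \<theta>" "\<theta> < 1"
    and X_0: "\<And>\<omega>. \<omega> \<in> space M \<Longrightarrow> X 0 \<omega> = 0"
    and X_Suc: "\<And>t \<omega>. \<omega> \<in> space M \<Longrightarrow> X (Suc t) \<omega> = \<alpha> + \<theta> * X t \<omega> + \<xi> (int (Suc t)) \<omega>"
    and f_pos: "\<And>x. x \<in> {0<..<1} \<Longrightarrow> 0 < second_moment M \<xi> x"
    and f_mono: "strict_mono_on {0<..<1} (second_moment M \<xi>)"
    and f_deriv: "deriv (second_moment M \<xi>) \<theta> \<noteq> 0"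
begin

abbreviation W where "W a \<equiv> trunc_ma \<theta> a (int a)"
abbreviation G where "G \<equiv> start_cov \<theta>"
abbreviation f where "f \<equiv> second_moment M \<xi>"

text \<open>The fixed point of the recursion without noise, around which X settles.\<close>

definition \<mu> where "\<mu> = \<alpha> / (1 - \<theta>)"
definition \<tau> where "\<tau> = (\<Sum>\<^sub>\<infinity>k\<in>UNIV. (autocov M (ar_stat \<xi> \<theta>) k)\<^sup>2)"
text \<open>The limit variance of the linear form as it arises from double summation of the
  covariances; it is identified with the Beta-function expression at the end.\<close>

definition lin_var where "lin_var = C / (H * (2 * H - 1))"

lemma \<theta>0: "0 \<le> \<theta>" using \<theta> by simp

lemma G_eq: "G a b = (\<integral>\<omega>. W a \<omega> * W b \<omega> \<partial>M)"
  by (rule start_cov_def[OF \<theta>0 \<theta>(2)])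

lemma W_Suc: "W (Suc n) \<omega> = \<theta> * W n \<omega> + \<xi> (int (Suc n)) \<omega>"
  unfolding trunc_ma_def sum.lessThan_Suc_shift by (simp add: sum_distrib_left mult.assoc)

text \<open>Both sides satisfy the same recursion from 0. The identity is pointwise and exact, so
  the start at 0 costs only a geometric term.\<close>

lemma X_eq: "\<omega> \<in> space M \<Longrightarrow> X n \<omega> = W n \<omega> + \<mu> * (1 - \<theta> ^ n)"
proof (induction n)
  case 0
  then show ?case by (simp add: X_0 trunc_ma_def)
next
  case (Suc n)
  have a: "\<mu> * (1 - \<theta>) = \<alpha>" using \<theta> by (simp add: \<mu>_def)
  have "X (Suc n) \<omega> = \<alpha> + \<theta> * (W n \<omega> + \<mu> * (1 - \<theta> ^ n)) + \<xi> (int (Suc n)) \<omega>"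
    using X_Suc[OF Suc.prems, of n] Suc.IH[OF Suc.prems] by simp
  also have "\<dots> = W (Suc n) \<omega> + (\<mu> * (1 - \<theta>) + \<theta> * (\<mu> * (1 - \<theta> ^ n)))"
    unfolding a W_Suc by (simp only: distrib_left ac_simps)
  also have "\<mu> * (1 - \<theta>) + \<theta> * (\<mu> * (1 - \<theta> ^ n)) = \<mu> * (1 - \<theta> ^ Suc n)"
    by (simp add: algebra_simps)
  finally show ?case .
qed

lemma X_measurable [measurable]: "X n \<in> borel_measurable M"
  by (subst measurable_cong[OF X_eq]) auto

text \<open>Summation of the recursion. It explains the factor 1 - \<theta> in the linear form: up
  to one boundary term the form is a sum of noise variables, whose variance growth is known.\<close>

lemma W_sum_noise: "(1 - \<theta>) * (\<Sum>a=1..n. W a \<omega>) = (\<Sum>t=1..n. \<xi> (int t) \<omega>) - \<theta> * W n \<omega>"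
proof (induction n)
  case 0
  then show ?case by (simp add: trunc_ma_def)
next
  case (Suc n)
  have S: "(\<Sum>a=1..Suc n. F a) = (\<Sum>a=1..n. F a) + F (Suc n)" for F :: "nat \<Rightarrow> real" by simp
  have "(1 - \<theta>) * W (Suc n) \<omega> = W (Suc n) \<omega> - \<theta> * W (Suc n) \<omega>" by (simp only: left_diff_distrib mult_1)
  then show ?case unfolding S distrib_left Suc.IH using W_Suc[of n \<omega>] by linarith
qed

lemma combination_square_expectation:
  assumes "finite I"
  shows "(\<integral>\<omega>. (\<Sum>a\<in>I. c a * W a \<omega>)\<^sup>2 \<partial>M) = (\<Sum>a\<in>I. \<Sum>b\<in>I. c a * c b * G a b)"
proof -
  have "(\<Sum>a\<in>I. c a * W a \<omega>)\<^sup>2 = (\<Sum>a\<in>I. \<Sum>b\<in>I. c a * c b * (W a \<omega> * W b \<omega>))" for \<omega>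
    unfolding power2_eq_square sum_product by (simp add: mult_ac)
  then show ?thesis by (simp add: G_eq)
qed

lemma W_gaussian_family: "gaussian_family M {1..n} W G"
proof
  show "centered_gaussian_family M {1..n} W G"
    unfolding centered_gaussian_family_def
  proof (intro conjI allI ballI)
    show "prob_space M" by (rule prob_space_axioms)
    show "G i j = G j i" for i j unfolding G_eq by (simp add: mult.commute)
    fix c :: "nat \<Rightarrow> real"
    show "0 \<le> (\<Sum>i\<in>{1..n}. \<Sum>j\<in>{1..n}. c i * c j * G i j)"
      unfolding combination_square_expectation[OF finite_atLeastAtMost, symmetric] by simp
    have "noise_span (\<lambda>\<omega>. \<Sum>i\<in>{1..n}. c i * W i \<omega>)"
      by (intro noise_span_sum noise_span_scale noise_span_trunc_ma) simp
    from noise_span_normal[OF this]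
    show "distr M borel (\<lambda>\<omega>. \<Sum>i\<in>{1..n}. c i * W i \<omega>) = normal_law 0 (\<Sum>i\<in>{1..n}. \<Sum>j\<in>{1..n}. c i * c j * G i j)"
      unfolding combination_square_expectation[OF finite_atLeastAtMost] .
  qed auto
qed

section \<open>Decay and limits of the covariances of the autoregression started at 0\<close>

lemma G_decay: obtains K where "K \<ge> 0" "\<And>a b. \<bar>G a b\<bar> \<le> K * decay (2 - 2 * H) (int a - int b)"
proof -
  obtain K where K: "\<And>k. \<bar>R k\<bar> \<le> K * decay (2 - 2 * H) k" by (rule autocov_decay, rule that)
  let ?K = "K * (\<Sum>i. \<theta> ^ i * (1 + real i))\<^sup>2"
  have b: "\<bar>G a b\<bar> \<le> ?K * decay (2 - 2 * H) (int a - int b)" for a b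
    unfolding G_eq using H by (intro trunc_ma_cov_bound[OF \<theta>0 \<theta>(2) _ _ K]) auto
  moreover have "?K \<ge> 0"
    using order_trans[OF abs_ge_zero b[of 0 0]] decay_pos[of "2 - 2 * H" 0] by (simp add: zero_le_mult_iff)
  ultimately show ?thesis using that by blast
qed

lemma G_diag_bound: obtains K where "K \<ge> 0" "\<And>a. 0 \<le> G a a" "\<And>a. G a a \<le> K"
proof -
  obtain K where K: "K \<ge> 0" "\<And>a b. \<bar>G a b\<bar> \<le> K * decay (2 - 2 * H) (int a - int b)" by (rule G_decay) blast
  have "G a a \<le> K" for a using K(2)[of a a] by (simp add: decay_def)
  moreover have "0 \<le> G a a" for a unfolding G_eq by simp
  ultimately show ?thesis using that K(1) by blast
qed

lemma G_row_sum: obtains \<rho> where "\<rho> > 0" "\<And>n a. a \<in> {1..n} \<Longrightarrow> (\<Sum>b=1..n. \<bar>G a b\<bar>) \<le> \<rho> * real n powr (2 * H - 1)"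
proof -
  obtain K where K: "K \<ge> 0" "\<And>a b. \<bar>G a b\<bar> \<le> K * decay (2 - 2 * H) (int a - int b)" by (rule G_decay) blast
  obtain D where D: "D > 0" "\<And>n a. a \<in> {1..n} \<Longrightarrow> (\<Sum>b=1..n. decay (2 - 2 * H) (int a - int b)) \<le> D * real n powr (1 - (2 - 2 * H))"
    using decay_sum_bound[of "2 - 2 * H"] H by auto
  \<comment> \<open>The added 1 makes the constant strictly positive even for K = 0; the
    characteristic function estimate requires a positive row bound.\<close>
  have "(\<Sum>b=1..n. \<bar>G a b\<bar>) \<le> (K * D + 1) * real n powr (2 * H - 1)" if a: "a \<in> {1..n}" for n a
  proof -
    have "(\<Sum>b=1..n. \<bar>G a b\<bar>) \<le> K * (\<Sum>b=1..n. decay (2 - 2 * H) (int a - int b))"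
      unfolding sum_distrib_left by (intro sum_mono K(2))
    also have "\<dots> \<le> K * (D * real n powr (2 * H - 1))" using mult_left_mono[OF D(2)[OF a] K(1)] by simp
    also have "K * (D * real n powr (2 * H - 1)) \<le> (K * D + 1) * real n powr (2 * H - 1)" by (simp add: algebra_simps)
    finally show ?thesis .
  qed
  moreover have "K * D + 1 > 0" using K(1) D(1) by (simp add: add_nonneg_pos)
  ultimately show ?thesis using that by blast
qed

text \<open>Along each lag the bound on \<open>G\<close> passes to the limit, so the stationary
  autocovariances are square summable as well. Summability matters: a divergent infinite sum would
  take the default value 0.\<close>

lemma G_square_lim: "(\<lambda>n. (\<Sum>a=1..n. \<Sum>b=1..n. (G a b)\<^sup>2) / real n) \<longlonglongrightarrow> \<tau>"
  and autocov_square_summable: "(\<lambda>k. (autocov M (ar_stat \<xi> \<theta>) k)\<^sup>2) summable_on UNIV"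
proof -
  obtain K where K: "K \<ge> 0" "\<And>a b. \<bar>G a b\<bar> \<le> K * decay (2 - 2 * H) (int a - int b)" by (rule G_decay) blast
  have "(\<lambda>k. K\<^sup>2 * (decay (2 - 2 * H) k)\<^sup>2) summable_on UNIV"
    using H by (intro summable_on_cmult_right decay_square_summable) simp
  then have d: "(\<lambda>k. (K * decay (2 - 2 * H) k)\<^sup>2) summable_on UNIV" by (simp add: power_mult_distrib)
  show "(\<lambda>n. (\<Sum>a=1..n. \<Sum>b=1..n. (G a b)\<^sup>2) / real n) \<longlonglongrightarrow> \<tau>"
    unfolding \<tau>_def by (rule covariance_square_sum_lim[OF K(2) d start_cov_lim[OF \<theta>0 \<theta>(2)]])
  have "\<bar>autocov M (ar_stat \<xi> \<theta>) k\<bar> \<le> K * decay (2 - 2 * H) k" for k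
  proof (rule LIMSEQ_le_const2[OF tendsto_rabs[OF start_cov_lim[OF \<theta>0 \<theta>(2)]]], intro exI[of _ "nat \<bar>k\<bar>"] allI impI)
    fix b assume "nat \<bar>k\<bar> \<le> b"
    then have "int (nat (int b + k)) - int b = k" by simp
    then show "\<bar>G (nat (int b + k)) b\<bar> \<le> K * decay (2 - 2 * H) k" using K(2)[of "nat (int b + k)" b] by simp
  qed
  then have "(autocov M (ar_stat \<xi> \<theta>) k)\<^sup>2 \<le> (K * decay (2 - 2 * H) k)\<^sup>2" for k
    using power_mono[OF _ abs_ge_zero, of "autocov M (ar_stat \<xi> \<theta>) k" _ 2] by simp
  then show "(\<lambda>k. (autocov M (ar_stat \<xi> \<theta>) k)\<^sup>2) summable_on UNIV"
    by (intro summable_on_comparison_test[OF d]) auto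
qed

text \<open>The term at lag 0 is the square of the positive second moment. Positivity is needed for
  the limit law to have a density.\<close>

lemma \<tau>_pos: "\<tau> > 0"
proof -
  have "0 < (autocov M (ar_stat \<xi> \<theta>) 0)\<^sup>2"
    using f_pos[of \<theta>] \<theta> by (simp add: autocov_ar_stat_0)
  also have "\<dots> = (\<Sum>\<^sub>\<infinity>k\<in>{0}. (autocov M (ar_stat \<xi> \<theta>) k)\<^sup>2)" by simp
  also have "\<dots> \<le> \<tau>"
    unfolding \<tau>_def by (rule infsum_mono_neutral) (use autocov_square_summable in auto)
  finally show ?thesis .
qed

lemma lin_var_pos: "lin_var > 0" unfolding lin_var_def using C H by (intro divide_pos_pos mult_pos_pos) auto

text \<open>The scaled sum of the \<open>W a\<close> equals a noise sum \<open>A\<close> minus a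
  boundary term \<open>B\<close> bounded in mean square. The mixed term is then of smaller order
  than the variance of \<open>A\<close>, so the limit is that of the noise sums.\<close>

lemma G_sum_lim: "(\<lambda>n. (1 - \<theta>)\<^sup>2 * (\<Sum>a=1..n. \<Sum>b=1..n. G a b) / real n powr (2 * H)) \<longlonglongrightarrow> lin_var"
proof -
  obtain K where K: "K \<ge> 0" "\<And>a. 0 \<le> G a a" "\<And>a. G a a \<le> K" by (rule G_diag_bound) blast
  define A where "A n \<omega> = (\<Sum>t=1..n. \<xi> (int t) \<omega>)" for n \<omega>
  define B where "B n \<omega> = \<theta> * W n \<omega>" for n \<omega>
  define S where "S n = (1 - \<theta>)\<^sup>2 * (\<Sum>a=1..n. \<Sum>b=1..n. G a b)" for n
  have [measurable]: "A n \<in> borel_measurable M" "B n \<in> borel_measurable M" for n unfolding A_def B_def by measurable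
  have iA: "integrable M (\<lambda>\<omega>. (A n \<omega>)\<^sup>2)" for n unfolding A_def power2_eq_square sum_product by simp
  have iB: "integrable M (\<lambda>\<omega>. (B n \<omega>)\<^sup>2)" for n
    unfolding B_def power_mult_distrib power2_eq_square[of "W n _"] by simp
  have B2: "(\<integral>\<omega>. (B n \<omega>)\<^sup>2 \<partial>M) \<le> K" for n
  proof -
    have "(\<integral>\<omega>. (B n \<omega>)\<^sup>2 \<partial>M) = \<theta>\<^sup>2 * G n n" unfolding B_def G_eq power_mult_distrib power2_eq_square[of "W n _"] by simp
    also have "\<dots> \<le> 1 * K" using \<theta> K by (intro mult_mono) (auto simp: power_le_one)
    finally show ?thesis by simp
  qed
  have iAB: "integrable M (\<lambda>\<omega>. A n \<omega> * B n \<omega>)" for n by (rule mult_integrable[OF _ _ iA iB]) auto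
  have S_eq: "S n = (\<integral>\<omega>. (A n \<omega> - B n \<omega>)\<^sup>2 \<partial>M)" for n
  proof -
    have "(\<integral>\<omega>. (A n \<omega> - B n \<omega>)\<^sup>2 \<partial>M) = (\<integral>\<omega>. (1 - \<theta>)\<^sup>2 * (\<Sum>a\<in>{1..n}. 1 * W a \<omega>)\<^sup>2 \<partial>M)"
      unfolding A_def B_def W_sum_noise[symmetric] power_mult_distrib by simp
    also have "\<dots> = S n" unfolding S_def integral_mult_right_zero combination_square_expectation[OF finite_atLeastAtMost] by simp
    finally show ?thesis ..
  qed
  have main: "\<bar>S n - noise_sum_var n\<bar> \<le> real n powr (- H) * noise_sum_var n + real n powr H * K + K" if n: "n > 0" for n
  proof -
    \<comment> \<open>The weight in the inequality between 2 a b and the weighted squares. It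
      balances a variance of order \<open>n powr (2 * H)\<close> against a bounded one, leaving an
      error of order \<open>n powr H\<close>.\<close>
    let ?c = "real n powr (- H)"
    have c: "?c > 0" "real n powr H = 1 / ?c" using n by (auto simp: powr_minus field_simps)
    have pt: "2 * (a * b) \<le> ?c * a\<^sup>2 + (1 / ?c) * b\<^sup>2" "- (2 * (a * b)) \<le> ?c * a\<^sup>2 + (1 / ?c) * b\<^sup>2" for a b :: real
    proof -
      have "0 \<le> (?c * a - b)\<^sup>2" "0 \<le> (?c * a + b)\<^sup>2" by auto
      then have "2 * (a * b) * ?c \<le> (?c * a\<^sup>2 + (1 / ?c) * b\<^sup>2) * ?c" "- (2 * (a * b)) * ?c \<le> (?c * a\<^sup>2 + (1 / ?c) * b\<^sup>2) * ?c"
        using c by (auto simp: power2_eq_square algebra_simps)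
      then show "2 * (a * b) \<le> ?c * a\<^sup>2 + (1 / ?c) * b\<^sup>2" "- (2 * (a * b)) \<le> ?c * a\<^sup>2 + (1 / ?c) * b\<^sup>2"
        using mult_right_le_imp_le[OF _ c(1)] by blast+
    qed
    have "S n = noise_sum_var n - 2 * (\<integral>\<omega>. A n \<omega> * B n \<omega> \<partial>M) + (\<integral>\<omega>. (B n \<omega>)\<^sup>2 \<partial>M)"
    proof -
      have "(A n \<omega> - B n \<omega>)\<^sup>2 = (A n \<omega>)\<^sup>2 - 2 * (A n \<omega> * B n \<omega>) + (B n \<omega>)\<^sup>2" for \<omega> by (simp add: power2_diff)
      then show ?thesis unfolding S_eq noise_sum_var_def A_def[symmetric] using iA iB iAB by simp
    qed
    moreover have "\<bar>2 * (\<integral>\<omega>. A n \<omega> * B n \<omega> \<partial>M)\<bar> \<le> ?c * noise_sum_var n + (1 / ?c) * (\<integral>\<omega>. (B n \<omega>)\<^sup>2 \<partial>M)"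
    proof -
      have "(\<integral>\<omega>. 2 * (A n \<omega> * B n \<omega>) \<partial>M) \<le> (\<integral>\<omega>. ?c * (A n \<omega>)\<^sup>2 + (1 / ?c) * (B n \<omega>)\<^sup>2 \<partial>M)"
        using iA iB iAB by (intro integral_mono pt) auto
      moreover have "(\<integral>\<omega>. - (2 * (A n \<omega> * B n \<omega>)) \<partial>M) \<le> (\<integral>\<omega>. ?c * (A n \<omega>)\<^sup>2 + (1 / ?c) * (B n \<omega>)\<^sup>2 \<partial>M)"
        using iA iB iAB by (intro integral_mono pt) auto
      moreover have "(\<integral>\<omega>. ?c * (A n \<omega>)\<^sup>2 + (1 / ?c) * (B n \<omega>)\<^sup>2 \<partial>M) = ?c * noise_sum_var n + (1 / ?c) * (\<integral>\<omega>. (B n \<omega>)\<^sup>2 \<partial>M)"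
        unfolding noise_sum_var_def A_def[symmetric] using iA iB by simp
      ultimately show ?thesis by simp
    qed
    moreover have "(1 / ?c) * (\<integral>\<omega>. (B n \<omega>)\<^sup>2 \<partial>M) \<le> (1 / ?c) * K" using c B2 by (intro mult_left_mono) auto
    moreover have "0 \<le> (\<integral>\<omega>. (B n \<omega>)\<^sup>2 \<partial>M)" by simp
    ultimately show ?thesis using B2[of n] unfolding c(2) by linarith
  qed
  have "(\<lambda>n. S n / real n powr (2 * H) - noise_sum_var n / real n powr (2 * H)) \<longlonglongrightarrow> 0"
  proof (rule Lim_null_comparison)
    have "(\<lambda>n. real n powr (- H)) \<longlonglongrightarrow> 0" "(\<lambda>n. real n powr (- (2 * H))) \<longlonglongrightarrow> 0" using H by real_asymp+
    then have "(\<lambda>n. real n powr (- H) * (noise_sum_var n / real n powr (2 * H)) + real n powr (- H) * K + real n powr (- (2 * H)) * K) \<longlonglongrightarrow> 0 * (C / (H * (2 * H - 1))) + 0 * K + 0 * K"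
      by (intro tendsto_add tendsto_mult noise_sum_var_lim tendsto_const)
    then show "(\<lambda>n. real n powr (- H) * (noise_sum_var n / real n powr (2 * H)) + real n powr (- H) * K + real n powr (- (2 * H)) * K) \<longlonglongrightarrow> 0" by simp
    show "\<forall>\<^sub>F n in sequentially. norm (S n / real n powr (2 * H) - noise_sum_var n / real n powr (2 * H)) \<le> 
        real n powr (- H) * (noise_sum_var n / real n powr (2 * H)) + real n powr (- H) * K + real n powr (- (2 * H)) * K"
      using eventually_gt_at_top[of 0]
    proof eventually_elim
      case (elim n)
      have e: "real n powr H / real n powr (2 * H) = real n powr (- H)" "1 / real n powr (2 * H) = real n powr (- (2 * H))"
        using elim powr_diff[of "real n" H "2 * H"] powr_minus_divide[of "real n" "2 * H"] by simp_all
      have "norm (S n / real n powr (2 * H) - noise_sum_var n / real n powr (2 * H)) = \<bar>S n - noise_sum_var n\<bar> / real n powr (2 * H)"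
        unfolding diff_divide_distrib[symmetric] by simp
      also have "\<dots> \<le> (real n powr (- H) * noise_sum_var n + real n powr H * K + K) / real n powr (2 * H)"
        using main elim by (intro divide_right_mono) auto
      also have "\<dots> = real n powr (- H) * (noise_sum_var n / real n powr (2 * H)) + (real n powr H / real n powr (2 * H)) * K + (1 / real n powr (2 * H)) * K"
        by (simp add: add_divide_distrib)
      finally show ?case unfolding e .
    qed
  qed
  from tendsto_add[OF this noise_sum_var_lim] show ?thesis unfolding S_def lin_var_def by (simp only: diff_add_cancel add_0)
qed

section \<open>Joint limit of the quadratic and the linear form\<close>

definition Q where "Q n \<omega> = (1 / sqrt (real n)) * (\<Sum>a=1..n. (W a \<omega>)\<^sup>2 - G a a)"
definition L where "L n \<omega> = (1 - \<theta>) * real n powr (- H) * (\<Sum>a=1..n. W a \<omega>)"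

lemma Q_measurable [measurable]: "Q n \<in> borel_measurable M" unfolding Q_def by measurable
lemma L_measurable [measurable]: "L n \<in> borel_measurable M" unfolding L_def by measurable

text \<open>The general estimate is used with q the inverse square root of n, u proportional to
  \<open>n powr (-H)\<close> and the row bound of order \<open>n powr (2 * H - 1)\<close>. The error
  is a convergent factor times \<open>P n\<close>, while the two exponents in the approximant
  converge.\<close>

lemma joint_char_QL: "(\<lambda>n. \<integral>\<omega>. iexp (s * Q n \<omega> + t * L n \<omega>) \<partial>M) \<longlonglongrightarrow> exp (- (s\<^sup>2 * \<tau>) - t\<^sup>2 * lin_var / 2)"
proof -
  obtain \<rho> where \<rho>: "\<rho> > 0" "\<And>n a. a \<in> {1..n} \<Longrightarrow> (\<Sum>b=1..n. \<bar>G a b\<bar>) \<le> \<rho> * real n powr (2 * H - 1)" by (rule G_row_sum) blast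
  define T where "T n = (\<Sum>a=1..n. \<Sum>b=1..n. (G a b)\<^sup>2)" for n
  define SG where "SG n = (\<Sum>a=1..n. \<Sum>b=1..n. G a b)" for n
  define P where "P n = real n powr (2 * H - 3 / 2)" for n
  define e where "e n = exp (- (s\<^sup>2 * (T n / real n)) - t\<^sup>2 * ((1 - \<theta>)\<^sup>2 * SG n / real n powr (2 * H)) / 2)" for n
  define bd where "bd n = \<bar>s\<bar> * (4 * s\<^sup>2 * \<rho> * (T n / real n) * P n + (\<bar>s\<bar> * (T n / real n + 1) + 1) * (\<bar>t\<bar> * (1 - \<theta>) * \<rho> * sqrt \<rho>) * P n)" for n
  have bound: "cmod ((\<integral>\<omega>. iexp (s * Q n \<omega> + t * L n \<omega>) \<partial>M) - e n) \<le> bd n" if n: "n > 0" for n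
  proof -
    interpret F: gaussian_family M "{1..n}" W G by (rule W_gaussian_family)
    define q where "q = 1 / sqrt (real n)"
    define u where "u = t * (1 - \<theta>) * real n powr (- H)"
    define r where "r = \<rho> * real n powr (2 * H - 1)"
    have q: "q \<ge> 0" "q\<^sup>2 = 1 / real n" "q * sqrt (real n) = 1" using n by (auto simp: q_def power_divide)
    have r: "r > 0" using \<rho> n by (simp add: r_def)
    have sqr: "sqrt r = sqrt \<rho> * real n powr (H - 1 / 2)"
    proof -
      have "sqrt (real n powr (2 * H - 1)) = real n powr ((2 * H - 1) * (1 / 2))"
        unfolding powr_half_sqrt[symmetric, OF powr_ge_zero] powr_powr ..
      also have "(2 * H - 1) * (1 / 2) = H - 1 / 2" by (simp add: field_simps)
      finally show ?thesis unfolding r_def real_sqrt_mult by simp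
    qed
    have au: "\<bar>u\<bar> = \<bar>t\<bar> * (1 - \<theta>) * real n powr (- H)" using \<theta> by (simp add: u_def abs_mult)
    \<comment> \<open>The exponents add up to 2H - 3/2 in both products: -1/2 + (2H - 1) here, and
      -H + (2H - 1) + (H - 1/2) in \<open>f2\<close>.\<close>
    have f1: "q * real n powr (2 * H - 1) = P n"
    proof -
      have "q = real n powr (- (1 / 2))" unfolding q_def powr_minus_divide by (simp add: powr_half_sqrt)
      then have "q * real n powr (2 * H - 1) = real n powr (- (1 / 2) + (2 * H - 1))" by (simp only: powr_add)
      also have "- (1 / 2) + (2 * H - 1) = 2 * H - 3 / 2" by (simp add: field_simps)
      finally show ?thesis unfolding P_def .
    qed
    have f2: "\<bar>u\<bar> * (r * sqrt r) = \<bar>t\<bar> * (1 - \<theta>) * \<rho> * sqrt \<rho> * P n"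
    proof -
      have "real n powr (- H) * (real n powr (2 * H - 1) * real n powr (H - 1 / 2)) = P n"
        unfolding powr_add[symmetric] P_def by (simp add: field_simps)
      then show ?thesis unfolding au sqr unfolding r_def by (simp add: mult_ac)
    qed
    have f3: "sqrt (real n * r ^ 3) = sqrt (real n) * (r * sqrt r)"
      using r by (simp add: real_sqrt_mult power3_eq_cube)
    have b: "cmod ((\<integral>\<omega>. iexp (s * (q * (\<Sum>a\<in>{1..n}. (W a \<omega>)\<^sup>2 - G a a)) + u * (\<Sum>a\<in>{1..n}. W a \<omega>)) \<partial>M)
      - exp (- (s\<^sup>2 * (q\<^sup>2 * T n)) - u\<^sup>2 * SG n / 2))
      \<le> \<bar>s\<bar> * (q * (4 * s\<^sup>2 * q\<^sup>2 * r * T n + \<bar>s\<bar> * q * \<bar>u\<bar> * r * sqrt r * (T n + real (card {1..n})) + \<bar>u\<bar> * sqrt (real (card {1..n}) * r ^ 3)))"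
      unfolding T_def SG_def by (rule F.char_quadratic_linear_approx[OF _ r q(1)]) (use \<rho>(2) in \<open>auto simp: r_def\<close>)
    have e1: "s * (q * (\<Sum>a\<in>{1..n}. (W a \<omega>)\<^sup>2 - G a a)) + u * (\<Sum>a\<in>{1..n}. W a \<omega>) = s * Q n \<omega> + t * L n \<omega>" for \<omega>
      by (simp add: Q_def L_def q_def u_def)
    have e2: "exp (- (s\<^sup>2 * (q\<^sup>2 * T n)) - u\<^sup>2 * SG n / 2) = e n"
    proof -
      have "(real n powr (- H))\<^sup>2 = 1 / real n powr (2 * H)"
        unfolding power2_eq_square powr_add[symmetric] powr_minus_divide[symmetric] by simp
      then show ?thesis by (simp add: e_def q u_def power_mult_distrib)
    qed
    have e3: "\<bar>s\<bar> * (q * (4 * s\<^sup>2 * q\<^sup>2 * r * T n + \<bar>s\<bar> * q * \<bar>u\<bar> * r * sqrt r * (T n + real (card {1..n})) + \<bar>u\<bar> * sqrt (real (card {1..n}) * r ^ 3))) = bd n"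
    proof -
      have "q * (4 * s\<^sup>2 * q\<^sup>2 * r * T n + \<bar>s\<bar> * q * \<bar>u\<bar> * r * sqrt r * (T n + real n) + \<bar>u\<bar> * sqrt (real n * r ^ 3))
        = 4 * s\<^sup>2 * \<rho> * (q\<^sup>2 * T n) * (q * real n powr (2 * H - 1)) + (\<bar>s\<bar> * (q\<^sup>2 * T n + q\<^sup>2 * real n) + q * sqrt (real n)) * (\<bar>u\<bar> * (r * sqrt r))"
        unfolding f3 by (simp add: r_def algebra_simps power2_eq_square)
      also have "\<dots> = 4 * s\<^sup>2 * \<rho> * (T n / real n) * P n + (\<bar>s\<bar> * (T n / real n + 1) + 1) * (\<bar>t\<bar> * (1 - \<theta>) * \<rho> * sqrt \<rho> * P n)"
        unfolding f1 f2 q(2,3) using n by simp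
      finally show ?thesis by (simp add: bd_def mult.assoc)
    qed
    show ?thesis using b unfolding e1 e2 e3 .
  qed
  have Tn: "(\<lambda>n. T n / real n) \<longlonglongrightarrow> \<tau>" unfolding T_def by (rule G_square_lim)
  have Pn: "P \<longlonglongrightarrow> 0" unfolding P_def using H by real_asymp
  have SGn: "(\<lambda>n. (1 - \<theta>)\<^sup>2 * SG n / real n powr (2 * H)) \<longlonglongrightarrow> lin_var" unfolding SG_def by (rule G_sum_lim)
  have bd0: "bd \<longlonglongrightarrow> 0"
  proof -
    have "bd \<longlonglongrightarrow> \<bar>s\<bar> * (4 * s\<^sup>2 * \<rho> * \<tau> * 0 + (\<bar>s\<bar> * (\<tau> + 1) + 1) * (\<bar>t\<bar> * (1 - \<theta>) * \<rho> * sqrt \<rho>) * 0)"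
      unfolding bd_def by (intro tendsto_mult tendsto_add tendsto_const Tn Pn)
    then show ?thesis by simp
  qed
  have "e \<longlonglongrightarrow> exp (- (s\<^sup>2 * \<tau>) - t\<^sup>2 * lin_var / 2)"
    unfolding e_def by (intro tendsto_exp tendsto_diff tendsto_minus tendsto_mult tendsto_divide tendsto_const Tn SGn) simp
  then have en: "(\<lambda>n. complex_of_real (e n)) \<longlonglongrightarrow> complex_of_real (exp (- (s\<^sup>2 * \<tau>) - t\<^sup>2 * lin_var / 2))" by (rule tendsto_of_real)
  have "(\<lambda>n. (\<integral>\<omega>. iexp (s * Q n \<omega> + t * L n \<omega>) \<partial>M) - e n) \<longlonglongrightarrow> 0"
  proof (rule Lim_null_comparison[OF _ bd0])
    show "\<forall>\<^sub>F n in sequentially. cmod ((\<integral>\<omega>. iexp (s * Q n \<omega> + t * L n \<omega>) \<partial>M) - e n) \<le> bd n"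
      using eventually_gt_at_top[of 0] by eventually_elim (rule bound)
  qed
  from tendsto_add[OF this en] show ?thesis by (simp only: diff_add_cancel add_0)
qed

section \<open>Sample variance and sample mean in terms of the two forms\<close>

definition V where "V n \<omega> = (1 / real n) * (\<Sum>t=1..n. (X t \<omega> - sample_mean X n \<omega>)\<^sup>2)"
definition g where "g = inv_into {0<..<1} f"

lemma theta_hat_eq: "theta_hat M \<xi> X n \<omega> = g (V n \<omega>)"
  by (simp add: theta_hat_def V_def g_def)

lemma sample_mean_measurable [measurable]: "sample_mean X n \<in> borel_measurable M"
  unfolding sample_mean_def by measurable

lemma V_measurable [measurable]: "V n \<in> borel_measurable M" unfolding V_def by measurable

lemma g_measurable [measurable]: "g \<in> borel_measurable borel"
  unfolding g_def by (rule strict_mono_inverse_measurable[OF f_mono second_moment_differentiable])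

lemma g_f: "g (f \<theta>) = \<theta>"
  unfolding g_def using \<theta> by (intro inv_into_f_f strict_mono_on_imp_inj_on f_mono) auto

lemma g_deriv: "(g has_real_derivative inverse (deriv f \<theta>)) (at (f \<theta>))"
  unfolding g_def using \<theta> by (intro strict_mono_inverse_deriv[OF f_mono second_moment_differentiable] f_deriv) auto

lemma geometric_sum_bound: "(\<Sum>a=1..n. \<theta> ^ a) \<le> 1 / (1 - \<theta>)"
proof -
  have "(\<Sum>a=1..n. \<theta> ^ a) \<le> (\<Sum>a. \<theta> ^ a)"
    using \<theta> by (intro sum_le_suminf summable_geometric) auto
  then show ?thesis using \<theta> by (simp add: suminf_geometric)
qed

lemma W_abs_bound: obtains B where "B \<ge> 0" "\<And>a. (\<integral>\<omega>. \<bar>W a \<omega>\<bar> \<partial>M) \<le> B"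
proof -
  obtain K where K: "K \<ge> 0" "\<And>a. 0 \<le> G a a" "\<And>a. G a a \<le> K" by (rule G_diag_bound) blast
  have "(\<integral>\<omega>. \<bar>W a \<omega>\<bar> \<partial>M) \<le> sqrt K" for a
  proof -
    have "(\<integral>\<omega>. \<bar>W a \<omega>\<bar> \<partial>M) \<le> sqrt (\<integral>\<omega>. (W a \<omega>)\<^sup>2 \<partial>M)"
      by (rule expectation_abs_le_sqrt) (simp_all add: power2_eq_square)
    also have "\<dots> \<le> sqrt K" using K(3)[of a] by (simp add: G_eq power2_eq_square)
    finally show ?thesis .
  qed
  then show ?thesis using that[of "sqrt K"] K(1) by simp
qed

lemma W_integrable [simp]: "integrable M (W a)"
  by (rule square_integrable_imp_integrable) (simp_all add: power2_eq_square)

lemma sample_mean_eq: "\<omega> \<in> space M \<Longrightarrow> sample_mean X n \<omega> = (1 / real n) * (\<Sum>a=1..n. W a \<omega> + \<mu> * (1 - \<theta> ^ a))"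
  unfolding sample_mean_def by (simp add: X_eq)

text \<open>A crude bound in mean suffices: in the error of the \<alpha>-estimator the sample mean
  appears only next to a tight factor and the null sequence \<open>n powr (1/2 - H)\<close>.\<close>

lemma sample_mean_tight: "tight_rvs (sample_mean X)"
proof -
  obtain B where B: "B \<ge> 0" "\<And>a. (\<integral>\<omega>. \<bar>W a \<omega>\<bar> \<partial>M) \<le> B" by (rule W_abs_bound) blast
  let ?S = "\<lambda>n \<omega>. (1 / real n) * (\<Sum>a=1..n. W a \<omega> + \<mu> * (1 - \<theta> ^ a))"
  have i: "integrable M (?S n)" for n by simp
  have b: "(\<integral>\<omega>. \<bar>?S n \<omega>\<bar> \<partial>M) \<le> B + \<bar>\<mu>\<bar>" for n
  proof -
    have "(\<integral>\<omega>. \<bar>?S n \<omega>\<bar> \<partial>M) \<le> (\<integral>\<omega>. (1 / real n) * (\<Sum>a=1..n. \<bar>W a \<omega>\<bar> + \<bar>\<mu>\<bar>) \<partial>M)"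
    proof (rule integral_mono)
      fix \<omega>
      have "\<bar>W a \<omega> + \<mu> * (1 - \<theta> ^ a)\<bar> \<le> \<bar>W a \<omega>\<bar> + \<bar>\<mu>\<bar>" for a
      proof -
        have "\<bar>\<mu> * (1 - \<theta> ^ a)\<bar> \<le> \<bar>\<mu>\<bar> * 1"
          unfolding abs_mult using \<theta> by (intro mult_left_mono) (auto simp: power_le_one abs_le_iff)
        then show ?thesis using abs_triangle_ineq[of "W a \<omega>" "\<mu> * (1 - \<theta> ^ a)"] by linarith
      qed
      then have "\<bar>\<Sum>a=1..n. W a \<omega> + \<mu> * (1 - \<theta> ^ a)\<bar> \<le> (\<Sum>a=1..n. \<bar>W a \<omega>\<bar> + \<bar>\<mu>\<bar>)"
        by (intro order_trans[OF sum_abs sum_mono])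
      then show "\<bar>?S n \<omega>\<bar> \<le> (1 / real n) * (\<Sum>a=1..n. \<bar>W a \<omega>\<bar> + \<bar>\<mu>\<bar>)"
        unfolding abs_mult by (intro mult_mono) auto
    qed (use i in auto)
    also have "\<dots> = (1 / real n) * (\<Sum>a=1..n. (\<integral>\<omega>. \<bar>W a \<omega>\<bar> \<partial>M) + \<bar>\<mu>\<bar>)"
      by (simp add: prob_space)
    also have "\<dots> \<le> (1 / real n) * (\<Sum>a=1..n. B + \<bar>\<mu>\<bar>)"
      using B by (intro mult_left_mono sum_mono add_mono) auto
    also have "\<dots> \<le> B + \<bar>\<mu>\<bar>" using B by (cases "n = 0") auto
    finally show ?thesis .
  qed
  have "tight_rvs ?S" by (rule tight_rvs_L1[OF i b])
  moreover have "prob {\<omega>\<in>space M. K < \<bar>sample_mean X n \<omega>\<bar>} = prob {\<omega>\<in>space M. K < \<bar>?S n \<omega>\<bar>}" for K n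
    by (rule arg_cong[where f = prob]) (use sample_mean_eq in auto)
  ultimately show ?thesis unfolding tight_rvs_def by simp
qed

text \<open>The sample variance is invariant under translation by \<mu>, so only the centered
  process and its geometric drift remain.\<close>

lemma sample_variance_eq:
  assumes n: "n > 0" and \<omega>: "\<omega> \<in> space M"
  shows "V n \<omega> = (1 / real n) * (\<Sum>a=1..n. (W a \<omega> - \<mu> * \<theta> ^ a)\<^sup>2) - ((1 / real n) * (\<Sum>a=1..n. W a \<omega> - \<mu> * \<theta> ^ a))\<^sup>2"
proof -
  let ?m = "(1 / real n) * (\<Sum>a=1..n. W a \<omega> - \<mu> * \<theta> ^ a)"
  have "sample_mean X n \<omega> = ?m + \<mu>"
    unfolding sample_mean_eq[OF \<omega>] using n by (simp add: sum.distrib sum_subtractf right_diff_distrib algebra_simps add_divide_distrib diff_divide_distrib)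
  then have "X a \<omega> - sample_mean X n \<omega> = (W a \<omega> - \<mu> * \<theta> ^ a) - ?m" for a
    unfolding X_eq[OF \<omega>] by (simp add: algebra_simps)
  then show ?thesis unfolding V_def by (simp only: sum_square_deviation[OF n refl])
qed

text \<open>Expanding the squares leaves three remainders. The drift and the centering contribute
  bounded sums times the inverse square root of n. The square of the sample mean is larger, of order
  \<open>n powr (2 * H - 3/2)\<close>, and vanishes because H < 3/4.\<close>

lemma variance_remainder_vanishes: "vanishes (\<lambda>n \<omega>. sqrt (real n) * (V n \<omega> - f \<theta>) - Q n \<omega>)"
proof -
  obtain B where B: "B \<ge> 0" "\<And>a. (\<integral>\<omega>. \<bar>W a \<omega>\<bar> \<partial>M) \<le> B" by (rule W_abs_bound) blast
  let ?g = "1 / (1 - \<theta>)"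
  have f0: "f \<theta> > 0" using f_pos \<theta> by simp
  have inv_sqrt: "(\<lambda>n. 1 / sqrt (real n)) \<longlonglongrightarrow> 0" by real_asymp
  \<comment> \<open>The deterministic part: the exact variances replace their limit, and the squared
    drift is added. Both sums stay bounded in n because their terms decay geometrically.\<close>
  define r1 where "r1 n = (1 / sqrt (real n)) * (\<Sum>a=1..n. G a a - f \<theta>) + (1 / sqrt (real n)) * (\<mu>\<^sup>2 * (\<Sum>a=1..n. (\<theta> ^ a)\<^sup>2))" for n
  define r2 where "r2 n \<omega> = (1 / sqrt (real n)) * (- (2 * \<mu>) * (\<Sum>a=1..n. \<theta> ^ a * W a \<omega>))" for n \<omega>
  \<comment> \<open>The contribution of the squared sample mean after centering. Its expected size
    is controlled by the variance of the sum of the \<open>W a\<close>, which grows like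
    \<open>n powr (2 * H)\<close>.\<close>
  define r3 where "r3 n \<omega> = - (sqrt (real n) * ((1 / real n) * (\<Sum>a=1..n. W a \<omega> - \<mu> * \<theta> ^ a))\<^sup>2)" for n \<omega>
  have "r1 \<longlonglongrightarrow> 0"
  proof (rule Lim_null_comparison)
    show "(\<lambda>n. 1 / sqrt (real n) * (3 * f \<theta> * ?g + \<mu>\<^sup>2 * ?g)) \<longlonglongrightarrow> 0" by (rule tendsto_mult_left_zero[OF inv_sqrt])
    have "\<bar>r1 n\<bar> \<le> 1 / sqrt (real n) * (3 * f \<theta> * ?g + \<mu>\<^sup>2 * ?g)" for n
    proof -
      have "\<bar>\<Sum>a=1..n. G a a - f \<theta>\<bar> \<le> (\<Sum>a=1..n. 3 * f \<theta> * \<theta> ^ a)"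
        by (intro order_trans[OF sum_abs sum_mono] start_cov_diag \<theta>0 \<theta>(2))
      also have "\<dots> \<le> 3 * f \<theta> * ?g" unfolding sum_distrib_left[symmetric] using f0 by (intro mult_left_mono geometric_sum_bound) simp
      finally have 1: "\<bar>\<Sum>a=1..n. G a a - f \<theta>\<bar> \<le> 3 * f \<theta> * ?g" .
      have "(\<Sum>a=1..n. (\<theta> ^ a)\<^sup>2) \<le> (\<Sum>a=1..n. \<theta> ^ a)"
        using \<theta> by (intro sum_mono) (simp add: power2_eq_square mult_left_le_one_le power_le_one)
      also have "\<dots> \<le> ?g" by (rule geometric_sum_bound)
      finally have 2: "\<mu>\<^sup>2 * (\<Sum>a=1..n. (\<theta> ^ a)\<^sup>2) \<le> \<mu>\<^sup>2 * ?g" by (intro mult_left_mono) auto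
      have "0 \<le> \<mu>\<^sup>2 * (\<Sum>a=1..n. (\<theta> ^ a)\<^sup>2)" by (intro mult_nonneg_nonneg sum_nonneg) auto
      then have "\<bar>(\<Sum>a=1..n. G a a - f \<theta>) + \<mu>\<^sup>2 * (\<Sum>a=1..n. (\<theta> ^ a)\<^sup>2)\<bar> \<le> 3 * f \<theta> * ?g + \<mu>\<^sup>2 * ?g" using 1 2 by linarith
      then show ?thesis unfolding r1_def distrib_left[symmetric] abs_mult by (intro mult_mono) auto
    qed
    then show "\<forall>\<^sub>F n in sequentially. norm (r1 n) \<le> 1 / sqrt (real n) * (3 * f \<theta> * ?g + \<mu>\<^sup>2 * ?g)" by simp
  qed
  then have v1: "vanishes (\<lambda>n \<omega>. r1 n)" by (rule vanishes_const)
  have v2: "vanishes r2"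
  proof (rule vanishes_L1)
    show i: "integrable M (r2 n)" for n unfolding r2_def by simp
    show "(\<lambda>n. \<integral>\<omega>. \<bar>r2 n \<omega>\<bar> \<partial>M) \<longlonglongrightarrow> 0"
    proof (rule Lim_null_comparison)
      show "(\<lambda>n. 1 / sqrt (real n) * (2 * \<bar>\<mu>\<bar> * (B * ?g))) \<longlonglongrightarrow> 0" by (rule tendsto_mult_left_zero[OF inv_sqrt])
      have "(\<integral>\<omega>. \<bar>r2 n \<omega>\<bar> \<partial>M) \<le> 1 / sqrt (real n) * (2 * \<bar>\<mu>\<bar> * (B * ?g))" for n
      proof -
        have "(\<integral>\<omega>. \<bar>r2 n \<omega>\<bar> \<partial>M) \<le> (\<integral>\<omega>. 1 / sqrt (real n) * (2 * \<bar>\<mu>\<bar> * (\<Sum>a=1..n. \<theta> ^ a * \<bar>W a \<omega>\<bar>)) \<partial>M)"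
        proof (rule integral_mono)
          show "integrable M (\<lambda>\<omega>. \<bar>r2 n \<omega>\<bar>)" using i by simp
          fix \<omega>
          have "\<bar>\<Sum>a=1..n. \<theta> ^ a * W a \<omega>\<bar> \<le> (\<Sum>a=1..n. \<theta> ^ a * \<bar>W a \<omega>\<bar>)"
            by (rule order_trans[OF sum_abs]) (use \<theta> in \<open>simp add: abs_mult\<close>)
          then have le: "2 * \<bar>\<mu>\<bar> * \<bar>\<Sum>a=1..n. \<theta> ^ a * W a \<omega>\<bar> \<le> 2 * \<bar>\<mu>\<bar> * (\<Sum>a=1..n. \<theta> ^ a * \<bar>W a \<omega>\<bar>)" by (intro mult_left_mono) auto
          have "\<bar>r2 n \<omega>\<bar> = 1 / sqrt (real n) * (2 * \<bar>\<mu>\<bar> * \<bar>\<Sum>a=1..n. \<theta> ^ a * W a \<omega>\<bar>)"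
            unfolding r2_def abs_mult abs_minus_cancel by simp
          also have "\<dots> \<le> 1 / sqrt (real n) * (2 * \<bar>\<mu>\<bar> * (\<Sum>a=1..n. \<theta> ^ a * \<bar>W a \<omega>\<bar>))"
            by (rule mult_left_mono[OF le]) simp
          finally show "\<bar>r2 n \<omega>\<bar> \<le> 1 / sqrt (real n) * (2 * \<bar>\<mu>\<bar> * (\<Sum>a=1..n. \<theta> ^ a * \<bar>W a \<omega>\<bar>))" .
        qed simp
        also have "\<dots> = 1 / sqrt (real n) * (2 * \<bar>\<mu>\<bar> * (\<Sum>a=1..n. \<theta> ^ a * (\<integral>\<omega>. \<bar>W a \<omega>\<bar> \<partial>M)))" by simp
        also have "\<dots> \<le> 1 / sqrt (real n) * (2 * \<bar>\<mu>\<bar> * (\<Sum>a=1..n. \<theta> ^ a * B))"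
          using \<theta> B by (intro mult_left_mono sum_mono) auto
        also have "\<dots> \<le> 1 / sqrt (real n) * (2 * \<bar>\<mu>\<bar> * (B * ?g))"
        proof -
          have "(\<Sum>a=1..n. \<theta> ^ a * B) \<le> B * ?g"
            unfolding mult.commute[of _ B] sum_distrib_left[symmetric] by (rule mult_left_mono[OF geometric_sum_bound B(1)])
          then show ?thesis by (intro mult_left_mono) auto
        qed
        finally show ?thesis .
      qed
      then show "\<forall>\<^sub>F n in sequentially. norm (\<integral>\<omega>. \<bar>r2 n \<omega>\<bar> \<partial>M) \<le> 1 / sqrt (real n) * (2 * \<bar>\<mu>\<bar> * (B * ?g))" by simp
    qed
  qed
  have v3: "vanishes r3"
  proof (rule vanishes_L1)
    define S where "S n \<omega> = (\<Sum>a\<in>{1..n}. 1 * W a \<omega>)" for n \<omega>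
    define p where "p n = \<mu> * (\<Sum>a=1..n. \<theta> ^ a)" for n
    have iS: "integrable M (\<lambda>\<omega>. (S n \<omega>)\<^sup>2)" for n unfolding S_def power2_eq_square sum_product by simp
    have iS1: "integrable M (S n)" for n unfolding S_def by simp
    have r3: "r3 n \<omega> = - (sqrt (real n) / (real n)\<^sup>2) * (S n \<omega> - p n)\<^sup>2" for n \<omega>
      unfolding r3_def S_def p_def by (simp add: sum_subtractf sum_distrib_left power_mult_distrib power_divide)
    have sq: "(S n \<omega> - p n)\<^sup>2 = (S n \<omega>)\<^sup>2 - 2 * p n * S n \<omega> + (p n)\<^sup>2" for n \<omega> by (simp add: power2_diff)
    show "integrable M (r3 n)" for n unfolding r3 sq using iS iS1 by simp
    have ES: "(\<integral>\<omega>. (S n \<omega>)\<^sup>2 \<partial>M) = (\<Sum>a=1..n. \<Sum>b=1..n. G a b)" for n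
      unfolding S_def combination_square_expectation[OF finite_atLeastAtMost] by simp
    have le: "(\<integral>\<omega>. \<bar>r3 n \<omega>\<bar> \<partial>M) \<le> (sqrt (real n) / (real n)\<^sup>2) * (2 * (\<Sum>a=1..n. \<Sum>b=1..n. G a b) + 2 * (\<bar>\<mu>\<bar> * ?g)\<^sup>2)" for n
    proof -
      have "(\<integral>\<omega>. \<bar>r3 n \<omega>\<bar> \<partial>M) = (sqrt (real n) / (real n)\<^sup>2) * (\<integral>\<omega>. (S n \<omega> - p n)\<^sup>2 \<partial>M)"
        unfolding r3 by (simp add: abs_mult)
      also have "\<dots> \<le> (sqrt (real n) / (real n)\<^sup>2) * (\<integral>\<omega>. 2 * (S n \<omega>)\<^sup>2 + 2 * (p n)\<^sup>2 \<partial>M)"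
      proof (intro mult_left_mono integral_mono)
        show "integrable M (\<lambda>\<omega>. (S n \<omega> - p n)\<^sup>2)" unfolding sq using iS iS1 by simp
        show "integrable M (\<lambda>\<omega>. 2 * (S n \<omega>)\<^sup>2 + 2 * (p n)\<^sup>2)" using iS by simp
        fix \<omega>
        have "0 \<le> (S n \<omega> + p n)\<^sup>2" by simp
        then show "(S n \<omega> - p n)\<^sup>2 \<le> 2 * (S n \<omega>)\<^sup>2 + 2 * (p n)\<^sup>2" by (simp add: power2_diff power2_sum)
      qed simp
      also have "(\<integral>\<omega>. 2 * (S n \<omega>)\<^sup>2 + 2 * (p n)\<^sup>2 \<partial>M) = 2 * (\<Sum>a=1..n. \<Sum>b=1..n. G a b) + 2 * (p n)\<^sup>2"
        using iS ES by (simp add: prob_space)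
      also have "(sqrt (real n) / (real n)\<^sup>2) * (2 * (\<Sum>a=1..n. \<Sum>b=1..n. G a b) + 2 * (p n)\<^sup>2) \<le> (sqrt (real n) / (real n)\<^sup>2) * (2 * (\<Sum>a=1..n. \<Sum>b=1..n. G a b) + 2 * (\<bar>\<mu>\<bar> * ?g)\<^sup>2)"
      proof -
        have "\<bar>p n\<bar> \<le> \<bar>\<mu>\<bar> * ?g"
          unfolding p_def abs_mult using \<theta> geometric_sum_bound[of n] by (intro mult_left_mono) (auto simp: abs_of_nonneg sum_nonneg)
        from power_mono[OF this abs_ge_zero, of 2] have "(p n)\<^sup>2 \<le> (\<bar>\<mu>\<bar> * ?g)\<^sup>2" by (simp only: power2_abs)
        then show ?thesis by (intro mult_left_mono) auto
      qed
      finally show ?thesis .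
    qed
    show "(\<lambda>n. \<integral>\<omega>. \<bar>r3 n \<omega>\<bar> \<partial>M) \<longlonglongrightarrow> 0"
    proof (rule Lim_null_comparison)
      let ?SG = "\<lambda>n. \<Sum>a=1..n. \<Sum>b=1..n. G a b"
      have th: "(1 - \<theta>)\<^sup>2 > 0" using \<theta> by simp
      have P: "(\<lambda>n. real n powr (2 * H - 3 / 2)) \<longlonglongrightarrow> 0" using H by real_asymp
      have P2: "(\<lambda>n. sqrt (real n) / (real n)\<^sup>2) \<longlonglongrightarrow> 0" by real_asymp
      have "(\<lambda>n. 2 / (1 - \<theta>)\<^sup>2 * (real n powr (2 * H - 3 / 2) * ((1 - \<theta>)\<^sup>2 * ?SG n / real n powr (2 * H))) + sqrt (real n) / (real n)\<^sup>2 * (2 * (\<bar>\<mu>\<bar> * ?g)\<^sup>2))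
        \<longlonglongrightarrow> 2 / (1 - \<theta>)\<^sup>2 * (0 * lin_var) + 0 * (2 * (\<bar>\<mu>\<bar> * ?g)\<^sup>2)"
        by (intro tendsto_add tendsto_mult tendsto_const P P2 G_sum_lim)
      then show "(\<lambda>n. 2 / (1 - \<theta>)\<^sup>2 * (real n powr (2 * H - 3 / 2) * ((1 - \<theta>)\<^sup>2 * ?SG n / real n powr (2 * H))) + sqrt (real n) / (real n)\<^sup>2 * (2 * (\<bar>\<mu>\<bar> * ?g)\<^sup>2)) \<longlonglongrightarrow> 0" by simp
      show "\<forall>\<^sub>F n in sequentially. norm (\<integral>\<omega>. \<bar>r3 n \<omega>\<bar> \<partial>M) \<le> 2 / (1 - \<theta>)\<^sup>2 * (real n powr (2 * H - 3 / 2) * ((1 - \<theta>)\<^sup>2 * ?SG n / real n powr (2 * H))) + sqrt (real n) / (real n)\<^sup>2 * (2 * (\<bar>\<mu>\<bar> * ?g)\<^sup>2)"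
        using eventually_gt_at_top[of 0]
      proof eventually_elim
        case (elim n)
        have "sqrt (real n) / (real n)\<^sup>2 = real n powr (1 / 2) / real n powr 2"
          using elim by (simp add: powr_half_sqrt)
        also have "\<dots> = real n powr (2 * H - 3 / 2) / real n powr (2 * H)"
          unfolding powr_diff[symmetric] by simp
        finally have sc: "sqrt (real n) / (real n)\<^sup>2 = real n powr (2 * H - 3 / 2) / real n powr (2 * H)" .
        have e: "sqrt (real n) / (real n)\<^sup>2 * (2 * ?SG n) = 2 / (1 - \<theta>)\<^sup>2 * (real n powr (2 * H - 3 / 2) * ((1 - \<theta>)\<^sup>2 * ?SG n / real n powr (2 * H)))"
          unfolding sc using th by simp
        show ?case using le[of n] unfolding distrib_left e by simp
      qed
    qed
  qed
  have v: "vanishes (\<lambda>n \<omega>. (r1 n + r2 n \<omega>) + r3 n \<omega>)" by (intro vanishes_add v1 v2 v3)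
  show ?thesis
  proof (rule vanishes_cong[OF v])
    show "(\<lambda>\<omega>. sqrt (real n) * (V n \<omega> - f \<theta>) - Q n \<omega>) \<in> borel_measurable M" for n by measurable
    show "\<forall>\<^sub>F n in sequentially. \<forall>\<omega>\<in>space M. sqrt (real n) * (V n \<omega> - f \<theta>) - Q n \<omega> = r1 n + r2 n \<omega> + r3 n \<omega>"
      using eventually_gt_at_top[of 0]
    proof (eventually_elim, intro ballI)
      fix n :: nat and \<omega> assume n: "0 < n" and \<omega>: "\<omega> \<in> space M"
      have sq: "sqrt (real n) * (1 / real n) = 1 / sqrt (real n)" using n by (simp add: field_simps flip: power2_eq_square)
      have fs: "sqrt (real n) * f \<theta> = 1 / sqrt (real n) * (\<Sum>a=1..n. f \<theta>)" 
      proof -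
        have "1 / sqrt (real n) * (\<Sum>a=1..n. f \<theta>) = real n / sqrt (real n) * f \<theta>" by simp
        then show ?thesis by (simp only: real_div_sqrt of_nat_0_le_iff)
      qed
      have "(\<Sum>a=1..n. (W a \<omega> - \<mu> * \<theta> ^ a)\<^sup>2) = (\<Sum>a=1..n. (W a \<omega>)\<^sup>2) - 2 * \<mu> * (\<Sum>a=1..n. \<theta> ^ a * W a \<omega>) + \<mu>\<^sup>2 * (\<Sum>a=1..n. (\<theta> ^ a)\<^sup>2)"
        by (simp add: power2_diff sum.distrib sum_subtractf sum_distrib_left power_mult_distrib mult_ac)
      then have sV: "sqrt (real n) * V n \<omega> = 1 / sqrt (real n) * ((\<Sum>a=1..n. (W a \<omega>)\<^sup>2) - 2 * \<mu> * (\<Sum>a=1..n. \<theta> ^ a * W a \<omega>) + \<mu>\<^sup>2 * (\<Sum>a=1..n. (\<theta> ^ a)\<^sup>2)) + r3 n \<omega>"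
        unfolding sample_variance_eq[OF n \<omega>] r3_def right_diff_distrib mult.assoc[symmetric] sq by simp
      have "sqrt (real n) * (V n \<omega> - f \<theta>) = 1 / sqrt (real n) * ((\<Sum>a=1..n. (W a \<omega>)\<^sup>2) - 2 * \<mu> * (\<Sum>a=1..n. \<theta> ^ a * W a \<omega>) + \<mu>\<^sup>2 * (\<Sum>a=1..n. (\<theta> ^ a)\<^sup>2)) + r3 n \<omega> - 1 / sqrt (real n) * (\<Sum>a=1..n. f \<theta>)"
        unfolding right_diff_distrib[of "sqrt (real n)"] fs sV ..
      then show "sqrt (real n) * (V n \<omega> - f \<theta>) - Q n \<omega> = r1 n + r2 n \<omega> + r3 n \<omega>"
        unfolding Q_def r1_def r2_def sum_subtractf by (simp add: algebra_simps)
    qed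
  qed
qed

section \<open>Limits of the normalized estimation errors\<close>

definition G1 where "G1 n \<omega> = sqrt (real n) * (theta_hat M \<xi> X n \<omega> - \<theta>)"
definition G2 where "G2 n \<omega> = real n powr (1 - H) * (alpha_hat M \<xi> X n \<omega> - \<alpha>)"
definition theta_var where "theta_var = 2 * \<tau> / (deriv f \<theta>)\<^sup>2"

lemma theta_hat_measurable [measurable]: "theta_hat M \<xi> X n \<in> borel_measurable M"
  unfolding theta_hat_eq[abs_def] by measurable

lemma G1_measurable [measurable]: "G1 n \<in> borel_measurable M" unfolding G1_def by measurable
lemma G2_measurable [measurable]: "G2 n \<in> borel_measurable M" unfolding G2_def alpha_hat_def by measurable

lemma theta_var_pos: "theta_var > 0" unfolding theta_var_def using \<tau>_pos f_deriv by simp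

text \<open>The linear form is carried along unchanged while the quadratic form is replaced by the
  scaled sample variance and then by the scaled error of its inverse image. The delta method needs
  tightness, which follows from the marginal limit at t = 0.\<close>

lemma joint_char_G1_L: 
  "(\<lambda>n. \<integral>\<omega>. iexp (s * G1 n \<omega> + t * L n \<omega>) \<partial>M) \<longlonglongrightarrow> exp (- (theta_var * s\<^sup>2 + lin_var * t\<^sup>2) / 2)"
proof -
  define Z where "Z n \<omega> = sqrt (real n) * (V n \<omega> - f \<theta>)" for n \<omega>
  have [measurable]: "Z n \<in> borel_measurable M" for n unfolding Z_def by measurable
  have ZL: "(\<lambda>n. \<integral>\<omega>. iexp (s * Z n \<omega> + t * L n \<omega>) \<partial>M) \<longlonglongrightarrow> exp (- (s\<^sup>2 * \<tau>) - t\<^sup>2 * lin_var / 2)" for s t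
  proof -
    have "(\<lambda>n. \<integral>\<omega>. iexp ((s * Q n \<omega> + t * L n \<omega>) + s * (sqrt (real n) * (V n \<omega> - f \<theta>) - Q n \<omega>)) \<partial>M) \<longlonglongrightarrow> exp (- (s\<^sup>2 * \<tau>) - t\<^sup>2 * lin_var / 2)"
      by (rule vanishes_char[OF _ vanishes_scale[OF variance_remainder_vanishes] joint_char_QL]) measurable
    moreover have "(s * Q n \<omega> + t * L n \<omega>) + s * (sqrt (real n) * (V n \<omega> - f \<theta>) - Q n \<omega>) = s * Z n \<omega> + t * L n \<omega>" for n \<omega>
      by (simp add: Z_def algebra_simps)
    ultimately show ?thesis by (simp only:)
  qed
  \<comment> \<open>The limit exp (- s^2 \<tau>) belongs to variance 2 \<tau>; this is the factor 2
    in \<open>sigma_H_sq\<close>.\<close>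
  have "weak_conv_m (\<lambda>n. distr M borel (Z n)) (normal_law 0 (2 * \<tau>))"
  proof (rule char_imp_weak_conv)
    show "real_distribution (normal_law 0 (2 * \<tau>))" using \<tau>_pos by (intro real_distribution_normal_law) simp
    show "(\<lambda>n. \<integral>\<omega>. iexp (s * Z n \<omega>) \<partial>M) \<longlonglongrightarrow> char (normal_law 0 (2 * \<tau>)) s" for s
      using ZL[of s 0] \<tau>_pos by (simp add: char_normal_law mult.commute)
  qed simp
  then have tight: "tight_rvs Z"
    using \<tau>_pos by (intro weak_conv_imp_tight[OF _ real_distribution_normal_law]) auto
  have sq: "filterlim (\<lambda>n. sqrt (real n)) at_top sequentially" by real_asymp
  have d: "vanishes (\<lambda>n \<omega>. sqrt (real n) * (g (V n \<omega>) - g (f \<theta>)) - inverse (deriv f \<theta>) * (sqrt (real n) * (V n \<omega> - f \<theta>)))"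
    by (rule delta_method[OF V_measurable g_measurable sq g_deriv]) (rule tight[unfolded Z_def])
  let ?d = "inverse (deriv f \<theta>)"
  have "(\<lambda>n. \<integral>\<omega>. iexp ((s * ?d * Z n \<omega> + t * L n \<omega>) + s * (sqrt (real n) * (g (V n \<omega>) - g (f \<theta>)) - ?d * (sqrt (real n) * (V n \<omega> - f \<theta>)))) \<partial>M)
     \<longlonglongrightarrow> exp (- ((s * ?d)\<^sup>2 * \<tau>) - t\<^sup>2 * lin_var / 2)"
    by (rule vanishes_char[OF _ vanishes_scale[OF d] ZL]) measurable
  moreover have "(s * ?d * Z n \<omega> + t * L n \<omega>) + s * (sqrt (real n) * (g (V n \<omega>) - g (f \<theta>)) - ?d * (sqrt (real n) * (V n \<omega> - f \<theta>))) = s * G1 n \<omega> + t * L n \<omega>" for n \<omega>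
    unfolding G1_def theta_hat_eq g_f Z_def by (simp add: algebra_simps)
  moreover have "- ((s * ?d)\<^sup>2 * \<tau>) - t\<^sup>2 * lin_var / 2 = - (theta_var * s\<^sup>2 + lin_var * t\<^sup>2) / 2"
    by (simp add: theta_var_def power_mult_distrib field_simps)
  ultimately show ?thesis by (simp only:)
qed

lemma G1_weak_conv: "weak_conv_m (\<lambda>n. distr M borel (G1 n)) (normal_law 0 theta_var)"
proof (rule char_imp_weak_conv)
  show "real_distribution (normal_law 0 theta_var)" using theta_var_pos by (intro real_distribution_normal_law) simp
  show "(\<lambda>n. \<integral>\<omega>. iexp (s * G1 n \<omega>) \<partial>M) \<longlonglongrightarrow> char (normal_law 0 theta_var) s" for s
    using joint_char_G1_L[of s 0] theta_var_pos by (simp add: char_normal_law)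
qed simp

text \<open>The error of the \<alpha>-estimator is the linear form, minus the geometric drift of
  order \<open>n powr (-H)\<close>, minus the \<theta>-error times the sample mean. Rescaling the
  last term from the square root of n to \<open>n powr (1 - H)\<close> gives the factor
  \<open>n powr (1/2 - H)\<close>, which tends to 0 because H > 1/2.\<close>

lemma G2_remainder_vanishes: "vanishes (\<lambda>n \<omega>. G2 n \<omega> - L n \<omega>)"
proof -
  have tight: "tight_rvs (\<lambda>n \<omega>. G1 n \<omega> * sample_mean X n \<omega>)"
    using theta_var_pos by (intro tight_rvs_mult weak_conv_imp_tight[OF _ real_distribution_normal_law G1_weak_conv] sample_mean_tight) auto
  have "(\<lambda>n. - (real n powr (1 / 2 - H))) \<longlonglongrightarrow> 0" using H by real_asymp
  from tight_rvs_null_mult[OF tight this]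
  have v1: "vanishes (\<lambda>n \<omega>. - (real n powr (1 / 2 - H)) * (G1 n \<omega> * sample_mean X n \<omega>))" .
  have "(\<lambda>n. - (real n powr (- H) * \<alpha> * (\<Sum>a=1..n. \<theta> ^ a))) \<longlonglongrightarrow> 0"
  proof (rule Lim_null_comparison)
    have "(\<lambda>n. real n powr (- H)) \<longlonglongrightarrow> 0" using H by real_asymp
    then show "(\<lambda>n. real n powr (- H) * (\<bar>\<alpha>\<bar> * (1 / (1 - \<theta>)))) \<longlonglongrightarrow> 0" by (rule tendsto_mult_left_zero)
    have "\<bar>- (real n powr (- H) * \<alpha> * (\<Sum>a=1..n. \<theta> ^ a))\<bar> \<le> real n powr (- H) * (\<bar>\<alpha>\<bar> * (1 / (1 - \<theta>)))" for n
      unfolding abs_minus_cancel abs_mult mult.assoc using \<theta> geometric_sum_bound[of n]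
      by (intro mult_mono) (auto simp: abs_of_nonneg sum_nonneg)
    then show "\<forall>\<^sub>F n in sequentially. norm (- (real n powr (- H) * \<alpha> * (\<Sum>a=1..n. \<theta> ^ a))) \<le> real n powr (- H) * (\<bar>\<alpha>\<bar> * (1 / (1 - \<theta>)))" by simp
  qed
  then have v2: "vanishes (\<lambda>n \<omega>. - (real n powr (- H) * \<alpha> * (\<Sum>a=1..n. \<theta> ^ a)))" by (rule vanishes_const)
  show ?thesis
  proof (rule vanishes_cong[OF vanishes_add[OF v1 v2]])
    show "(\<lambda>\<omega>. G2 n \<omega> - L n \<omega>) \<in> borel_measurable M" for n by measurable
    show "\<forall>\<^sub>F n in sequentially. \<forall>\<omega>\<in>space M. G2 n \<omega> - L n \<omega> = - (real n powr (1 / 2 - H)) * (G1 n \<omega> * sample_mean X n \<omega>) + - (real n powr (- H) * \<alpha> * (\<Sum>a=1..n. \<theta> ^ a))"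
      using eventually_gt_at_top[of 0]
    proof (eventually_elim, intro ballI)
      fix n :: nat and \<omega> assume n: "0 < n" and \<omega>: "\<omega> \<in> space M"
      let ?th = "theta_hat M \<xi> X n \<omega>" and ?m = "sample_mean X n \<omega>" and ?h = "real n powr (1 - H)"
      have a: "\<mu> * (1 - \<theta>) = \<alpha>" using \<theta> by (simp add: \<mu>_def)
      have "real n * ?m = (\<Sum>a=1..n. W a \<omega>) + real n * \<mu> - \<mu> * (\<Sum>a=1..n. \<theta> ^ a)"
        unfolding sample_mean_eq[OF \<omega>] using n by (simp add: sum.distrib sum_subtractf right_diff_distrib sum_distrib_left)
      then have "(1 - \<theta>) * (real n * ?m) = (1 - \<theta>) * (\<Sum>a=1..n. W a \<omega>) + real n * (\<mu> * (1 - \<theta>)) - \<mu> * (1 - \<theta>) * (\<Sum>a=1..n. \<theta> ^ a)"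
        by (simp only:) (simp add: algebra_simps)
      then have m: "real n * ((1 - \<theta>) * ?m - \<alpha>) = (1 - \<theta>) * (\<Sum>a=1..n. W a \<omega>) - \<alpha> * (\<Sum>a=1..n. \<theta> ^ a)"
        unfolding a by (simp add: algebra_simps)
      have h1: "?h = real n powr (- H) * real n" using n powr_add[of "real n" "- H" 1] by simp
      have h2: "?h = real n powr (1 / 2 - H) * sqrt (real n)"
        using n powr_add[of "real n" "1 / 2 - H" "1 / 2"] by (simp add: powr_half_sqrt)
      have g: "G2 n \<omega> = ?h * ((1 - \<theta>) * ?m - \<alpha>) - ?h * ((?th - \<theta>) * ?m)"
        unfolding G2_def alpha_hat_def by (simp add: algebra_simps)
      have "?h * ((1 - \<theta>) * ?m - \<alpha>) = real n powr (- H) * ((1 - \<theta>) * (\<Sum>a=1..n. W a \<omega>) - \<alpha> * (\<Sum>a=1..n. \<theta> ^ a))"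
        unfolding h1 mult.assoc m ..
      also have "\<dots> = L n \<omega> - real n powr (- H) * \<alpha> * (\<Sum>a=1..n. \<theta> ^ a)" unfolding L_def by (simp add: algebra_simps)
      finally have l: "?h * ((1 - \<theta>) * ?m - \<alpha>) = L n \<omega> - real n powr (- H) * \<alpha> * (\<Sum>a=1..n. \<theta> ^ a)" .
      have k: "?h * ((?th - \<theta>) * ?m) = real n powr (1 / 2 - H) * (G1 n \<omega> * ?m)" unfolding h2 G1_def by (simp only: mult_ac)
      show "G2 n \<omega> - L n \<omega> = - (real n powr (1 / 2 - H)) * (G1 n \<omega> * ?m) + - (real n powr (- H) * \<alpha> * (\<Sum>a=1..n. \<theta> ^ a))"
        unfolding g l k by simp
    qed
  qed
qed

lemma joint_char_G1_G2:
  "(\<lambda>n. \<integral>\<omega>. iexp (s * G1 n \<omega> + t * G2 n \<omega>) \<partial>M) \<longlonglongrightarrow> exp (- (theta_var * s\<^sup>2 + lin_var * t\<^sup>2) / 2)"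
proof -
  have "(\<lambda>n. \<integral>\<omega>. iexp ((s * G1 n \<omega> + t * L n \<omega>) + t * (G2 n \<omega> - L n \<omega>)) \<partial>M) \<longlonglongrightarrow> exp (- (theta_var * s\<^sup>2 + lin_var * t\<^sup>2) / 2)"
    by (rule vanishes_char[OF _ vanishes_scale[OF G2_remainder_vanishes] joint_char_G1_L]) measurable
  moreover have "(s * G1 n \<omega> + t * L n \<omega>) + t * (G2 n \<omega> - L n \<omega>) = s * G1 n \<omega> + t * G2 n \<omega>" for n \<omega>
    by (simp add: algebra_simps)
  ultimately show ?thesis by (simp only:)
qed

lemma G2_weak_conv: "weak_conv_m (\<lambda>n. distr M borel (G2 n)) (normal_law 0 lin_var)"
proof (rule char_imp_weak_conv)
  show "real_distribution (normal_law 0 lin_var)" using lin_var_pos by (intro real_distribution_normal_law) simp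
  show "(\<lambda>n. \<integral>\<omega>. iexp (s * G2 n \<omega>) \<partial>M) \<longlonglongrightarrow> char (normal_law 0 lin_var) s" for s
    using joint_char_G1_G2[of 0 s] lin_var_pos by (simp add: char_normal_law)
qed simp

lemma G1_G2_converges_in_law:
  "converges_in_law M (\<lambda>n \<omega>. vector [G1 n \<omega>, G2 n \<omega>] :: real^2)
     (mv_normal_law (vector [vector [theta_var, 0], vector [0, lin_var]]))"
proof (rule weak_conv_vec2[where \<mu> = "normal_law 0 theta_var" and \<nu> = "normal_law 0 lin_var"])
  show "real_distribution (normal_law 0 theta_var)" "real_distribution (normal_law 0 lin_var)"
    using theta_var_pos lin_var_pos by (auto intro: real_distribution_normal_law)
  show "(\<integral>x. h (x $ 1) * k (x $ 2) \<partial>mv_normal_law (vector [vector [theta_var, 0], vector [0, lin_var]] :: real^2^2)) = (\<integral>x. h x \<partial>normal_law 0 theta_var) * (\<integral>x. k x \<partial>normal_law 0 lin_var)"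
    if "continuous_on UNIV h" "continuous_on UNIV k" "bounded (range h)" "bounded (range k)" for h k :: "real \<Rightarrow> real"
    using that by (intro integral_mv_normal_law_diag theta_var_pos lin_var_pos borel_measurable_continuous_onI)
  show "(\<lambda>n. \<integral>\<omega>. iexp (s * G1 n \<omega> + t * G2 n \<omega>) \<partial>M) \<longlonglongrightarrow> char (normal_law 0 theta_var) s * char (normal_law 0 lin_var) t" for s t
  proof -
    have "exp (- (theta_var * s\<^sup>2 + lin_var * t\<^sup>2) / 2) = exp (- (theta_var * s\<^sup>2 / 2)) * exp (- (lin_var * t\<^sup>2 / 2))"
      unfolding exp_add[symmetric] by (simp add: add_divide_distrib)
    then have "complex_of_real (exp (- (theta_var * s\<^sup>2 + lin_var * t\<^sup>2) / 2)) = char (normal_law 0 theta_var) s * char (normal_law 0 lin_var) t"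
      using theta_var_pos lin_var_pos by (simp only: char_normal_law of_real_mult less_imp_le) simp
    then show ?thesis using joint_char_G1_G2[of s t] by (simp only:)
  qed
qed (use prob_space_axioms prob_space_mv_normal_law_diag[OF theta_var_pos lin_var_pos] sets_mv_normal_law_diag[OF theta_var_pos lin_var_pos] in auto)

section \<open>Identification of the limit variances\<close>

lemma sigma_H_sq_eq: "sigma_H_sq M \<xi> \<theta> / (deriv f \<theta>)\<^sup>2 = theta_var"
  by (simp add: sigma_H_sq_def theta_var_def \<tau>_def)

text \<open>Euler's reflection formula at 2H - 1: the two arguments of the Beta function add up to
  1, so it equals pi divided by the sine that multiplies it. The sine is positive since 2H - 1 lies
  strictly between 0 and 1/2.\<close>

lemma sigma_1_sq_eq: "C * sigma_1_sq H = lin_var"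
proof -
  let ?x = "2 * H - 1"
  have "Beta ?x (1 - ?x) = pi / sin (pi * ?x)"
  proof -
    have "complex_of_real (Gamma ?x * Gamma (1 - ?x)) = Gamma (complex_of_real ?x) * Gamma (1 - complex_of_real ?x)"
      unfolding of_real_mult Gamma_complex_of_real[symmetric] of_real_diff of_real_1 ..
    also have "\<dots> = complex_of_real pi / sin (complex_of_real pi * complex_of_real ?x)"
      by (rule Gamma_reflection_complex)
    also have "\<dots> = complex_of_real (pi / sin (pi * ?x))"
      unfolding of_real_divide sin_of_real[symmetric] of_real_mult ..
    finally have "Gamma ?x * Gamma (1 - ?x) = pi / sin (pi * ?x)" by (simp only: of_real_eq_iff)
    then show ?thesis by (simp add: Beta_def)
  qed
  moreover have "sin (pi * ?x) > 0" using H by (intro sin_gt_zero) auto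
  ultimately have B: "Beta ?x (1 - ?x) * sin (pi * ?x) = pi" by simp
  have e: "2 - 2 * H = 1 - ?x" "2 * pi * H - pi = pi * ?x" by (simp_all add: algebra_simps)
  have "C * sigma_1_sq H = C * (inverse (H * ?x) * (inverse pi * (Beta ?x (1 - ?x) * sin (pi * ?x))))"
    unfolding sigma_1_sq_def e by (simp only: mult.assoc)
  also have "\<dots> = lin_var" unfolding B lin_var_def by (simp add: divide_inverse)
  finally show ?thesis .
qed

end

text \<open>The variance for the \<alpha>-estimator carries the factor C because the covariance
  asymptotics are normalized by C. Nonvanishing of the derivative is assumed explicitly: strict
  monotonicity allows isolated zeros of a derivative, and the limit variance divides by its
  square.\<close>

theorem theorem1p3:
  fixes M :: "'a measure"
    and \<xi> :: "int \<Rightarrow> 'a \<Rightarrow> real"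
    and X :: "nat \<Rightarrow> 'a \<Rightarrow> real"
    and f :: "real \<Rightarrow> real"
    and G1 G2 :: "nat \<Rightarrow> 'a \<Rightarrow> real"
    and \<alpha> \<theta> H C :: real
  assumes M: "prob_space M"
    and \<theta>: "0 < \<theta>" "\<theta> < 1"
    and H: "1 / 2 < H" "H < 3 / 4"
    and C: "0 < C"
    and gaussian: "gaussian_seq M \<xi>"
    and stationary: "stationary_seq M \<xi>"
    and zero_mean: "\<And>t. (\<integral>\<omega>. \<xi> t \<omega> \<partial>M) = 0"
    and long_memory: "autocov M \<xi> \<sim>[at_top] (\<lambda>k. C * \<bar>real_of_int k\<bar> powr (2 * H - 2))"
    and X_0: "\<And>\<omega>. \<omega> \<in> space M \<Longrightarrow> X 0 \<omega> = 0"
    and X_Suc: "\<And>t \<omega>. \<omega> \<in> space M \<Longrightarrow> X (Suc t) \<omega> = \<alpha> + \<theta> * X t \<omega> + \<xi> (int (Suc t)) \<omega>"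
    and f: "f = second_moment M \<xi>"
    and f_pos: "\<And>x. x \<in> {0<..<1} \<Longrightarrow> 0 < f x"
    and f_mono: "strict_mono_on {0<..<1} f"
    and f_deriv: "deriv f \<theta> \<noteq> 0"
    and G1: "G1 = (\<lambda>n \<omega>. sqrt (real n) * (theta_hat M \<xi> X n \<omega> - \<theta>))"
    and G2: "G2 = (\<lambda>n \<omega>. real n powr (1 - H) * (alpha_hat M \<xi> X n \<omega> - \<alpha>))"
  shows "weak_conv_m (\<lambda>n. distr M borel (G1 n))
           (normal_law 0 (sigma_H_sq M \<xi> \<theta> / (deriv f \<theta>)\<^sup>2)) \<and>
         weak_conv_m (\<lambda>n. distr M borel (G2 n)) (normal_law 0 (C * sigma_1_sq H)) \<and>
         converges_in_law M (\<lambda>n \<omega>. vector [G1 n \<omega>, G2 n \<omega>] :: real^2)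
           (mv_normal_law (vector [vector [sigma_H_sq M \<xi> \<theta> / (deriv f \<theta>)\<^sup>2, 0],
                                   vector [0, C * sigma_1_sq H]]))"
proof -
  interpret prob_space M by (rule M)
  interpret ar: long_memory_ar M \<xi> H C X \<alpha> \<theta>
    using long_memory_noise_axioms.intro[OF H C gaussian stationary zero_mean long_memory]
      long_memory_ar_axioms.intro[OF \<theta> X_0 X_Suc f_pos[unfolded f] f_mono[unfolded f] f_deriv[unfolded f]]
    by (simp only: long_memory_ar_def long_memory_noise_def M simp_thms)
  have "G1 = ar.G1" "G2 = ar.G2" unfolding G1 G2 ar.G1_def[abs_def] ar.G2_def[abs_def] by (rule refl)+
  then show ?thesis
    unfolding f ar.sigma_H_sq_eq ar.sigma_1_sq_eq
    by (simp only: ar.G1_weak_conv ar.G2_weak_conv ar.G1_G2_converges_in_law simp_thms)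
qed

end
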